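(* Let $n\ge 1$, let $\eta$ be a composition in $\mathbb{Z}_{\ge 0}^n$ and let $i\in\{1,\dots,n\}$. For $I=\{t_1,\dots,t_s\}\subseteq\{1,\dots,n\}$ with $1\le t_1<\dots<t_s\le n$ and $I\ne\emptyset$, let $$\widetilde B_I(z):=\left(qz_{t_1}-t^{-n+1}\right)\prod_{u=1}^{s}\ \prod_{j=t_{u-1}+1}^{t_u-1}\widehat b(z_{t_u},z_j)\ \prod_{j=t_s+1}^{n}\widehat b(qz_{t_1},z_j),\qquad t_0:=0,$$ and, for $i\in I$, $$\widetilde\chi_I^{\{i\}}(z):=\begin{cases}\dfrac{z_i}{\widehat a(z_i,z_{t_{k+1}})}, & i=t_k,\ k=1,\dots,s-1,\\[2mm] \dfrac{z_i}{\widehat a(z_i,qz_{t_1})}, & i=t_s.\end{cases}$$ Then $$z_iE_\eta(z;q^{-1},t^{-1})=\sum_{I\in\mathbb{J}_\eta^I,\ i\in I}\frac{\widetilde\chi_I^{\{i\}}(\overline\eta)\,A_I(\overline\eta)\,\widetilde B_I(\overline\eta)\,k_\eta}{k_{c_I(\eta)}}\,E_{c_I(\eta)}(z;q^{-1},t^{-1}).$$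
   Context: Polynomials are in $z=(z_1,\dots,z_n)$ over $\mathbb{Q}(q,t)$, with $q,t$ indeterminates. A composition is $\eta=(\eta_1,\dots,\eta_n)\in\mathbb{Z}_{\ge0}^n$; $|\eta|=\sum_i\eta_i$; $z^\eta=z_1^{\eta_1}\cdots z_n^{\eta_n}$. Put $$l'_\eta(i)=\#\{j<i:\eta_j\ge\eta_i\}+\#\{j>i:\eta_j>\eta_i\},\quad \overline\eta_i=q^{\eta_i}t^{-l'_\eta(i)},\quad \overline\eta=(\overline\eta_1,\dots,\overline\eta_n).$$ Empty products equal 1. Nonsymmetric Macdonald polynomials: let $s_i$ exchange $z_i$ and $z_{i+1}$ in a function, $(\tau_1f)(z)=f(qz_1,z_2,\dots,z_n)$, $\omega=s_{n-1}\cdots s_1\tau_1$, $T_i=t+\frac{tz_i-z_{i+1}}{z_i-z_{i+1}}(s_i-1)$, $Y_i=t^{-n+i}T_i\cdots T_{n-1}\,\omega\, T_1^{-1}\cdots T_{i-1}^{-1}$ ($1\le i\le n$). $E_\eta(z;q,t)$ is the unique polynomial with $Y_iE_\eta=\overline\eta_iE_\eta$ for all $i$ and of the form $z^\eta+\sum_{\nu\prec\eta}b_{\eta\nu}z^\nu$. Here, for $|\mu|=|\eta|$, $\mu\prec\eta$ iff $\mu^+<\eta^+$, or $\mu^+=\eta^+$ and $\mu<\eta$; $\eta^+$ is the partition obtained by permuting the parts of $\eta$, and $\mu<\eta$ means $\mu\neq\eta$ and $\sum_{i=1}^p(\eta_i-\mu_i)\ge0$ for all $1\le p\le n$. $E_\eta(z;q^{-1},t^{-1})$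 is obtained by replacing $q,t$ by $q^{-1},t^{-1}$ in the coefficients. Functions: $\widehat a(x,y)=\frac{(t-1)x}{x-y}$, $\widehat b(x,y)=\frac{x-ty}{x-y}$, and for $I=\{t_1<\dots<t_s\}$, $A_I(z)=\widehat a\left(\frac{z_{t_s}}q,z_{t_1}\right)\prod_{u=1}^{s-1}\widehat a(z_{t_u},z_{t_{u+1}})$. Maximal sets: a nonempty $I=\{t_1<\dots<t_s\}\subseteq\{1,\dots,n\}$ is maximal with respect to $\eta$ iff (1) $\eta_j\ne\eta_{t_u}$ for $j=t_{u-1}+1,\dots,t_u-1$ and $u=1,\dots,s$ (with $t_0:=0$), and (2) $\eta_j\neq\eta_{t_1}+1$ for $j=t_s+1,\dots,n$. $\mathbb{J}^I_\eta$ is the set of all $I$ maximal with respect to $\eta$. The composition $c_I(\eta)$ is defined by $(c_I(\eta))_{t_k}=\eta_{t_{k+1}}$ for $k=1,\dots,s-1$, $(c_I(\eta))_{t_s}=\eta_{t_1}+1$, $(c_I(\eta))_j=\eta_j$ for $j\notin I$. Constants: $k_\eta=\left(\prod_{i=1}^n\overline\eta_i^{\,\eta_i}\right)d'_\eta(q^{-1},t^{-1})$ with $d'_\eta(q^{-1},t^{-1})=\prod_{(i,j):\,1\le i\le n,\,1\le j\le\eta_i}\left(1-q^{-a_\eta(i,j)-1}t^{-l_\eta(i,j)}\right)$, $a_\eta(i,j)=\eta_i-j$, $l_\eta(i,j)=\#\{k>i: j\le\eta_k\le\eta_i\}+\#\{k<i: j\le\eta_k+1\le\eta_i\}$. *)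

theory Defs
  imports "HOL-Library.Poly_Mapping" "HOL-Computational_Algebra.Computational_Algebra"
    "HOL-Computational_Algebra.Field_as_Ring"
begin

text \<open>
  Operators and polynomials are defined over an arbitrary field with parameters \<open>q\<close>, \<open>t\<close>;
  they are used over \<open>\<rat>(q,t)\<close>, realised as the fraction field of \<open>\<rat>[t][q]\<close>:
  \<open>q_var\<close> is the outer indeterminate and \<open>t_var\<close> the inner one.
\<close>

type_synonym ratfun_qt = "rat poly poly fract"

definition q_var :: ratfun_qt where "q_var = to_fract [:0, 1:]"

definition t_var :: ratfun_qt where "t_var = to_fract [:[:0, 1:]:]"

definition eval_qt :: "rat poly poly \<Rightarrow> ratfun_qt \<Rightarrow> ratfun_qt \<Rightarrow> ratfun_qt" where
  "eval_qt p x y =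
     poly (map_poly (\<lambda>r. poly (map_poly (\<lambda>c. to_fract [:[:c:]:]) r) y) p) x"

text \<open>The substitution \<open>q \<mapsto> q\<^sup>-\<^sup>1\<close>, \<open>t \<mapsto> t\<^sup>-\<^sup>1\<close> in a rational function, performed in its reduced fraction.\<close>

definition invert_qt :: "ratfun_qt \<Rightarrow> ratfun_qt" where
  "invert_qt x =
     (let (a, b) = quot_of_fract x
      in eval_qt a (inverse q_var) (inverse t_var) / eval_qt b (inverse q_var) (inverse t_var))"


text \<open>
  Polynomials have variables \<open>z\<^sub>j\<close> for all natural numbers \<open>j\<close>; only \<open>z\<^sub>1, \<dots>, z\<^sub>n\<close> matter.
  A composition is a function supported in \<open>{1..n}\<close>.
\<close>

type_synonym 'a mpoly = "(nat \<Rightarrow>\<^sub>0 nat) \<Rightarrow>\<^sub>0 'a"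

definition Const :: "'a::field \<Rightarrow> 'a mpoly" where
  "Const c = Poly_Mapping.single 0 c"

definition zvar :: "nat \<Rightarrow> 'a::field mpoly" where
  "zvar j = Poly_Mapping.single (Poly_Mapping.single j 1) 1"

definition zpow :: "nat \<Rightarrow> (nat \<Rightarrow> nat) \<Rightarrow> 'a::field mpoly" where
  "zpow n \<eta> = (\<Prod>j=1..n. zvar j ^ \<eta> j)"

definition subst_vars :: "(nat \<Rightarrow> 'a::field mpoly) \<Rightarrow> 'a mpoly \<Rightarrow> 'a mpoly" where
  "subst_vars \<sigma> f = (\<Sum>m\<in>Poly_Mapping.keys f.
      Const (Poly_Mapping.lookup f m) * (\<Prod>j\<in>Poly_Mapping.keys m. \<sigma> j ^ Poly_Mapping.lookup m j))"

definition compositions :: "nat \<Rightarrow> (nat \<Rightarrow> nat) set" where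
  "compositions n = {\<eta>. \<forall>j. j \<notin> {1..n} \<longrightarrow> \<eta> j = 0}"

definition csize :: "nat \<Rightarrow> (nat \<Rightarrow> nat) \<Rightarrow> nat" where
  "csize n \<eta> = (\<Sum>j=1..n. \<eta> j)"

definition lprime :: "nat \<Rightarrow> (nat \<Rightarrow> nat) \<Rightarrow> nat \<Rightarrow> nat" where
  "lprime n \<eta> i = card {j \<in> {1..<i}. \<eta> j \<ge> \<eta> i} + card {j \<in> {i<..n}. \<eta> j > \<eta> i}"

definition eta_bar :: "nat \<Rightarrow> 'a::field \<Rightarrow> 'a \<Rightarrow> (nat \<Rightarrow> nat) \<Rightarrow> nat \<Rightarrow> 'a" where
  "eta_bar n q t \<eta> i = q ^ \<eta> i * t powi (- int (lprime n \<eta> i))"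

definition dom_less :: "nat \<Rightarrow> (nat \<Rightarrow> nat) \<Rightarrow> (nat \<Rightarrow> nat) \<Rightarrow> bool" where
  "dom_less n \<mu> \<eta> \<longleftrightarrow> \<mu> \<noteq> \<eta> \<and> (\<forall>p\<in>{1..n}. (\<Sum>i=1..p. int (\<eta> i) - int (\<mu> i)) \<ge> 0)"

definition comp_plus :: "nat \<Rightarrow> (nat \<Rightarrow> nat) \<Rightarrow> nat \<Rightarrow> nat" where
  "comp_plus n \<eta> j =
     (if j \<in> {1..n} then rev (sort (map \<eta> [1..<Suc n])) ! (j - 1) else 0)"

definition comp_prec :: "nat \<Rightarrow> (nat \<Rightarrow> nat) \<Rightarrow> (nat \<Rightarrow> nat) \<Rightarrow> bool" where
  "comp_prec n \<mu> \<eta> \<longleftrightarrow> csize n \<mu> = csize n \<eta> \<and>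
     (dom_less n (comp_plus n \<mu>) (comp_plus n \<eta>) \<or>
      comp_plus n \<mu> = comp_plus n \<eta> \<and> dom_less n \<mu> \<eta>)"


definition s_op :: "nat \<Rightarrow> 'a::field mpoly \<Rightarrow> 'a mpoly" where
  "s_op i = subst_vars (\<lambda>j. if j = i then zvar (i + 1) else if j = i + 1 then zvar i else zvar j)"

definition tau_op :: "'a::field \<Rightarrow> 'a mpoly \<Rightarrow> 'a mpoly" where
  "tau_op q = subst_vars (\<lambda>j. if j = 1 then Const q * zvar 1 else zvar j)"

definition omega_op :: "nat \<Rightarrow> 'a::field \<Rightarrow> 'a mpoly \<Rightarrow> 'a mpoly" where
  "omega_op n q f = foldr s_op (rev [1..<n]) (tau_op q f)"

text \<open>
  The description operator is the exact quotient \<open>(s\<^sub>i f - f) / (z\<^sub>i - z\<^sub>i\<^sub>+\<^sub>1)\<close> in the polynomial ring.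
\<close>

definition T_op :: "'a::field \<Rightarrow> nat \<Rightarrow> 'a mpoly \<Rightarrow> 'a mpoly" where
  "T_op t i f = Const t * f +
     (Const t * zvar i - zvar (i + 1)) * (THE g. (zvar i - zvar (i + 1)) * g = s_op i f - f)"

definition Y_op :: "nat \<Rightarrow> 'a::field \<Rightarrow> 'a \<Rightarrow> nat \<Rightarrow> 'a mpoly \<Rightarrow> 'a mpoly" where
  "Y_op n q t i f = Const (t powi (int i - int n)) *
     foldr (T_op t) [i..<n] (omega_op n q (foldr (\<lambda>j. inv (T_op t j)) [1..<i] f))"

definition is_macdonald ::
    "nat \<Rightarrow> 'a::field \<Rightarrow> 'a \<Rightarrow> (nat \<Rightarrow> nat) \<Rightarrow> 'a mpoly \<Rightarrow> bool" where
  "is_macdonald n q t \<eta> E \<longleftrightarrow>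
     (\<forall>i\<in>{1..n}. Y_op n q t i E = Const (eta_bar n q t \<eta> i) * E) \<and>
     (\<exists>b. E = zpow n \<eta> +
        (\<Sum>\<nu> | \<nu> \<in> compositions n \<and> comp_prec n \<nu> \<eta>. Const (b \<nu>) * zpow n \<nu>))"

definition macdonald :: "nat \<Rightarrow> (nat \<Rightarrow> nat) \<Rightarrow> ratfun_qt mpoly" where
  "macdonald n \<eta> = (THE E. is_macdonald n q_var t_var \<eta> E)"

text \<open>\<open>E\<^sub>\<eta>(z; q\<^sup>-\<^sup>1, t\<^sup>-\<^sup>1)\<close>\<close>

definition macdonald_inv :: "nat \<Rightarrow> (nat \<Rightarrow> nat) \<Rightarrow> ratfun_qt mpoly" where
  "macdonald_inv n \<eta> = Poly_Mapping.map invert_qt (macdonald n \<eta>)"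


definition a_hat :: "'a::field \<Rightarrow> 'a \<Rightarrow> 'a \<Rightarrow> 'a" where
  "a_hat t x y = (t - 1) * x / (x - y)"

definition b_hat :: "'a::field \<Rightarrow> 'a \<Rightarrow> 'a \<Rightarrow> 'a" where
  "b_hat t x y = (x - t * y) / (x - y)"

text \<open>
  For \<open>I = {t\<^sub>1 < \<dots> < t\<^sub>s}\<close>: \<open>elt I u = t\<^sub>u\<close> for \<open>1 \<le> u \<le> s\<close>, and \<open>elt I 0 = 0\<close>;
  \<open>idx\<close> is the inverse, \<open>idx I t\<^sub>k = k\<close>.
\<close>

definition elt :: "nat set \<Rightarrow> nat \<Rightarrow> nat" where
  "elt I u = (0 # sorted_list_of_set I) ! u"

definition idx :: "nat set \<Rightarrow> nat \<Rightarrow> nat" where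
  "idx I i = card {x \<in> I. x \<le> i}"

definition A_coef :: "'a::field \<Rightarrow> 'a \<Rightarrow> nat set \<Rightarrow> (nat \<Rightarrow> 'a) \<Rightarrow> 'a" where
  "A_coef q t I z = a_hat t (z (elt I (card I)) / q) (z (elt I 1)) *
     (\<Prod>u\<in>{1..<card I}. a_hat t (z (elt I u)) (z (elt I (u + 1))))"

definition B_coef :: "nat \<Rightarrow> 'a::field \<Rightarrow> 'a \<Rightarrow> nat set \<Rightarrow> (nat \<Rightarrow> 'a) \<Rightarrow> 'a" where
  "B_coef n q t I z = (q * z (elt I 1) - t powi (- int n + 1)) *
     (\<Prod>u\<in>{1..card I}. \<Prod>j\<in>{elt I (u - 1)<..<elt I u}. b_hat t (z (elt I u)) (z j)) *
     (\<Prod>j\<in>{elt I (card I)<..n}. b_hat t (q * z (elt I 1)) (z j))"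

definition chi_coef :: "'a::field \<Rightarrow> 'a \<Rightarrow> nat set \<Rightarrow> nat \<Rightarrow> (nat \<Rightarrow> 'a) \<Rightarrow> 'a" where
  "chi_coef q t I i z =
     (if idx I i < card I then z i / a_hat t (z i) (z (elt I (idx I i + 1)))
      else z i / a_hat t (z i) (q * z (elt I 1)))"

definition maximal_sets :: "nat \<Rightarrow> (nat \<Rightarrow> nat) \<Rightarrow> nat set set" where
  "maximal_sets n \<eta> = {I. I \<noteq> {} \<and> I \<subseteq> {1..n} \<and>
     (\<forall>u\<in>{1..card I}. \<forall>j\<in>{elt I (u - 1)<..<elt I u}. \<eta> j \<noteq> \<eta> (elt I u)) \<and>
     (\<forall>j\<in>{elt I (card I)<..n}. \<eta> j \<noteq> \<eta> (elt I 1) + 1)}"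

definition c_comp :: "nat set \<Rightarrow> (nat \<Rightarrow> nat) \<Rightarrow> nat \<Rightarrow> nat" where
  "c_comp I \<eta> j =
     (if j \<notin> I then \<eta> j
      else if idx I j < card I then \<eta> (elt I (idx I j + 1))
      else \<eta> (elt I 1) + 1)"

definition arm :: "(nat \<Rightarrow> nat) \<Rightarrow> nat \<Rightarrow> nat \<Rightarrow> nat" where
  "arm \<eta> i j = \<eta> i - j"

definition leg :: "nat \<Rightarrow> (nat \<Rightarrow> nat) \<Rightarrow> nat \<Rightarrow> nat \<Rightarrow> nat" where
  "leg n \<eta> i j = card {k \<in> {i<..n}. j \<le> \<eta> k \<and> \<eta> k \<le> \<eta> i} +
     card {k \<in> {1..<i}. j \<le> \<eta> k + 1 \<and> \<eta> k + 1 \<le> \<eta> i}"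

text \<open>\<open>d'\<^sub>\<eta>(q\<^sup>-\<^sup>1, t\<^sup>-\<^sup>1)\<close>\<close>

definition dprime_inv :: "nat \<Rightarrow> 'a::field \<Rightarrow> 'a \<Rightarrow> (nat \<Rightarrow> nat) \<Rightarrow> 'a" where
  "dprime_inv n q t \<eta> = (\<Prod>i\<in>{1..n}. \<Prod>j\<in>{1..\<eta> i}.
     1 - q powi (- int (arm \<eta> i j) - 1) * t powi (- int (leg n \<eta> i j)))"

definition k_const :: "nat \<Rightarrow> 'a::field \<Rightarrow> 'a \<Rightarrow> (nat \<Rightarrow> nat) \<Rightarrow> 'a" where
  "k_const n q t \<eta> = (\<Prod>i\<in>{1..n}. eta_bar n q t \<eta> i ^ \<eta> i) * dprime_inv n q t \<eta>"

end

(*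
  The polynomials E_eta are built from 1 by the intertwiners T_k - const, which exchange two entries
  of eta, and the creation operator Phi = z_n omega, which sends eta to (eta_2, ..., eta_n, eta_1 + 1).
  Both respect the affine Bruhat order, hence triangularity, and uniqueness holds because the joint
  spectrum of the Y_i is simple.

  With all operators at the inverted parameters 1/q, 1/t,
    z_i = T_i^-1 ... T_(n-1)^-1 Phi Y_1^-1 (t T_1) ... (t T_(i-1)).
  Each Hecke factor acts on E_eta / k_eta by two terms: it keeps eta, with a coefficient a_hat, or
  exchanges two entries, with a coefficient b_hat. The normalisation by k_eta makes b_hat independent
  of which of the two entries is larger, and the exchange term is absent if they are equal. Expanding
  the product, the positions where the entry is kept form, together with i, a set I; equal entries
  force a position into I, which is the maximality condition. The factors a_hat(y, x) of the first
  i - 1 steps turn into a_hat(x, y) up to a product y / x that telescopes with the eigenvalue of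
  Y_1^-1 to z_i.
*)
theory Submission
  imports Defs
begin

section \<open>Substitutions and linear operators on polynomials\<close>

text \<open>The coefficients are values at the spectral vector of the original eta, although the
  operators pass through many intermediate compositions. This works because a Hecke step exchanges
  only distinct entries, and then eigenvalues move together with entries. So pairs (entry,
  eigenvalue) are transported as rigid objects and every coefficient is read off at the start. Only
  \<open>Phi\<close> alters a pair, adding one to the entry and multiplying the eigenvalue by q;
  this is the source of the arguments q z_{t_1}. The factor q z_{t_1} - t^(1-n) of B_I is that new
  eigenvalue times the one box factor which \<open>Phi\<close> adds to d'.

  The statement speaks of inverted coefficients, while uniqueness concerns eigenvectors. The bridge
  is that inversion is a field homomorphism carrying the defining conditions at (q, t) to those at
  (1/q, 1/t). The theory is therefore developed over any field with multiplicatively independent q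
  and t, a condition stable under inversion, and used at both parameter pairs.\<close>

lemma Const_0 [simp]: "Const 0 = 0"
  and Const_1 [simp]: "Const 1 = 1"
  and Const_add [simp]: "Const (a + b) = Const a + Const b"
  and Const_diff [simp]: "Const (a - b) = Const a - Const b"
  and Const_mult [simp]: "Const (a * b) = Const a * Const b"
  by (simp_all add: Const_def single_add single_diff mult_single)

lemma Const_uminus [simp]: "Const (- a) = - Const a"
  by (metis Const_0 Const_diff diff_0)

lemma Const_eq_iff [simp]: "Const a = Const b \<longleftrightarrow> a = b"
  by (metis Const_def lookup_single_eq)

lemma Const_eq_0_iff [simp]: "Const a = 0 \<longleftrightarrow> a = 0"
  using Const_eq_iff[of a 0] by (simp del: Const_eq_iff)

lemma Const_inverse_cancel: "c \<noteq> 0 \<Longrightarrow> Const c * (Const (inverse c) * f) = f"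
  "c \<noteq> 0 \<Longrightarrow> Const (inverse c) * (Const c * f) = f"
  by (simp_all add: mult.assoc[symmetric] Const_mult[symmetric] del: Const_mult)

lemma zvar_eq_iff [simp]: "(zvar i :: 'a::field mpoly) = zvar j \<longleftrightarrow> i = j"
  unfolding zvar_def
  by (metis lookup_single_eq lookup_single_not_eq one_neq_zero)

lemma poly_mapping_sum_single:
  "f = (\<Sum>m\<in>Poly_Mapping.keys f. Poly_Mapping.single m (Poly_Mapping.lookup f m))"
proof (rule poly_mapping_eqI)
  fix k
  have "Poly_Mapping.lookup (\<Sum>m\<in>Poly_Mapping.keys f. Poly_Mapping.single m (Poly_Mapping.lookup f m)) k
      = (\<Sum>m\<in>Poly_Mapping.keys f. if m = k then Poly_Mapping.lookup f k else 0)"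
    unfolding lookup_sum by (rule sum.cong) (auto simp: lookup_single when_def)
  also have "\<dots> = Poly_Mapping.lookup f k"
    by (simp add: sum.delta in_keys_iff)
  finally show "Poly_Mapping.lookup f k = Poly_Mapping.lookup
      (\<Sum>m\<in>Poly_Mapping.keys f. Poly_Mapping.single m (Poly_Mapping.lookup f m)) k" ..
qed

lemma poly_mapping_additive_induct [case_names zero single add]:
  fixes f :: "'k \<Rightarrow>\<^sub>0 'b::comm_monoid_add"
  assumes "P 0" "\<And>m c. P (Poly_Mapping.single m c)" "\<And>f g. P f \<Longrightarrow> P g \<Longrightarrow> P (f + g)"
  shows "P f"
proof -
  have "P (\<Sum>m\<in>S. Poly_Mapping.single m (c m))" if "finite S" for S and c :: "'k \<Rightarrow> 'b"
    using that by induction (auto intro: assms)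
  then show ?thesis
    using poly_mapping_sum_single[of f] by (metis finite_keys)
qed

lemma zvar_power: "zvar j ^ k = Poly_Mapping.single (Poly_Mapping.single j k) 1"
  by (induction k) (simp_all add: zvar_def mult_single single_add[symmetric])

text \<open>Constants and variables generate the polynomial ring; properties stable under sums and
  products are reduced to these generators.\<close>

lemma mpoly_induct [case_names Const zvar add mult]:
  fixes f :: "'a::field mpoly"
  assumes C: "\<And>c. P (Const c)" and Z: "\<And>j. P (zvar j)"
    and A: "\<And>f g. P f \<Longrightarrow> P g \<Longrightarrow> P (f + g)" and M: "\<And>f g. P f \<Longrightarrow> P g \<Longrightarrow> P (f * g)"
  shows "P f"
proof -
  have one: "P 1" using C[of 1] by simp
  have pow: "P (zvar j ^ k)" for j k
    by (induction k) (auto intro: one Z M)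
  have mon: "P (Poly_Mapping.single m 1)" for m
  proof (induction m rule: poly_mapping_additive_induct)
    case zero then show ?case using one by simp
  next
    case (single j k) then show ?case using pow[of j k] by (simp add: zvar_power)
  next
    case (add a b)
    then show ?case using M[OF add] by (simp add: mult_single)
  qed
  show ?thesis
  proof (induction f rule: poly_mapping_additive_induct)
    case zero then show ?case using C[of 0] by simp
  next
    case (single m c)
    show ?case using M[OF C[of c] mon[of m]] by (simp add: Const_def mult_single)
  qed (rule A)
qed

definition mon_subst :: "(nat \<Rightarrow> 'a::field mpoly) \<Rightarrow> (nat \<Rightarrow>\<^sub>0 nat) \<Rightarrow> 'a mpoly" where
  "mon_subst \<sigma> m = (\<Prod>j\<in>Poly_Mapping.keys m. \<sigma> j ^ Poly_Mapping.lookup m j)"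

text \<open>\<open>subst_vars\<close> and \<open>mon_subst\<close> run over supports, which vary
  with the argument. On a common finite superset the extra exponents are 0 and contribute the factor
  1, so both sides of an additivity law can be compared termwise.\<close>

lemma mon_subst_superset:
  assumes "finite S" "Poly_Mapping.keys m \<subseteq> S"
  shows "mon_subst \<sigma> m = (\<Prod>j\<in>S. \<sigma> j ^ Poly_Mapping.lookup m j)"
  unfolding mon_subst_def
  by (rule prod.mono_neutral_left) (use assms in \<open>auto simp: in_keys_iff\<close>)

lemma mon_subst_add: "mon_subst \<sigma> (m + m') = mon_subst \<sigma> m * mon_subst \<sigma> m'"
  using keys_add[of m m']
  by (simp add: mon_subst_superset[where S = "Poly_Mapping.keys m \<union> Poly_Mapping.keys m'"]
      lookup_add power_add prod.distrib)

lemma subst_vars_superset: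
  assumes "finite S" "Poly_Mapping.keys f \<subseteq> S"
  shows "subst_vars \<sigma> f = (\<Sum>m\<in>S. Const (Poly_Mapping.lookup f m) * mon_subst \<sigma> m)"
  unfolding subst_vars_def mon_subst_def
  by (rule sum.mono_neutral_left) (use assms in \<open>auto simp: in_keys_iff\<close>)

lemma subst_vars_add: "subst_vars \<sigma> (f + g) = subst_vars \<sigma> f + subst_vars \<sigma> g"
  using keys_add[of f g]
  by (simp add: subst_vars_superset[where S = "Poly_Mapping.keys f \<union> Poly_Mapping.keys g"]
      lookup_add sum.distrib distrib_right)

lemma subst_vars_single: "subst_vars \<sigma> (Poly_Mapping.single m c) = Const c * mon_subst \<sigma> m"
  by (simp add: subst_vars_superset[where S = "{m}"])

lemma subst_vars_0 [simp]: "subst_vars \<sigma> 0 = 0"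
  by (simp add: subst_vars_def)

lemma subst_vars_mult: "subst_vars \<sigma> (f * g) = subst_vars \<sigma> f * subst_vars \<sigma> g"
proof (induction f rule: poly_mapping_additive_induct)
  case (single m c)
  show ?case
    by (induction g rule: poly_mapping_additive_induct)
      (simp_all add: mult_single subst_vars_single mon_subst_add subst_vars_add distrib_left mult.assoc mult.left_commute)
qed (simp_all add: subst_vars_add distrib_right)

lemma subst_vars_Const [simp]: "subst_vars \<sigma> (Const c) = Const c"
  by (simp add: Const_def subst_vars_single) (simp add: mon_subst_def Const_def)

lemma subst_vars_1 [simp]: "subst_vars \<sigma> 1 = 1"
  using subst_vars_Const[of \<sigma> 1] by (simp del: subst_vars_Const)

lemma subst_vars_zvar [simp]: "subst_vars \<sigma> (zvar j) = \<sigma> j"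
  by (simp add: zvar_def subst_vars_single) (simp add: mon_subst_def)

lemma subst_vars_uminus: "subst_vars \<sigma> (- f) = - subst_vars \<sigma> f"
  using subst_vars_mult[of \<sigma> "Const (-1)" f] subst_vars_Const[of \<sigma> "- 1"]
  by (simp del: subst_vars_Const)

lemma subst_vars_diff: "subst_vars \<sigma> (f - g) = subst_vars \<sigma> f - subst_vars \<sigma> g"
  using subst_vars_add[of \<sigma> f "- g"] by (simp add: subst_vars_uminus)

lemmas subst_vars_hom = subst_vars_add subst_vars_diff subst_vars_mult subst_vars_uminus

lemma subst_vars_comp:
  "subst_vars \<sigma> (subst_vars \<rho> f) = subst_vars (\<lambda>j. subst_vars \<sigma> (\<rho> j)) f"
  by (induction f rule: mpoly_induct) (simp_all add: subst_vars_hom)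

section \<open>Linear operators and their comparison\<close>

definition lin_op :: "('a::field mpoly \<Rightarrow> 'a mpoly) \<Rightarrow> bool" where
  "lin_op F \<longleftrightarrow> (\<forall>f g. F (f + g) = F f + F g) \<and> (\<forall>c f. F (Const c * f) = Const c * F f)"

lemma lin_op_add: "lin_op F \<Longrightarrow> F (f + g) = F f + F g"
  and lin_op_scale: "lin_op F \<Longrightarrow> F (Const c * f) = Const c * F f"
  by (simp_all add: lin_op_def)

lemma lin_op_0: "lin_op F \<Longrightarrow> F 0 = 0"
  using lin_op_scale[of F 0 0] by simp

lemma lin_op_uminus: "lin_op F \<Longrightarrow> F (- f) = - F f"
  using lin_op_scale[of F "-1" f] by simp

lemma lin_op_diff: "lin_op F \<Longrightarrow> F (f - g) = F f - F g"
  using lin_op_add[of F f "- g"] by (simp add: lin_op_uminus)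

lemmas lin_op_simps = lin_op_add lin_op_scale lin_op_uminus lin_op_diff lin_op_0

lemma lin_op_sum: "lin_op F \<Longrightarrow> F (sum h S) = (\<Sum>x\<in>S. F (h x))"
  by (induction S rule: infinite_finite_induct) (simp_all add: lin_op_simps)

lemma lin_op_subst_vars: "lin_op (subst_vars \<sigma>)"
  by (simp add: lin_op_def subst_vars_hom)

lemma lin_op_mult: "lin_op G \<Longrightarrow> lin_op (\<lambda>f. h * G f)"
  by (simp add: lin_op_def algebra_simps)

lemma lin_op_id: "lin_op (\<lambda>f. f)"
  by (simp add: lin_op_def)

lemma lin_op_compose: "lin_op F \<Longrightarrow> lin_op G \<Longrightarrow> lin_op (\<lambda>f. F (G f))"
  by (simp add: lin_op_def)

lemma lin_op_plus: "lin_op F \<Longrightarrow> lin_op G \<Longrightarrow> lin_op (\<lambda>f. F f + G f)"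
  by (simp add: lin_op_def algebra_simps)

lemma lin_op_foldr: "(\<And>x. x \<in> set xs \<Longrightarrow> lin_op (F x)) \<Longrightarrow> lin_op (foldr F xs)"
proof (induction xs)
  case Nil
  then show ?case by (simp add: lin_op_def)
next
  case (Cons x xs)
  then show ?case using lin_op_compose[of "F x" "foldr F xs"] by (simp add: o_def)
qed

text \<open>Every polynomial arises from 1 by linear combinations and multiplication by variables.
  Relations between operators thus follow from the rules for moving an operator past one variable,
  without dividing by z_i - z_(i+1).\<close>

lemma lin_op_eqI:
  assumes F: "lin_op F" and G: "lin_op G" and one: "F 1 = G 1"
    and step: "\<And>f j. F f = G f \<Longrightarrow> F (zvar j * f) = G (zvar j * f)"
  shows "F f = G f"
proof -
  \<comment> \<open>Stated for an arbitrary right factor \<open>g\<close> on which the operators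
    agree, so that a product is absorbed one factor at a time; the claim is the case
    \<open>g = 1\<close>.\<close>
  have "F g = G g \<Longrightarrow> F (f * g) = G (f * g)" for g
  proof (induction f arbitrary: g rule: mpoly_induct)
    case (add f h)
    then show ?case using F G by (simp add: distrib_right lin_op_simps)
  next
    case (mult f h)
    then show ?case by (simp add: mult.assoc)
  qed (use F G step in \<open>simp_all add: lin_op_simps\<close>)
  from this[of 1] one show ?thesis by simp
qed

section \<open>The Demazure--Lusztig operators\<close>

definition swap_idx :: "nat \<Rightarrow> nat \<Rightarrow> nat" where
  "swap_idx i j = (if j = i then Suc i else if j = Suc i then i else j)"

lemma s_op_eq: "s_op i = subst_vars (\<lambda>j. zvar (swap_idx i j))"
  unfolding s_op_def swap_idx_def by (rule arg_cong[where f = subst_vars]) auto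

lemma s_op_zvar [simp]: "s_op i (zvar j) = zvar (swap_idx i j)"
  by (simp add: s_op_eq)

lemma s_op_hom: "s_op i (f + g) = s_op i f + s_op i g" "s_op i (f * g) = s_op i f * s_op i g"
  "s_op i (f - g) = s_op i f - s_op i g" "s_op i (Const c) = Const c" "s_op i 1 = 1"
  by (simp_all add: s_op_eq subst_vars_hom)

lemma ex_divided_difference: "\<exists>g. (zvar i - zvar (Suc i)) * g = s_op i f - f"
proof (induction f rule: mpoly_induct)
  case (Const c)
  then show ?case by (auto simp: s_op_hom intro: exI[of _ 0])
next
  case (zvar j)
  show ?case
    by (rule exI[of _ "if j = i then -1 else if j = Suc i then 1 else 0"]) (auto simp: swap_idx_def)
next
  case (add f g)
  then obtain a b where "(zvar i - zvar (Suc i)) * a = s_op i f - f"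
    "(zvar i - zvar (Suc i)) * b = s_op i g - g" by blast
  then have "(zvar i - zvar (Suc i)) * (a + b) = s_op i (f + g) - (f + g)"
    by (simp add: s_op_hom distrib_left)
  then show ?case by blast
next
  case (mult f g)
  then obtain a b where "(zvar i - zvar (Suc i)) * a = s_op i f - f"
    "(zvar i - zvar (Suc i)) * b = s_op i g - g" by blast
  note ab = this
  \<comment> \<open>The quotient for a product comes from the twisted Leibniz rule D(f g) = D(f)
    s_i(g) + f D(g) of divided differences.\<close>
  have "(zvar i - zvar (Suc i)) * (a * s_op i g + f * b) =
      (zvar i - zvar (Suc i)) * a * s_op i g + f * ((zvar i - zvar (Suc i)) * b)"
    by (simp add: algebra_simps)
  also have "\<dots> = s_op i (f * g) - f * g"
    unfolding ab s_op_hom by (simp add: algebra_simps)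
  finally have "(zvar i - zvar (Suc i)) * (a * s_op i g + f * b) = s_op i (f * g) - f * g" .
  then show ?case by blast
qed

text \<open>The polynomial ring is a domain and the two variables differ. Equations for
  \<open>T_op\<close> are proved by multiplying with this difference and cancelling it.\<close>

lemma zvar_diff_cancel:
  assumes "(zvar i - zvar (Suc i)) * f = (zvar i - zvar (Suc i)) * g"
  shows "f = g"
  using assms by simp

text \<open>The defining formula of T_i with its denominator cleared. Existence of the quotient and
  cancellation make the definite description meaningful here; all later properties of
  \<open>T_op\<close> rest on this equation.\<close>

lemma T_op_mult_diff:
  "(zvar i - zvar (Suc i)) * T_op t i f =
    (zvar i - zvar (Suc i)) * Const t * f + (Const t * zvar i - zvar (Suc i)) * (s_op i f - f)"
proof -
  obtain g where g: "(zvar i - zvar (Suc i)) * g = s_op i f - f"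
    using ex_divided_difference by blast
  have "(THE g. (zvar i - zvar (Suc i)) * g = s_op i f - f) = g"
    proof (rule the_equality)
    fix h assume "(zvar i - zvar (Suc i)) * h = s_op i f - f"
    with g show "h = g" by (metis zvar_diff_cancel)
  qed (rule g)
  then have "T_op t i f = Const t * f + (Const t * zvar i - zvar (Suc i)) * g"
    by (simp add: T_op_def)
  then show ?thesis
    by (simp only: g[symmetric]) (simp add: algebra_simps)
qed

lemma lin_op_T_op [simp]: "lin_op (T_op t i)"
  unfolding lin_op_def
proof (intro conjI allI)
  fix f g :: "'a mpoly" and c
  show "T_op t i (f + g) = T_op t i f + T_op t i g"
    by (rule zvar_diff_cancel[of i], unfold distrib_left T_op_mult_diff s_op_hom) (simp add: algebra_simps)
  have "(zvar i - zvar (Suc i)) * T_op t i (Const c * f) = Const c * ((zvar i - zvar (Suc i)) * T_op t i f)"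
    unfolding T_op_mult_diff s_op_hom by (simp add: algebra_simps)
  also have "\<dots> = (zvar i - zvar (Suc i)) * (Const c * T_op t i f)"
    by (rule mult.left_commute)
  finally show "T_op t i (Const c * f) = Const c * T_op t i f"
    by (rule zvar_diff_cancel)
qed

lemma lin_op_T_op_comp: "lin_op G \<Longrightarrow> lin_op (\<lambda>f. T_op t i (G f))"
  by (rule lin_op_compose[OF lin_op_T_op])

lemmas T_op_lin [simp] = lin_op_simps[OF lin_op_T_op]

lemma T_op_1 [simp]: "T_op t i 1 = Const t"
  by (rule zvar_diff_cancel[of i], unfold T_op_mult_diff s_op_hom) simp

lemma T_op_Const [simp]: "T_op t i (Const c) = Const c * Const t"
  using T_op_lin(2)[of t i c 1] by simp

text \<open>Together with \<open>T_op_zvar_left\<close> and \<open>T_op_zvar_right\<close> these are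
  the cross relations of T_i with multiplication by a variable, the input for the inductive step of
  \<open>lin_op_eqI\<close>.\<close>

lemma T_op_zvar_other:
  assumes "j \<noteq> i" "j \<noteq> Suc i"
  shows "T_op t i (zvar j * f) = zvar j * T_op t i f"
proof (rule zvar_diff_cancel[of i])
  have "(zvar i - zvar (Suc i)) * (zvar j * T_op t i f) = zvar j * ((zvar i - zvar (Suc i)) * T_op t i f)"
    by (simp add: algebra_simps)
  then show "(zvar i - zvar (Suc i)) * T_op t i (zvar j * f) = (zvar i - zvar (Suc i)) * (zvar j * T_op t i f)"
    using assms by (simp only: T_op_mult_diff) (simp add: s_op_hom swap_idx_def algebra_simps)
qed

lemma T_op_zvar_left:
  "T_op t i (zvar i * f) = zvar (Suc i) * T_op t i f + (1 - Const t) * zvar (Suc i) * f"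
proof (rule zvar_diff_cancel[of i])
  have "(zvar i - zvar (Suc i)) * (zvar (Suc i) * T_op t i f + (1 - Const t) * zvar (Suc i) * f) =
     zvar (Suc i) * ((zvar i - zvar (Suc i)) * T_op t i f) + (zvar i - zvar (Suc i)) * ((1 - Const t) * zvar (Suc i) * f)"
    by (simp add: algebra_simps)
  then show "(zvar i - zvar (Suc i)) * T_op t i (zvar i * f) =
      (zvar i - zvar (Suc i)) * (zvar (Suc i) * T_op t i f + (1 - Const t) * zvar (Suc i) * f)"
    by (simp only: T_op_mult_diff) (simp add: s_op_hom swap_idx_def algebra_simps)
qed

lemma T_op_zvar_right:
  "T_op t i (zvar (Suc i) * f) = zvar i * T_op t i f + (Const t - 1) * zvar (Suc i) * f"
proof (rule zvar_diff_cancel[of i])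
  have "(zvar i - zvar (Suc i)) * (zvar i * T_op t i f + (Const t - 1) * zvar (Suc i) * f) =
     zvar i * ((zvar i - zvar (Suc i)) * T_op t i f) + (zvar i - zvar (Suc i)) * ((Const t - 1) * zvar (Suc i) * f)"
    by (simp add: algebra_simps)
  then show "(zvar i - zvar (Suc i)) * T_op t i (zvar (Suc i) * f) =
      (zvar i - zvar (Suc i)) * (zvar i * T_op t i f + (Const t - 1) * zvar (Suc i) * f)"
    by (simp only: T_op_mult_diff) (simp add: s_op_hom swap_idx_def algebra_simps)
qed

text \<open>The Hecke relation (T_i - t)(T_i + 1) = 0, from which the explicit inverse
  \<open>T_inv\<close> is read off.\<close>

lemma T_op_quadratic: "T_op t i (T_op t i f) = (Const t - 1) * T_op t i f + Const t * f"
proof (rule lin_op_eqI[where F = "\<lambda>f. T_op t i (T_op t i f)" and G = "\<lambda>f. (Const t - 1) * T_op t i f + Const t * f"])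
  fix f j
  assume IH: "T_op t i (T_op t i f) = (Const t - 1) * T_op t i f + Const t * f"
  have scale: "T_op t i ((1 - Const t) * g) = (1 - Const t) * T_op t i g"
    "T_op t i ((Const t - 1) * g) = (Const t - 1) * T_op t i g" for g
    using T_op_lin(2)[of t i "1 - t" g] T_op_lin(2)[of t i "t - 1" g] by simp_all
  consider "j = i" | "j = Suc i" | "j \<noteq> i" "j \<noteq> Suc i" by blast
  then show "T_op t i (T_op t i (zvar j * f)) = (Const t - 1) * T_op t i (zvar j * f) + Const t * (zvar j * f)"
  proof cases
    case 1
    then show ?thesis using IH
      by (simp add: T_op_zvar_left T_op_zvar_right scale mult.assoc) (simp add: algebra_simps)
  next
    case 2
    then show ?thesis using IH
      by (simp add: T_op_zvar_left T_op_zvar_right scale mult.assoc) (simp add: algebra_simps)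
  next
    case 3
    then show ?thesis using IH
      by (simp add: T_op_zvar_other) (simp add: algebra_simps)
  qed
next
  show "lin_op (\<lambda>f. T_op t i (T_op t i f))"
    by (intro lin_op_T_op_comp lin_op_id)
next
  show "lin_op (\<lambda>f. (Const t - 1) * T_op t i f + Const t * f)"
    by (intro lin_op_plus lin_op_mult lin_op_T_op lin_op_id)
qed (simp add: algebra_simps)

lemma T_op_commute:
  assumes "i + 1 < j"
  shows "T_op t i (T_op t j f) = T_op t j (T_op t i f)"
proof (rule lin_op_eqI[where F = "\<lambda>f. T_op t i (T_op t j f)" and G = "\<lambda>f. T_op t j (T_op t i f)"])
  fix f k
  assume IH: "T_op t i (T_op t j f) = T_op t j (T_op t i f)"
  have scale: "T_op t i ((1 - Const t) * g) = (1 - Const t) * T_op t i g"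
    "T_op t i ((Const t - 1) * g) = (Const t - 1) * T_op t i g" for g i
    using T_op_lin(2)[of t i "1 - t" g] T_op_lin(2)[of t i "t - 1" g] by simp_all
  consider "k = i" | "k = Suc i" | "k = j" | "k = Suc j" | "k \<noteq> i" "k \<noteq> Suc i" "k \<noteq> j" "k \<noteq> Suc j"
    by fastforce
  then show "T_op t i (T_op t j (zvar k * f)) = T_op t j (T_op t i (zvar k * f))"
    using assms IH
    by cases (simp_all add: T_op_zvar_other T_op_zvar_left T_op_zvar_right scale mult.assoc)
next
  show "lin_op (\<lambda>f. T_op t i (T_op t j f))" "lin_op (\<lambda>f. T_op t j (T_op t i f))"
    by (intro lin_op_T_op_comp lin_op_id)+
qed (simp add: mult.commute)

lemma T_op_braid:
  "T_op t i (T_op t (Suc i) (T_op t i f)) = T_op t (Suc i) (T_op t i (T_op t (Suc i) f))"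
proof -
  \<comment> \<open>The operators, the variables and 1 - t stay folded, so that \<open>r\<close> and
    \<open>c\<close> act as rewrite rules moving variables and scalars to the left, while
    \<open>q\<close> removes repeated operators.\<close>
  define T1 where "T1 = T_op t i"
  define T2 where "T2 = T_op t (Suc i)"
  define x where "x = (zvar i :: 'a mpoly)"
  define y where "y = (zvar (Suc i) :: 'a mpoly)"
  define w where "w = (zvar (Suc (Suc i)) :: 'a mpoly)"
  define c where "c = 1 - Const t"
  have l: "lin_op T1" "lin_op T2" by (simp_all add: T1_def T2_def)
  note ls = lin_op_simps[OF l(1)] lin_op_simps[OF l(2)]
  have c: "T1 (c * g) = c * T1 g" "T2 (c * g) = c * T2 g" for g
    using ls(2)[of "1 - t" g] ls(7)[of "1 - t" g] by (simp_all add: c_def)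
  have r: "T1 (x * g) = y * T1 g + c * (y * g)" "T1 (y * g) = x * T1 g - c * (y * g)" "T1 (w * g) = w * T1 g"
       "T2 (x * g) = x * T2 g" "T2 (y * g) = w * T2 g + c * (w * g)" "T2 (w * g) = y * T2 g - c * (w * g)"
    for g
    using T_op_zvar_left[of t i g] T_op_zvar_right[of t i g] T_op_zvar_other[of "Suc (Suc i)" i t g]
      T_op_zvar_other[of i "Suc i" t g] T_op_zvar_left[of t "Suc i" g] T_op_zvar_right[of t "Suc i" g]
    by (simp_all add: T1_def T2_def x_def y_def w_def c_def algebra_simps)
  have q: "T1 (T1 g) = g - c * g - c * T1 g" "T2 (T2 g) = g - c * g - c * T2 g" for g
    by (simp_all add: T1_def T2_def c_def T_op_quadratic algebra_simps)
  have "T1 (T2 (T1 f)) = T2 (T1 (T2 f))"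
  proof (rule lin_op_eqI[where F = "\<lambda>f. T1 (T2 (T1 f))" and G = "\<lambda>f. T2 (T1 (T2 f))"])
    fix f j
    assume IH: "T1 (T2 (T1 f)) = T2 (T1 (T2 f))"
    consider "j = i" | "j = Suc i" | "j = Suc (Suc i)" | "j \<noteq> i" "j \<noteq> Suc i" "j \<noteq> Suc (Suc i)" by blast
    then show "T1 (T2 (T1 (zvar j * f))) = T2 (T1 (T2 (zvar j * f)))"
    proof cases
      case 1
      then have "zvar j = x" by (simp add: x_def)
      then show ?thesis using IH by (simp add: r c q ls) (simp add: algebra_simps)
    next
      case 2
      then have "zvar j = y" by (simp add: y_def)
      then show ?thesis using IH by (simp add: r c q ls) (simp add: algebra_simps)
    next
      case 3
      then have "zvar j = w" by (simp add: w_def)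
      then show ?thesis using IH by (simp add: r c q ls) (simp add: algebra_simps)
    next
      case 4
      then show ?thesis using IH by (simp add: T1_def T2_def T_op_zvar_other)
    qed
  next
    show "T1 (T2 (T1 1)) = T2 (T1 (T2 1))" by (simp add: T1_def T2_def)
  next
  show "lin_op (\<lambda>f. T1 (T2 (T1 f)))" "lin_op (\<lambda>f. T2 (T1 (T2 f)))"
    unfolding T1_def T2_def by (intro lin_op_T_op_comp lin_op_id)+
qed
  then show ?thesis by (simp add: T1_def T2_def)
qed

text \<open>The quadratic relation T_i^2 = (t - 1) T_i + t solved for the inverse. Being a linear
  expression in T_i, it is visibly linear and inherits the commutation rules of T_i.\<close>

definition T_inv :: "'a::field \<Rightarrow> nat \<Rightarrow> 'a mpoly \<Rightarrow> 'a mpoly" where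
  "T_inv t i f = Const (inverse t) * (T_op t i f + (1 - Const t) * f)"

lemma T_op_one_minus: "T_op t i ((1 - Const t) * g) = (1 - Const t) * T_op t i g"
  using T_op_lin(2)[of t i "1 - t" g] by simp

lemma T_op_T_inv [simp]: "t \<noteq> 0 \<Longrightarrow> T_op t i (T_inv t i f) = f"
  and T_inv_T_op [simp]: "t \<noteq> 0 \<Longrightarrow> T_inv t i (T_op t i f) = f"
proof -
  assume t: "t \<noteq> 0"
  have "T_op t i (T_op t i f) + (1 - Const t) * T_op t i f = Const t * f"
    by (simp add: T_op_quadratic algebra_simps)
  then show "T_op t i (T_inv t i f) = f" "T_inv t i (T_op t i f) = f"
    using t by (simp_all add: T_inv_def T_op_one_minus Const_inverse_cancel)
qed

lemma inv_T_op: "t \<noteq> 0 \<Longrightarrow> inv (T_op t i) = T_inv t i"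
  by (rule inv_equality) simp_all

lemma lin_op_T_inv [simp]: "lin_op (T_inv t i)"
  unfolding T_inv_def
  by (intro lin_op_mult lin_op_plus lin_op_T_op lin_op_id)

text \<open>In operator form t T_i^(-1) z_(i+1) = z_i T_i: the correction term of the cross relation
  cancels against that of the inverse. This relation lowers the index of a variable and is the
  mechanism behind the formula for z_i.\<close>

lemma T_inv_zvar_right: "t \<noteq> 0 \<Longrightarrow> T_inv t i (zvar (Suc i) * f) = Const (inverse t) * (zvar i * T_op t i f)"
  unfolding T_inv_def T_op_zvar_right by (simp add: algebra_simps)

section \<open>Cherednik operators\<close>

definition omega_subst :: "nat \<Rightarrow> 'a::field \<Rightarrow> nat \<Rightarrow> 'a mpoly" where
  "omega_subst n q j = (if j = 1 then Const q * zvar n else if 2 \<le> j \<and> j \<le> n then zvar (j - 1) else zvar j)"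

text \<open>Each further reflection lengthens the cyclic shift by one: the new outermost s_(k+1)
  moves the end of the cycle from k + 1 to k + 2.\<close>

lemma foldr_s_op_tau_op:
  "foldr s_op (rev [1..<Suc k]) (tau_op q f) = subst_vars (omega_subst (Suc k) q) f"
proof (induction k)
  case 0
  show ?case
    by (auto simp: tau_op_def omega_subst_def intro!: arg_cong[where f = "\<lambda>\<sigma>. subst_vars \<sigma> f"])
next
  case (Suc k)
  have "foldr s_op (rev [1..<Suc (Suc k)]) (tau_op q f) = s_op (Suc k) (subst_vars (omega_subst (Suc k) q) f)"
    using Suc by simp
  also have "\<dots> = subst_vars (omega_subst (Suc (Suc k)) q) f"
    unfolding s_op_eq subst_vars_comp
    by (rule arg_cong[where f = "\<lambda>\<sigma>. subst_vars \<sigma> f"])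
      (auto simp: omega_subst_def swap_idx_def subst_vars_hom fun_eq_iff)
  finally show ?case .
qed

lemma omega_op_eq: "n \<ge> 1 \<Longrightarrow> omega_op n q f = subst_vars (omega_subst n q) f"
  using foldr_s_op_tau_op[of "n - 1" q f] by (simp add: omega_op_def)

lemma upt_split: "i \<le> j \<Longrightarrow> j \<le> k \<Longrightarrow> [i..<k] = [i..<j] @ [j..<k]"
  by (metis le_iff_add upt_add_eq_append)

lemma foldr_commute_op:
  assumes "\<And>x g. x \<in> set xs \<Longrightarrow> A (F x g) = F x (A g)"
  shows "A (foldr F xs f) = foldr F xs (A f)"
  using assms by (induction xs) auto

text \<open>Invertible parameters suffice for the operator identities; independence of q and t
  enters with the spectrum, in \<open>generic\<close>.\<close>

locale params =
  fixes n :: nat and q t :: "'a::field"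
  assumes n_pos: "n \<ge> 1" and q_nz [simp]: "q \<noteq> 0" and t_nz [simp]: "t \<noteq> 0"
begin

abbreviation "T \<equiv> T_op t"
abbreviation "T' \<equiv> T_inv t"
abbreviation "Y \<equiv> Y_op n q t"

definition w :: "'a mpoly \<Rightarrow> 'a mpoly" where "w = omega_op n q"
definition Phi :: "'a mpoly \<Rightarrow> 'a mpoly" where "Phi f = zvar n * w f"

lemma w_eq: "w = subst_vars (omega_subst n q)"
  using omega_op_eq[OF n_pos] by (auto simp: w_def)

lemma w_hom: "w (f + g) = w f + w g" "w (f - g) = w f - w g" "w (f * g) = w f * w g" "w (Const c) = Const c" "w 1 = 1"
  by (simp_all add: w_eq subst_vars_hom)

lemma lin_op_w [simp]: "lin_op w"
  by (simp add: w_eq lin_op_subst_vars)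

lemma w_zvar_1 [simp]: "w (zvar (Suc 0)) = Const q * zvar n"
  and w_zvar_Suc: "1 \<le> j \<Longrightarrow> j < n \<Longrightarrow> w (zvar (Suc j)) = zvar j"
  and w_zvar_other: "j = 0 \<or> j > n \<Longrightarrow> w (zvar j) = zvar j"
  using n_pos by (auto simp: w_eq omega_subst_def)

text \<open>Omega substitutes z_(j-1) for z_j when 2 <= j <= n, so conjugation by it lowers the
  index of T by one.\<close>

lemma w_T:
  assumes "1 \<le> i" "Suc i < n"
  shows "w (T (Suc i) f) = T i (w f)"
proof (rule lin_op_eqI[where F = "\<lambda>f. w (T (Suc i) f)" and G = "\<lambda>f. T i (w f)"])
  fix f j
  assume IH: "w (T (Suc i) f) = T i (w f)"
  have scale: "T i (Const q * g) = Const q * T i g" for g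
    by simp
  consider "j = Suc i" | "j = Suc (Suc i)" | "j = Suc 0" | k where "j = Suc k" "1 \<le> k" "k < n" "k \<noteq> i" "k \<noteq> Suc i"
    | "j = 0 \<or> j > n"
    using assms by (cases j) (auto, fastforce)
  then show "w (T (Suc i) (zvar j * f)) = T i (w (zvar j * f))"
    using assms IH
    by cases (auto simp: T_op_zvar_other T_op_zvar_left T_op_zvar_right w_hom w_zvar_Suc w_zvar_other mult.assoc)
qed (use assms in \<open>simp_all add: lin_op_compose w_hom\<close>)

text \<open>A single omega would turn T_1 into the affine generator T_0, which is not among the
  operators at hand; a second one carries T_0 on to T_(n-1).\<close>

lemma w_w_T:
  assumes m: "Suc (Suc m) = n"
  shows "w (w (T 1 f)) = T (Suc m) (w (w f))"
proof (rule lin_op_eqI[where F = "\<lambda>f. w (w (T 1 f))" and G = "\<lambda>f. T (Suc m) (w (w f))"])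
  fix f j
  assume IH: "w (w (T 1 f)) = T (Suc m) (w (w f))"
  have wn: "w (zvar n) = zvar (Suc m)"
    using w_zvar_Suc[of "Suc m", unfolded m] m by simp
  have w2: "w (zvar (Suc (Suc 0))) = zvar (Suc 0)"
    using w_zvar_Suc[of 1] m by simp
  note TR = T_op_zvar_right[of t "Suc m", unfolded m] T_op_zvar_left[of t "Suc m", unfolded m]
  note rules = T_op_zvar_left T_op_zvar_right TR wn w2 w_hom mult.assoc
  have "j = Suc 0 \<or> j = Suc (Suc 0) \<or> (\<exists>k. j = Suc (Suc k) \<and> 1 \<le> k \<and> k \<le> m) \<or> j = 0 \<or> j > n"
    using m by (cases j; cases "j - 1"; cases "j - 2"; cases "j \<le> n") auto
  then consider "j = Suc 0" | "j = Suc (Suc 0)" | k where "j = Suc (Suc k)" "1 \<le> k" "k \<le> m" | "j = 0 \<or> j > n"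
    by blast
  then show "w (w (T 1 (zvar j * f))) = T (Suc m) (w (w (zvar j * f)))"
  proof cases
    case 1 then show ?thesis using IH m by (simp add: rules) (simp add: algebra_simps)
  next
    case 2 then show ?thesis using IH m by (simp add: rules) (simp add: algebra_simps)
  next
    case 3
    then have "w (zvar j) = zvar (Suc k)" "w (zvar (Suc k)) = zvar k" "k \<noteq> n"
      using m by (simp_all add: w_zvar_Suc)
    then show ?thesis using 3 IH m by (simp add: T_op_zvar_other w_hom)
  next
    case 4
    then have "w (zvar j) = zvar j" "j \<noteq> Suc m" "j \<noteq> n" "j \<noteq> Suc 0" "j \<noteq> Suc (Suc 0)"
      using m by (auto simp: w_zvar_other)
    then show ?thesis using IH m by (simp add: T_op_zvar_other w_hom)
  qed
next
  show "lin_op (\<lambda>f. w (w (T 1 f)))"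
    by (rule lin_op_compose[OF lin_op_w lin_op_compose[OF lin_op_w lin_op_T_op]])
next
  show "lin_op (\<lambda>f. T (Suc m) (w (w f)))"
    by (rule lin_op_compose[OF lin_op_T_op lin_op_compose[OF lin_op_w lin_op_w]])
qed (simp add: w_hom)

lemma Y_eq: "Y i f = Const (t powi (int i - int n)) * foldr T [i..<n] (w (foldr T' [1..<i] f))"
  by (simp add: Y_op_def w_def inv_T_op)

lemma lin_op_Y [simp]: "lin_op (Y i)"
proof -
  have "lin_op (foldr T' [1..<i])" "lin_op (foldr T [i..<n])" by (simp_all add: lin_op_foldr)
  then have "lin_op (\<lambda>f. Const (t powi (int i - int n)) * foldr T [i..<n] (w (foldr T' [1..<i] f)))"
    using lin_op_mult[OF lin_op_compose[OF _ lin_op_compose[OF lin_op_w]]] by blast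
  then show ?thesis by (simp add: Y_eq[abs_def])
qed

lemmas Y_lin [simp] = lin_op_simps[OF lin_op_Y]
lemmas w_lin [simp] = lin_op_simps[OF lin_op_w]

text \<open>The outermost T_i of Y_i is split off, and the extra T_i^(-1) at the inner end of
  Y_(i+1) is cancelled by the T_i on the right.\<close>

lemma Y_step:
  assumes "1 \<le> i" "i < n"
  shows "Y i f = Const (inverse t) * T i (Y (Suc i) (T i f))"
proof -
  have "t powi (int i - int n) = inverse t * t powi (int (Suc i) - int n)"
    using power_int_add[of t "-1" "int (Suc i) - int n"] by (simp add: algebra_simps)
  moreover have "[i..<n] = i # [Suc i..<n]" "[1..<Suc i] = [1..<i] @ [i]"
    using assms by (simp_all add: upt_conv_Cons)
  ultimately show ?thesis
    unfolding Y_eq by (simp add: mult.assoc)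
qed

lemma T_T'_commute:
  assumes "i + 1 < j \<or> j + 1 < i"
  shows "T i (T' j f) = T' j (T i f)"
  using assms T_op_commute[of i j t f] T_op_commute[of j i t f]
  by (auto simp: T_inv_def T_op_one_minus)

lemma T'_braid: "T' i (T' (Suc i) (T i f)) = T (Suc i) (T' i (T' (Suc i) f))"
proof -
  have "T (Suc i) (T i (T (Suc i) (T' i (T' (Suc i) f)))) = T i f"
    using T_op_braid[of t i "T' i (T' (Suc i) f)"] by simp
  then have "T' i (T' (Suc i) (T (Suc i) (T i (T (Suc i) (T' i (T' (Suc i) f)))))) = T' i (T' (Suc i) (T i f))"
    by simp
  then show ?thesis by simp
qed

text \<open>T_i commutes with the factors of index above i + 1, the braid relation with T_i T_(i+1)
  raises its index, and T_(i+1) commutes with the factors of index below i.\<close>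

lemma foldr_T_shift:
  assumes "j \<le> i" "Suc i < m"
  shows "foldr T [j..<m] (T i f) = T (Suc i) (foldr T [j..<m] f)"
proof -
  have split: "[j..<m] = [j..<i] @ i # Suc i # [Suc (Suc i)..<m]"
    using assms upt_split[of j i m] by (simp add: upt_conv_Cons)
  have "foldr T [Suc (Suc i)..<m] (T i f) = T i (foldr T [Suc (Suc i)..<m] f)"
    by (rule foldr_commute_op[symmetric]) (auto intro: T_op_commute)
  moreover have "foldr T [j..<i] (T (Suc i) g) = T (Suc i) (foldr T [j..<i] g)" for g
    by (rule foldr_commute_op[symmetric]) (auto intro: T_op_commute[symmetric])
  ultimately show ?thesis
    unfolding split by (simp add: T_op_braid)
qed

lemma foldr_T'_shift:
  assumes "1 \<le> i" "Suc i < j"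
  shows "foldr T' [1..<j] (T i f) = T (Suc i) (foldr T' [1..<j] f)"
proof -
  have split: "[1..<j] = [1..<i] @ i # Suc i # [Suc (Suc i)..<j]"
    using assms upt_split[of 1 i j] by (simp add: upt_conv_Cons)
  have "foldr T' [Suc (Suc i)..<j] (T i f) = T i (foldr T' [Suc (Suc i)..<j] f)"
    by (rule foldr_commute_op[symmetric]) (auto intro: T_T'_commute)
  moreover have "foldr T' [1..<i] (T (Suc i) g) = T (Suc i) (foldr T' [1..<i] g)" for g
    by (rule foldr_commute_op[symmetric]) (auto intro: T_T'_commute)
  ultimately show ?thesis
    unfolding split by (simp add: T'_braid)
qed

text \<open>Omega lowers the index of T by one and a braid relation raises it: for j < i among the
  factors T_j ... T_(n-1) outside omega, for j > i + 1 among the inverse factors inside it.\<close>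

lemma Y_T_commute:
  assumes "1 \<le> i" "i < n" "1 \<le> j" "j \<le> n" "j \<noteq> i" "j \<noteq> Suc i"
  shows "Y j (T i f) = T i (Y j f)"
proof (cases "j < i")
  case True
  then obtain i' where i': "i = Suc i'" "1 \<le> i'" "j \<le> i'" using assms by (cases i) auto
  have "foldr T' [1..<j] (T i f) = T i (foldr T' [1..<j] f)"
    by (rule foldr_commute_op[symmetric]) (use True in \<open>auto intro!: T_T'_commute\<close>)
  then show ?thesis
    using i' assms by (simp add: Y_eq w_T foldr_T_shift)
next
  case False
  then have j: "Suc i < j" using assms by auto
  have "foldr T [j..<n] (T i g) = T i (foldr T [j..<n] g)" for g
    by (rule foldr_commute_op[symmetric]) (use j in \<open>auto intro!: T_op_commute\<close>)
  then show ?thesis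
    using j assms foldr_T'_shift[of i j f] by (simp add: Y_eq w_T)
qed

lemma lin_op_Phi [simp]: "lin_op Phi"
  unfolding Phi_def by (intro lin_op_mult lin_op_w)

lemmas Phi_lin [simp] = lin_op_simps[OF lin_op_Phi]

lemma Phi_T: "1 \<le> i \<Longrightarrow> Suc i < n \<Longrightarrow> Phi (T (Suc i) f) = T i (Phi f)"
  by (simp add: Phi_def w_T T_op_zvar_other)

lemma foldr_T'_zvar:
  "foldr T' [1..<Suc m] (zvar (Suc m) * f) =
    Const (inverse t ^ m) * (zvar 1 * foldr T [1..<Suc m] f)"
proof (induction m arbitrary: f)
  case (Suc m)
  have lin: "lin_op (foldr T' [1..<Suc m])" by (simp add: lin_op_foldr)
  have "foldr T' [1..<Suc (Suc m)] (zvar (Suc (Suc m)) * f) =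
      foldr T' [1..<Suc m] (Const (inverse t) * (zvar (Suc m) * T (Suc m) f))"
    using T_inv_zvar_right[of t "Suc m" f] by simp
  also have "\<dots> = Const (inverse t) * foldr T' [1..<Suc m] (zvar (Suc m) * T (Suc m) f)"
    by (rule lin_op_scale[OF lin])
  finally show ?case
    unfolding Suc by (simp add: mult.assoc)
qed simp

text \<open>In Y_n only inverse factors stand between omega and the variable. They turn z_n into z_1
  followed by T_1 ... T_(n-1), which rebuilds Y_1, and the outer omega maps z_1 to q z_n. Here the
  eigenvalue picks up its factor q.\<close>

lemma Y_n_Phi: "Y n (Phi f) = Const q * Phi (Y 1 f)"
proof -
  obtain m where m: "n = Suc m" using n_pos by (cases n) auto
  have "t powi (1 - int n) = inverse t ^ m"
    by (simp add: m power_int_minus power_inverse)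
  then have Y1: "Y 1 f = Const (inverse t ^ m) * foldr T [1..<n] (w f)"
    by (simp add: Y_eq)
  have "Y n (Phi f) = w (foldr T' [1..<n] (zvar n * w f))"
    by (simp add: Y_eq Phi_def)
  also have "\<dots> = Const q * Phi (Y 1 f)"
    unfolding foldr_T'_zvar[of m, folded m] Y1 by (simp add: Phi_def w_hom)
  finally show ?thesis .
qed

text \<open>Descending induction on j: by \<open>Y_step\<close> and \<open>Phi_T\<close> both sides
  satisfy the same recursion. The start j = n - 1 is where the wrap-around relation
  \<open>w_w_T\<close> enters.\<close>

lemma Y_Phi:
  assumes "1 \<le> j" "j < n"
  shows "Y j (Phi f) = Phi (Y (Suc j) f)"
proof -
  obtain m where m: "n = Suc (Suc m)" using assms by (metis Suc_lessE less_imp_Suc_add Suc_le_D One_nat_def add_Suc)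
  have "j \<le> Suc m" using assms m by simp
  then show ?thesis using assms(1)
  proof (induction arbitrary: f rule: inc_induct)
    case base
    have "w (zvar n) = zvar (Suc m)"
      using w_zvar_Suc[of "Suc m"] m by simp
    then have 1: "w (Phi f) = zvar (Suc m) * w (w f)" for f
      by (simp add: Phi_def w_hom)
    have comm: "foldr T' [1..<Suc m] (Phi f) = Phi (foldr T' [2..<n] f)" for f
    proof -
      have Phi_T': "Phi (T' (Suc i) f) = T' i (Phi f)" if "1 \<le> i" "i \<le> m" for i f
      proof -
        have "Phi (T (Suc i) (T' (Suc i) f)) = T i (Phi (T' (Suc i) f))"
          by (rule Phi_T) (use that m in auto)
        then have "T' i (Phi f) = T' i (T i (Phi (T' (Suc i) f)))" by simp
        then show ?thesis by simp
      qed
      have "i \<le> m \<Longrightarrow> foldr T' [1..<Suc i] (Phi f) = Phi (foldr T' [2..<Suc (Suc i)] f)" for i f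
      proof (induction i arbitrary: f)
        case (Suc i)
        then show ?case
          using Suc.IH[of "T' (Suc (Suc i)) f"] Phi_T'[of "Suc i" f] by (simp add: numeral_2_eq_2)
      qed simp
      from this[of m] show ?thesis by (simp add: m)
    qed
    have n1: "[1..<n] = 1 # [2..<n]" by (simp add: m upt_conv_Cons numeral_2_eq_2)
    \<comment> \<open>The relation T_(n-1) z_(n-1) T_(n-1) = t z_n, obtained by inverting
      \<open>T_inv_zvar_right\<close>.\<close>
    have left: "T (Suc m) (zvar (Suc m) * T (Suc m) g) = Const t * (zvar n * g)" for g
    proof -
      have "Const (inverse t) * (zvar (Suc m) * T (Suc m) g) = T' (Suc m) (zvar n * g)"
        using T_inv_zvar_right[of t "Suc m" g] m by simp
      then have "T (Suc m) (Const (inverse t) * (zvar (Suc m) * T (Suc m) g)) = zvar n * g"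
        by simp
      then have "Const t * (Const (inverse t) * T (Suc m) (zvar (Suc m) * T (Suc m) g)) = Const t * (zvar n * g)"
        by simp
      then show ?thesis by (simp add: Const_inverse_cancel)
    qed
    have "Y (Suc m) (Phi f) = Const (t powi (- 1)) * T (Suc m) (w (Phi (foldr T' [2..<n] f)))"
    proof -
      have "[Suc m..<n] = [Suc m]" "int (Suc m) - int n = - 1" by (simp_all add: m)
      then show ?thesis unfolding Y_eq comm by (simp only: foldr.simps o_def id_def)
    qed
    also have "\<dots> = Const (inverse t) * T (Suc m) (zvar (Suc m) * w (w (foldr T' [2..<n] f)))"
      unfolding 1 by simp
    \<comment> \<open>The missing factor T_1^(-1) is restored as T_1 T_1^(-1), and the spare T_1
      crosses both omegas to become T_(n-1).\<close>
    also have "w (w (foldr T' [2..<n] f)) = T (Suc m) (w (w (foldr T' [1..<n] f)))"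
      using w_w_T[OF m[symmetric], of "foldr T' [1..<n] f"] unfolding n1 by simp
    also have "Const (inverse t) * T (Suc m) (zvar (Suc m) * T (Suc m) (w (w (foldr T' [1..<n] f)))) =
        zvar n * w (w (foldr T' [1..<n] f))"
      unfolding left by (simp add: Const_inverse_cancel)
    also have "\<dots> = Phi (Y n f)"
      by (simp add: Y_eq Phi_def)
    finally show ?case by (simp add: m)
  next
    case (step j)
    have "Y j (Phi f) = Const (inverse t) * T j (Y (Suc j) (T j (Phi f)))"
      using step m by (intro Y_step) auto
    also have "T j (Phi f) = Phi (T (Suc j) f)"
      using step m by (intro Phi_T[symmetric]) auto
    also have "Y (Suc j) (Phi (T (Suc j) f)) = Phi (Y (Suc (Suc j)) (T (Suc j) f))"
      using step by simp
    also have "Const (inverse t) * T j (Phi (Y (Suc (Suc j)) (T (Suc j) f))) =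
        Phi (Const (inverse t) * T (Suc j) (Y (Suc (Suc j)) (T (Suc j) f)))"
    proof -
      have "1 \<le> j" "Suc j < n" using step m by auto
      then show ?thesis by (simp add: Phi_T)
    qed
    also have "\<dots> = Phi (Y (Suc j) f)"
      using step m Y_step[of "Suc j" f] by simp
    finally show ?case .
  qed
qed

section \<open>Joint eigenvectors of the Y_i and intertwiners\<close>

definition eigen :: "(nat \<Rightarrow> 'a) \<Rightarrow> 'a mpoly \<Rightarrow> bool" where
  "eigen y f \<longleftrightarrow> (\<forall>i\<in>{1..n}. Y i f = Const (y i) * f)"

lemma eigen_scale: "eigen y f \<Longrightarrow> eigen y (Const c * f)"
  by (simp add: eigen_def mult.left_commute)

lemma eigen_diff: "eigen y f \<Longrightarrow> eigen y g \<Longrightarrow> eigen y (f - g)"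
  by (simp add: eigen_def right_diff_distrib)

lemma eigen_Phi:
  assumes "eigen y f"
  shows "eigen (\<lambda>j. if j = n then q * y 1 else y (Suc j)) (Phi f)"
  unfolding eigen_def
proof
  fix i assume i: "i \<in> {1..n}"
  show "Y i (Phi f) = Const (if i = n then q * y 1 else y (Suc i)) * Phi f"
  proof (cases "i = n")
    case True
    then show ?thesis using assms n_pos Y_n_Phi[of f] by (simp add: eigen_def mult.assoc)
  next
    case False
    then show ?thesis using i assms by (simp add: Y_Phi eigen_def)
  qed
qed

text \<open>The Bernstein relations between T_k and Y_k, Y_(k+1), obtained from
  \<open>Y_step\<close> by means of the quadratic relation.\<close>

lemma Y_T:
  assumes "1 \<le> k" "k < n"
  shows "Y k (T k f) = Const (t - 1) * Y k f + T k (Y (Suc k) f)"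
    and "Y (Suc k) (T k f) = T k (Y k f) - Const (t - 1) * Y k f"
proof -
  have "T k (Y (Suc k) (T k f)) = Const t * Y k f"
    using assms by (simp add: Y_step Const_inverse_cancel)
  then have "T' k (T k (Y (Suc k) (T k f))) = T' k (Const t * Y k f)"
    by simp
  also have "\<dots> = Const t * T' k (Y k f)"
    by (rule lin_op_scale) simp
  finally have "Y (Suc k) (T k f) = Const t * T' k (Y k f)"
    by simp
  then show 2: "Y (Suc k) (T k f) = T k (Y k f) - Const (t - 1) * Y k f"
    by (simp add: T_inv_def Const_inverse_cancel) (simp add: algebra_simps)
  have "Y k (T k f) = Const (inverse t) * T k (Y (Suc k) (T k (T k f)))"
    using assms by (intro Y_step)
  also have "T k (T k f) = Const (t - 1) * T k f + Const t * f"
    by (simp add: T_op_quadratic)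
  also have "Const (inverse t) * T k (Y (Suc k) (Const (t - 1) * T k f + Const t * f)) =
      Const (t - 1) * (Const (inverse t) * T k (Y (Suc k) (T k f))) + T k (Y (Suc k) f)"
    by (simp only: Y_lin T_op_lin distrib_left Const_inverse_cancel t_nz) (simp add: mult.left_commute[of "Const (inverse t)"] Const_inverse_cancel)
  also have "Const (inverse t) * T k (Y (Suc k) (T k f)) = Y k f"
    using assms Y_step[of k f] by simp
  finally show "Y k (T k f) = Const (t - 1) * Y k f + T k (Y (Suc k) f)" .
qed

text \<open>The Bernstein relations express Y_k and Y_(k+1) on T_k f through f and T_k f. The scalar
  a is the solution of (t - 1) y_k = a (y_k - y_(k+1)), the condition for T_k f - a f to satisfy the
  eigenvalue equations with the two eigenvalues exchanged.\<close>

lemma eigen_T: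
  assumes f: "eigen y f" and k: "1 \<le> k" "k < n" and y: "y k \<noteq> y (Suc k)"
  shows "eigen (y \<circ> swap_idx k) (T k f - Const ((t - 1) * y k / (y k - y (Suc k))) * f)"
  unfolding eigen_def
proof
  define a where "a = (t - 1) * y k / (y k - y (Suc k))"
  have a: "(t - 1) * y k = a * y k - a * y (Suc k)"
    using y by (simp add: a_def divide_simps) (simp add: algebra_simps)
  have ca: "Const (t - 1) * (Const (y k) * f) = Const a * (Const (y k) * f) - Const a * (Const (y (Suc k)) * f)"
    by (simp only: mult.assoc[symmetric] Const_mult[symmetric] left_diff_distrib[symmetric] a Const_diff[symmetric])
  have e: "i \<in> {1..n} \<Longrightarrow> Y i f = Const (y i) * f" for i
    using f by (simp add: eigen_def)
  fix i assume i: "i \<in> {1..n}"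
  consider "i = k" | "i = Suc k" | "i \<noteq> k" "i \<noteq> Suc k" by blast
  then have "Y i (T k f - Const a * f) = Const (y (swap_idx k i)) * (T k f - Const a * f)"
  proof cases
    case 1
    then show ?thesis
      using k by (simp add: Y_T e swap_idx_def ca del: Const_diff) (simp add: algebra_simps)
  next
    case 2
    then show ?thesis
      using k by (simp add: Y_T e swap_idx_def ca del: Const_diff) (simp add: algebra_simps)
  next
    case 3
    then show ?thesis
      using k i by (simp add: Y_T_commute e swap_idx_def) (simp add: algebra_simps)
  qed
  then show "Y i (T k f - Const ((t - 1) * y k / (y k - y (Suc k))) * f) =
      Const ((y \<circ> swap_idx k) i) * (T k f - Const ((t - 1) * y k / (y k - y (Suc k))) * f)"
    by (simp add: a_def)
qed

end

section \<open>Orders on compositions\<close>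

lemma compositions_eqI:
  assumes "\<mu> \<in> compositions n" "\<eta> \<in> compositions n" "\<And>j. 1 \<le> j \<Longrightarrow> j \<le> n \<Longrightarrow> \<mu> j = \<eta> j"
  shows "\<mu> = \<eta>"
proof
  fix j
  show "\<mu> j = \<eta> j"
    using assms by (cases "j \<in> {1..n}") (auto simp: compositions_def)
qed

lemma finite_compositions_csize: "finite {\<eta> \<in> compositions n. csize n \<eta> = m}"
proof (rule finite_subset)
  show "{\<eta> \<in> compositions n. csize n \<eta> = m} \<subseteq> {\<eta>. \<forall>j. (j \<in> {1..n} \<longrightarrow> \<eta> j \<in> {0..m}) \<and> (j \<notin> {1..n} \<longrightarrow> \<eta> j = 0)}"
  proof safe
    fix \<eta> j
    assume "j \<in> {1..n}"
    then have "\<eta> j \<le> csize n \<eta>"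
      unfolding csize_def by (intro member_le_sum) auto
    then show "\<eta> j \<in> {0..csize n \<eta>}" by simp
  qed (auto simp: compositions_def)
  show "finite \<dots>" by (rule finite_set_of_finite_funs) auto
qed

lemma swap_idx_swap_idx [simp]: "swap_idx k (swap_idx k j) = j"
  by (auto simp: swap_idx_def)

lemma swap_idx_simps [simp]: "swap_idx k k = Suc k" "swap_idx k (Suc k) = k"
  by (auto simp: swap_idx_def)

lemma swap_idx_in_iff: "1 \<le> k \<Longrightarrow> k < n \<Longrightarrow> swap_idx k j \<in> {1..n} \<longleftrightarrow> j \<in> {1..n}"
  by (auto simp: swap_idx_def)

lemma bij_betw_swap_idx: "1 \<le> k \<Longrightarrow> k < n \<Longrightarrow> bij_betw (swap_idx k) {1..n} {1..n}"
  by (rule bij_betw_byWitness[where f' = "swap_idx k"]) (auto simp: swap_idx_def)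

lemma sum_swap_idx: "1 \<le> k \<Longrightarrow> k < n \<Longrightarrow> (\<Sum>j=1..n. f (swap_idx k j)) = (\<Sum>j=1..n. f j)"
  by (rule sum.reindex_bij_betw[OF bij_betw_swap_idx])

lemma prod_swap_idx: "1 \<le> k \<Longrightarrow> k < n \<Longrightarrow> (\<Prod>j=1..n. f (swap_idx k j)) = (\<Prod>j=1..n. f j)"
  by (rule prod.reindex_bij_betw[OF bij_betw_swap_idx])

lemma swap_in_compositions [simp]:
  "1 \<le> k \<Longrightarrow> k < n \<Longrightarrow> \<eta> \<in> compositions n \<Longrightarrow> \<eta> \<circ> swap_idx k \<in> compositions n"
  using swap_idx_in_iff[of k n] by (auto simp: compositions_def)

lemma csize_swap [simp]: "1 \<le> k \<Longrightarrow> k < n \<Longrightarrow> csize n (\<eta> \<circ> swap_idx k) = csize n \<eta>"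
  by (simp add: csize_def sum_swap_idx[of k n \<eta>] del: One_nat_def)

definition Phi_comp :: "nat \<Rightarrow> (nat \<Rightarrow> nat) \<Rightarrow> nat \<Rightarrow> nat" where
  "Phi_comp n \<eta> j = (if j = n then \<eta> 1 + 1 else if 1 \<le> j \<and> j < n then \<eta> (Suc j) else 0)"

lemma Phi_comp_in_compositions [simp]: "n \<ge> 1 \<Longrightarrow> Phi_comp n \<eta> \<in> compositions n"
  by (auto simp: compositions_def Phi_comp_def)

text \<open>The summand at 1 is put last, where \<open>Phi_comp\<close> places the first entry. With
  \<open>sum_split_last\<close> this allows termwise comparison of sums over
  \<open>Phi_comp n \<eta>\<close> and over eta.\<close>

lemma sum_Phi_shift:
  assumes "n \<ge> 1"
  shows "(\<Sum>j=1..n. f j) = (\<Sum>j=1..<n. f (Suc j)) + f (1::nat)"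
proof -
  have "(\<Sum>j=1..n. f j) = f 1 + (\<Sum>j=Suc 1..n. f j)"
    using assms by (simp add: sum.atLeast_Suc_atMost)
  also have "(\<Sum>j=Suc 1..n. f j) = (\<Sum>j=1..<n. f (Suc j))"
    using assms by (metis Suc_le_D One_nat_def atLeastLessThanSuc_atLeastAtMost sum.shift_bounds_Suc_ivl)
  finally show ?thesis by (simp add: add.commute)
qed

lemma prod_Phi_shift:
  assumes "n \<ge> 1"
  shows "(\<Prod>j=1..n. f j) = (\<Prod>j=1..<n. f (Suc j)) * f (1::nat)"
proof -
  have "(\<Prod>j=1..n. f j) = f 1 * (\<Prod>j=Suc 1..n. f j)"
    using assms by (simp add: prod.atLeast_Suc_atMost)
  also have "(\<Prod>j=Suc 1..n. f j) = (\<Prod>j=1..<n. f (Suc j))"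
    using assms by (metis Suc_le_D One_nat_def atLeastLessThanSuc_atLeastAtMost prod.shift_bounds_Suc_ivl)
  finally show ?thesis by (simp add: mult.commute)
qed

lemma sum_split_last: "n \<ge> 1 \<Longrightarrow> (\<Sum>j=1..n. f j) = (\<Sum>j=1..<n. f j) + f (n::nat)"
  by (metis Suc_le_D One_nat_def atLeastLessThanSuc_atLeastAtMost sum.atLeastLessThan_Suc)

lemma prod_split_last: "n \<ge> 1 \<Longrightarrow> (\<Prod>j=1..n. f j) = (\<Prod>j=1..<n. f j) * f (n::nat)"
  by (metis Suc_le_D One_nat_def atLeastLessThanSuc_atLeastAtMost prod.atLeastLessThan_Suc)

lemma csize_Phi_comp: "n \<ge> 1 \<Longrightarrow> csize n (Phi_comp n \<eta>) = Suc (csize n \<eta>)"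
  unfolding csize_def by (simp only: sum_split_last[of n "Phi_comp n \<eta>"] sum_Phi_shift[of n \<eta>])
    (simp add: Phi_comp_def)

text \<open>
  The dominance order used in the triangularity condition is not preserved by the creation
  operators. A finer order that is preserved is the rank criterion for the affine Bruhat order:
  extending \<open>\<eta>\<close> to all of \<open>\<int>\<close> by \<open>\<eta>\<^sub>j\<^sub>+\<^sub>n = \<eta>\<^sub>j + 1\<close>, the following number is
  the cardinality of \<open>{j \<le> p. \<eta>\<^sub>j \<ge> c}\<close>.
\<close>

definition rnk :: "nat \<Rightarrow> nat \<Rightarrow> nat \<Rightarrow> (nat \<Rightarrow> nat) \<Rightarrow> nat" where
  "rnk n p c \<eta> = (\<Sum>j=1..n. \<eta> j + (if j \<le> p then 1 else 0) - c)"

text \<open>Positions 0 to n represent all of them: moving p by n moves c by one in the periodic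
  extension. Equal size settles the thresholds at and below 0, where ranks depend on the size and
  the position alone.\<close>

definition aff_le :: "nat \<Rightarrow> (nat \<Rightarrow> nat) \<Rightarrow> (nat \<Rightarrow> nat) \<Rightarrow> bool" where
  "aff_le n \<mu> \<eta> \<longleftrightarrow> csize n \<mu> = csize n \<eta> \<and> (\<forall>p\<le>n. \<forall>c. rnk n p c \<mu> \<le> rnk n p c \<eta>)"

lemma aff_le_refl [simp]: "aff_le n \<eta> \<eta>"
  by (simp add: aff_le_def)

lemma aff_le_trans: "aff_le n \<mu> \<nu> \<Longrightarrow> aff_le n \<nu> \<eta> \<Longrightarrow> aff_le n \<mu> \<eta>"
  by (auto simp: aff_le_def) (meson order_trans)

text \<open>Going from p - 1 to p tests a single entry against c. Ranks therefore determine the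
  composition, which gives antisymmetry of \<open>aff_le\<close>.\<close>

lemma rnk_step:
  assumes "1 \<le> p" "p \<le> n"
  shows "rnk n p c \<eta> = rnk n (p - 1) c \<eta> + (if c \<le> \<eta> p then 1 else 0)"
proof -
  have "rnk n p c \<eta> = (\<Sum>j=1..n. (\<eta> j + (if j \<le> p - 1 then 1 else 0) - c) + (if j = p then if c \<le> \<eta> p then 1 else 0 else 0))"
    unfolding rnk_def using assms by (intro sum.cong) auto
  also have "\<dots> = rnk n (p - 1) c \<eta> + (if c \<le> \<eta> p then 1 else 0)"
    using assms by (simp add: sum.distrib rnk_def)
  finally show ?thesis .
qed

lemma aff_le_antisym:
  assumes "aff_le n \<mu> \<eta>" "aff_le n \<eta> \<mu>" "\<mu> \<in> compositions n" "\<eta> \<in> compositions n"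
  shows "\<mu> = \<eta>"
proof (rule compositions_eqI[OF assms(3,4)])
  fix p assume p: "1 \<le> p" "p \<le> n"
  have eq: "rnk n p' c \<mu> = rnk n p' c \<eta>" if "p' \<le> n" for p' c
    using assms(1,2) that by (metis aff_le_def antisym)
  have "c \<le> \<mu> p \<longleftrightarrow> c \<le> \<eta> p" for c
  proof -
    have "rnk n (p - 1) c \<mu> = rnk n (p - 1) c \<eta>"
      using p by (intro eq) auto
    then have "(if c \<le> \<mu> p then 1 else 0 :: nat) = (if c \<le> \<eta> p then 1 else 0)"
      using rnk_step[OF p, of c \<mu>] rnk_step[OF p, of c \<eta>] eq[OF p(2), of c] by linarith
    then show ?thesis by (simp split: if_splits)
  qed
  then show "\<mu> p = \<eta> p" by (meson antisym order_refl)
qed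

lemma rnk_swap:
  assumes k: "1 \<le> k" "k < n" and "p \<noteq> k"
  shows "rnk n p c (\<eta> \<circ> swap_idx k) = rnk n p c \<eta>"
proof -
  have "rnk n p c \<eta> = (\<Sum>j=1..n. \<eta> (swap_idx k j) + (if swap_idx k j \<le> p then 1 else 0) - c)"
    unfolding rnk_def by (rule sum_swap_idx[OF k, symmetric])
  also have "\<dots> = rnk n p c (\<eta> \<circ> swap_idx k)"
    unfolding rnk_def using assms by (intro sum.cong) (auto simp: swap_idx_def)
  finally show ?thesis ..
qed

lemma rnk_swap_eq:
  assumes k: "1 \<le> k" "k < n"
  shows "rnk n k c (\<eta> \<circ> swap_idx k) = rnk n (k - 1) c \<eta> + (if c \<le> \<eta> (Suc k) then 1 else 0)"
  using rnk_step[of k n c "\<eta> \<circ> swap_idx k"] rnk_swap[OF k, of "k - 1" c \<eta>] k by auto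

lemma aff_le_swap:
  assumes k: "1 \<le> k" "k < n" and "\<eta> k \<le> \<eta> (Suc k)"
  shows "aff_le n \<eta> (\<eta> \<circ> swap_idx k)"
  unfolding aff_le_def
proof (intro conjI allI impI)
  fix p c assume "p \<le> n"
  show "rnk n p c \<eta> \<le> rnk n p c (\<eta> \<circ> swap_idx k)"
  proof (cases "p = k")
    case True
    then show ?thesis
      unfolding True rnk_swap_eq[OF k] using rnk_step[of k n c \<eta>] k assms(3) by auto
  qed (simp add: rnk_swap[OF k])
qed (use k in simp)

text \<open>A lifting property of Bruhat type. Only the rank at k is affected: if c <= eta_(k+1),
  the ranks at k - 1 suffice; otherwise c exceeds both entries of eta and the ranks at k + 1
  decide.\<close>

lemma aff_le_swap_mono:
  assumes k: "1 \<le> k" "k < n" and "\<eta> k \<le> \<eta> (Suc k)" and le: "aff_le n \<nu> \<eta>"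
  shows "aff_le n (\<nu> \<circ> swap_idx k) (\<eta> \<circ> swap_idx k)"
  unfolding aff_le_def
proof (intro conjI allI impI)
  fix p c assume p: "p \<le> n"
  have r: "rnk n p c \<nu> \<le> rnk n p c \<eta>" if "p \<le> n" for p
    using le that by (simp add: aff_le_def)
  show "rnk n p c (\<nu> \<circ> swap_idx k) \<le> rnk n p c (\<eta> \<circ> swap_idx k)"
  proof (cases "p = k")
    case True
    have r1: "rnk n (k - 1) c \<nu> \<le> rnk n (k - 1) c \<eta>" and r2: "rnk n (Suc k) c \<nu> \<le> rnk n (Suc k) c \<eta>"
      using k by (auto intro: r)
    show ?thesis
      unfolding True rnk_swap_eq[OF k]
      using r1 r2 k assms(3) rnk_step[of k n c \<eta>] rnk_step[of "Suc k" n c \<eta>]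
        rnk_step[of k n c \<nu>] rnk_step[of "Suc k" n c \<nu>]
      by (auto split: if_splits)
  qed (simp add: rnk_swap[OF k] r p)
qed (use k le in \<open>simp add: aff_le_def\<close>)

text \<open>A rank is a sum of convex functions, x - c truncated at 0, so moving two entries towards
  each other can only lower it. The larger entry stands at k, so this persists for p = k, where the
  argument at k is raised by one: a + 1 and b still lie between \<open>\<nu> (Suc k)\<close> and
  \<open>\<nu> k + 1\<close>.\<close>

lemma aff_le_between:
  assumes k: "1 \<le> k" "k < n" and ab: "a + b = \<nu> k + \<nu> (Suc k)" "\<nu> (Suc k) \<le> a" "\<nu> (Suc k) \<le> b"
  shows "aff_le n (\<nu>(k := a, Suc k := b)) \<nu>"
proof -
  define S where "S = {1..n} - {k, Suc k}"
  have split: "(\<Sum>j=1..n. f j) = sum f S + (f k + f (Suc k))" for f :: "nat \<Rightarrow> nat"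
  proof -
    have "sum f {1..n} = sum f S + sum f {k, Suc k}"
      unfolding S_def using k by (intro sum.subset_diff) auto
    then show ?thesis by simp
  qed
  have S: "sum (\<lambda>j. g j ((\<nu>(k := a, Suc k := b)) j)) S = sum (\<lambda>j. g j (\<nu> j)) S" for g :: "nat \<Rightarrow> nat \<Rightarrow> nat"
    by (rule sum.cong) (auto simp: S_def)
  show ?thesis
    unfolding aff_le_def
  proof (intro conjI allI impI)
    show "csize n (\<nu>(k := a, Suc k := b)) = csize n \<nu>"
      unfolding csize_def split S[of "\<lambda>j x. x"] using ab by simp
    fix p c assume "p \<le> n"
    show "rnk n p c (\<nu>(k := a, Suc k := b)) \<le> rnk n p c \<nu>"
      unfolding rnk_def split S[of "\<lambda>j x. x + (if j \<le> p then 1 else 0) - c"] using ab by auto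
  qed
qed

text \<open>In the periodic extension \<open>Phi_comp\<close> is the translation of indices by one,
  so ranks at p become ranks at p + 1. Only p = n wraps around, which costs one in c
  (\<open>rnk_Phi_comp_last\<close>).\<close>

lemma rnk_Phi_comp:
  assumes n: "n \<ge> 1" and "p < n"
  shows "rnk n p c (Phi_comp n \<eta>) = rnk n (Suc p) c \<eta>"
proof -
  have "rnk n p c (Phi_comp n \<eta>) =
      (\<Sum>j=1..<n. Phi_comp n \<eta> j + (if j \<le> p then 1 else 0) - c) +
      (Phi_comp n \<eta> n + (if n \<le> p then 1 else 0) - c)"
    unfolding rnk_def by (rule sum_split_last[OF n])
  also have "\<dots> = (\<Sum>j=1..<n. \<eta> (Suc j) + (if Suc j \<le> Suc p then 1 else 0) - c) +
      (\<eta> 1 + (if 1 \<le> Suc p then 1 else 0) - c)"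
    using assms by (intro arg_cong2[where f = "(+)"] sum.cong) (auto simp: Phi_comp_def)
  also have "\<dots> = rnk n (Suc p) c \<eta>"
    unfolding rnk_def by (rule sum_Phi_shift[OF n, symmetric])
  finally show ?thesis .
qed

lemma rnk_Phi_comp_last:
  assumes n: "n \<ge> 1"
  shows "rnk n n (Suc c) (Phi_comp n \<eta>) = rnk n 1 c \<eta>"
proof -
  have "rnk n n (Suc c) (Phi_comp n \<eta>) =
      (\<Sum>j=1..<n. Phi_comp n \<eta> j + (if j \<le> n then 1 else 0) - Suc c) +
      (Phi_comp n \<eta> n + (if n \<le> n then 1 else 0) - Suc c)"
    unfolding rnk_def by (rule sum_split_last[OF n])
  also have "\<dots> = (\<Sum>j=1..<n. \<eta> (Suc j) + (if Suc j \<le> 1 then 1 else 0) - c) +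
      (\<eta> 1 + (if 1 \<le> (1::nat) then 1 else 0) - c)"
    using assms by (intro arg_cong2[where f = "(+)"] sum.cong) (auto simp: Phi_comp_def)
  also have "\<dots> = rnk n (1) c \<eta>"
    unfolding rnk_def by (rule sum_Phi_shift[OF n, symmetric])
  finally show ?thesis .
qed

lemma rnk_0: "p \<le> n \<Longrightarrow> rnk n p 0 \<eta> = csize n \<eta> + p"
  by (induction p) (simp_all add: rnk_step, simp add: rnk_def csize_def)

lemma aff_le_Phi_comp:
  assumes n: "n \<ge> 1" and le: "aff_le n \<nu> \<eta>"
  shows "aff_le n (Phi_comp n \<nu>) (Phi_comp n \<eta>)"
  unfolding aff_le_def
proof (intro conjI allI impI)
  show cs: "csize n (Phi_comp n \<nu>) = csize n (Phi_comp n \<eta>)"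
    using le n by (simp add: csize_Phi_comp aff_le_def)
  fix p c assume p: "p \<le> n"
  consider "p < n" | "p = n" "c = 0" | c' where "p = n" "c = Suc c'"
    using p by (cases c; cases "p = n") auto
  then show "rnk n p c (Phi_comp n \<nu>) \<le> rnk n p c (Phi_comp n \<eta>)"
  proof cases
    case 1
    then show ?thesis using le n by (simp add: rnk_Phi_comp aff_le_def)
  next
    case 2
    then show ?thesis using cs by (simp add: rnk_0)
  next
    case 3
    then show ?thesis using le n rnk_Phi_comp_last[OF n] by (simp add: aff_le_def)
  qed
qed

lemma Phi_comp_inject:
  assumes "n \<ge> 1" "\<mu> \<in> compositions n" "\<eta> \<in> compositions n" "Phi_comp n \<mu> = Phi_comp n \<eta>"
  shows "\<mu> = \<eta>"
proof (rule compositions_eqI[OF assms(2,3)])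
  fix j assume j: "1 \<le> j" "j \<le> n"
  have *: "Phi_comp n \<mu> i = Phi_comp n \<eta> i" for i using assms(4) by simp
  show "\<mu> j = \<eta> j"
  proof (cases "j = 1")
    case True
    then show ?thesis using *[of n] by (simp add: Phi_comp_def)
  next
    case False
    then show ?thesis using *[of "j - 1"] j by (cases j) (auto simp: Phi_comp_def)
  qed
qed

section \<open>Ranks against the order of the triangularity condition\<close>

lemma comp_plus_sum:
  "(\<Sum>j=1..n. f (comp_plus n \<eta> j)) = (\<Sum>j=1..n. f (\<eta> j))"
proof -
  let ?xs = "map \<eta> [1..<Suc n]"
  have len: "length (rev (sort ?xs)) = n"
    by simp
  have "(\<Sum>j=1..n. f (comp_plus n \<eta> j)) = (\<Sum>j=1..n. f (rev (sort ?xs) ! (j - 1)))"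
    by (intro sum.cong) (auto simp: comp_plus_def)
  also have "\<dots> = (\<Sum>j<n. f (rev (sort ?xs) ! j))"
    by (rule sum.reindex_bij_witness[where i = Suc and j = "\<lambda>j. j - 1"]) auto
  also have "\<dots> = sum_list (map f (rev (sort ?xs)))"
    using len by (simp add: sum_list_sum_nth atLeast0LessThan del: upt_Suc)
  also have "\<dots> = sum_mset (image_mset f (mset (rev (sort ?xs))))"
    by (metis mset_map sum_mset_sum_list)
  also have "\<dots> = sum_mset (image_mset f (mset ?xs))"
    by simp
  also have "\<dots> = sum_list (map f ?xs)"
    by (metis mset_map sum_mset_sum_list)
  also have "\<dots> = (\<Sum>j=1..n. f (\<eta> j))"
    by (simp only: map_map o_def interv_sum_list_conv_sum_set_nat set_upt atLeastLessThanSuc_atLeastAtMost)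
  finally show ?thesis .
qed

lemma comp_plus_antimono:
  assumes "1 \<le> i" "i \<le> j" "j \<le> n"
  shows "comp_plus n \<eta> j \<le> comp_plus n \<eta> i"
proof -
  let ?xs = "sort (map \<eta> [1..<Suc n])"
  have len: "length ?xs = n" by simp
  have "?xs ! (n - j) \<le> ?xs ! (n - i)"
    using assms len by (intro sorted_nth_mono) auto
  moreover have "rev ?xs ! (i - 1) = ?xs ! (n - i)" "rev ?xs ! (j - 1) = ?xs ! (n - j)"
    using assms len by (subst rev_nth; simp)+
  ultimately show ?thesis
    using assms by (simp add: comp_plus_def)
qed

text \<open>The sum of the p largest parts is the minimum over c of p c plus the sum of all x - c
  truncated at 0, and the latter sums are ranks at 0. The minimum is attained at the p-th largest
  part, so c is taken from eta, the side where equality is required.\<close>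

lemma comp_plus_dominates:
  assumes h: "\<And>c. rnk n 0 c \<mu> \<le> rnk n 0 c \<eta>" and p: "1 \<le> p" "p \<le> n"
  shows "(\<Sum>i=1..p. comp_plus n \<mu> i) \<le> (\<Sum>i=1..p. comp_plus n \<eta> i)"
proof -
  define c where "c = comp_plus n \<eta> p"
  have h': "(\<Sum>j=1..n. \<mu> j - c) \<le> (\<Sum>j=1..n. \<eta> j - c)"
  proof -
    have "rnk n 0 c \<nu> = (\<Sum>j=1..n. \<nu> j - c)" for \<nu>
      unfolding rnk_def by (intro sum.cong) auto
    then show ?thesis using h[of c] by simp
  qed
  have "(\<Sum>i=1..p. comp_plus n \<mu> i) \<le> (\<Sum>i=1..p. c + (comp_plus n \<mu> i - c))"
    by (intro sum_mono) auto
  also have "\<dots> = p * c + (\<Sum>i=1..p. comp_plus n \<mu> i - c)"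
    by (simp add: sum.distrib)
  also have "(\<Sum>i=1..p. comp_plus n \<mu> i - c) \<le> (\<Sum>i=1..n. comp_plus n \<mu> i - c)"
    using p by (intro sum_mono2) auto
  also have "\<dots> \<le> (\<Sum>i=1..n. comp_plus n \<eta> i - c)"
    using h' by (simp only: comp_plus_sum[where f = "\<lambda>x. x - c"])
  also have "\<dots> = (\<Sum>i=1..p. comp_plus n \<eta> i - c)"
    using p comp_plus_antimono[of p _ n \<eta>] by (intro sum.mono_neutral_right) (auto simp: c_def)
  also have "p * c + \<dots> = (\<Sum>i=1..p. c + (comp_plus n \<eta> i - c))"
    by (simp add: sum.distrib)
  also have "\<dots> = (\<Sum>i=1..p. comp_plus n \<eta> i)"
    using p comp_plus_antimono[of _ p n \<eta>] by (intro sum.cong) (auto simp: c_def)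
  finally show ?thesis by simp
qed

lemma rnk_eq_card: "p \<le> n \<Longrightarrow> rnk n p c \<eta> = rnk n 0 c \<eta> + card {j \<in> {1..p}. c \<le> \<eta> j}"
proof (induction p)
  case (Suc p)
  have "{j \<in> {1..Suc p}. c \<le> \<eta> j} = (if c \<le> \<eta> (Suc p) then insert (Suc p) else id) {j \<in> {1..p}. c \<le> \<eta> j}"
    by (auto simp: le_Suc_eq)
  then show ?case using Suc rnk_step[of "Suc p" n c \<eta>] by auto
qed simp

text \<open>Cells of a diagram counted by columns instead of rows; it converts inequalities between
  counts for all thresholds c into inequalities between partial sums.\<close>

lemma sum_eq_sum_card:
  assumes "\<And>j. j \<in> A \<Longrightarrow> \<eta> j \<le> N" "finite A"
  shows "(\<Sum>j\<in>A. \<eta> j) = (\<Sum>c=1..N. card {j \<in> A. c \<le> (\<eta> j :: nat)})"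
proof -
  have "(\<Sum>c=1..N. card {j \<in> A. c \<le> \<eta> j}) = (\<Sum>c=1..N. \<Sum>j\<in>A. if c \<le> \<eta> j then 1 else 0)"
    using assms(2) by (simp add: sum.If_cases Int_def)
  also have "\<dots> = (\<Sum>j\<in>A. \<Sum>c=1..N. if c \<le> \<eta> j then 1 else 0)"
    by (rule sum.swap)
  also have "\<dots> = (\<Sum>j\<in>A. \<eta> j)"
  proof (rule sum.cong)
    fix j assume "j \<in> A"
    then have "{1..N} \<inter> {c. c \<le> \<eta> j} = {1..\<eta> j}" using assms(1)[of j] by auto
    then show "(\<Sum>c=1..N. if c \<le> \<eta> j then 1 else 0) = \<eta> j"
      by (simp add: sum.If_cases)
  qed simp
  finally show ?thesis ..
qed

lemma dom_less_iff:
  "dom_less n \<mu> \<eta> \<longleftrightarrow> \<mu> \<noteq> \<eta> \<and> (\<forall>p\<in>{1..n}. (\<Sum>i=1..p. \<mu> i) \<le> (\<Sum>i=1..p. \<eta> i))"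
proof -
  have "(\<Sum>i=1..p. int (\<eta> i) - int (\<mu> i)) \<ge> 0 \<longleftrightarrow> (\<Sum>i=1..p. \<mu> i) \<le> (\<Sum>i=1..p. \<eta> i)" for p
    by (simp add: sum_subtractf of_nat_sum[symmetric] del: of_nat_sum)
  then show ?thesis by (simp add: dom_less_def)
qed

text \<open>Ranks at p = 0 depend only on the sorted parts and give dominance of the partitions. If
  the partitions agree, so do these ranks; what remains of the rank at p counts the entries at least
  c among the first p, and summing over c yields the partial sums.\<close>

lemma aff_le_imp_comp_prec:
  assumes "aff_le n \<mu> \<eta>" "\<mu> \<noteq> \<eta>"
  shows "comp_prec n \<mu> \<eta>"
proof -
  have r: "rnk n p c \<mu> \<le> rnk n p c \<eta>" if "p \<le> n" for p c
    using assms that by (simp add: aff_le_def)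
  show ?thesis
  proof (cases "comp_plus n \<mu> = comp_plus n \<eta>")
    case False
    then show ?thesis
      using assms(1) comp_plus_dominates[of n \<mu> \<eta>, OF r] by (auto simp: comp_prec_def dom_less_iff aff_le_def)
  next
    case True
    have "rnk n 0 c \<nu> = (\<Sum>j=1..n. comp_plus n \<nu> j - c)" for \<nu> c
      unfolding rnk_def comp_plus_sum[of "\<lambda>x. x - c"] by (intro sum.cong) auto
    then have "rnk n 0 c \<mu> = rnk n 0 c \<eta>" for c
      using True by simp
    then have card: "card {j \<in> {1..p}. c \<le> \<mu> j} \<le> card {j \<in> {1..p}. c \<le> \<eta> j}" if "p \<le> n" for p c
      using r[OF that, of c] rnk_eq_card[OF that, of c \<mu>] rnk_eq_card[OF that, of c \<eta>] by (metis add_le_cancel_left)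
    have "(\<Sum>i=1..p. \<mu> i) \<le> (\<Sum>i=1..p. \<eta> i)" if "p \<le> n" for p
    proof -
      define N where "N = (\<Sum>i=1..p. \<mu> i) + (\<Sum>i=1..p. \<eta> i)"
      have "\<mu> j \<le> N" "\<eta> j \<le> N" if "j \<in> {1..p}" for j
        using that member_le_sum[of j "{1..p}" \<mu>] member_le_sum[of j "{1..p}" \<eta>] by (auto simp: N_def)
      then have "(\<Sum>i=1..p. \<mu> i) = (\<Sum>c=1..N. card {j \<in> {1..p}. c \<le> \<mu> j})"
        "(\<Sum>i=1..p. \<eta> i) = (\<Sum>c=1..N. card {j \<in> {1..p}. c \<le> \<eta> j})"
        by (blast intro: sum_eq_sum_card)+
      then show ?thesis
        using sum_mono[of "{1..N}", OF card[OF that]] by simp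
    qed
    then show ?thesis
      using True assms by (auto simp: comp_prec_def dom_less_iff aff_le_def)
  qed
qed

lemma partial_sums_eqI:
  fixes \<mu> \<eta> :: "nat \<Rightarrow> nat"
  assumes "\<And>p. 1 \<le> p \<Longrightarrow> p \<le> n \<Longrightarrow> (\<Sum>i=1..p. \<mu> i) = (\<Sum>i=1..p. \<eta> i :: nat)" "1 \<le> j" "j \<le> n"
  shows "\<mu> j = \<eta> j"
proof -
  have "(\<Sum>i=1..Suc p. \<mu> i) = (\<Sum>i=1..p. \<mu> i) + \<mu> (Suc p)" for p and \<mu> :: "nat \<Rightarrow> nat"
    by simp
  then show ?thesis
    using assms(1)[of j] assms(1)[of "j - 1"] assms(2,3) by (cases j; cases "j - 1") fastforce+
qed

lemma comp_prec_asym: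
  assumes "comp_prec n \<mu> \<eta>" "comp_prec n \<eta> \<mu>" "\<mu> \<in> compositions n" "\<eta> \<in> compositions n"
  shows False
proof -
  have asym: False if "dom_less n \<mu> \<eta>" "dom_less n \<eta> \<mu>" "\<mu> \<in> compositions n" "\<eta> \<in> compositions n" for \<mu> \<eta>
  proof -
    have le: "\<forall>p\<in>{1..n}. (\<Sum>i=1..p. \<mu> i) \<le> (\<Sum>i=1..p. \<eta> i)" "\<forall>p\<in>{1..n}. (\<Sum>i=1..p. \<eta> i) \<le> (\<Sum>i=1..p. \<mu> i)"
      using that(1,2) unfolding dom_less_iff by blast+
    have "\<mu> = \<eta>"
    proof (rule compositions_eqI[OF that(3,4)])
      fix j assume "1 \<le> j" "j \<le> n"
      moreover have "(\<Sum>i=1..p. \<mu> i) = (\<Sum>i=1..p. \<eta> i)" if "1 \<le> p" "p \<le> n" for p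
      proof (rule antisym)
        show "(\<Sum>i=1..p. \<mu> i) \<le> (\<Sum>i=1..p. \<eta> i)" "(\<Sum>i=1..p. \<eta> i) \<le> (\<Sum>i=1..p. \<mu> i)"
          using bspec[OF le(1), of p] bspec[OF le(2), of p] that by (simp_all only: atLeastAtMost_iff)
      qed
      ultimately show "\<mu> j = \<eta> j" using partial_sums_eqI[of n \<mu> \<eta> j] by blast
    qed
    then show False using that by (simp add: dom_less_def)
  qed
  have "comp_plus n \<nu> \<in> compositions n" for \<nu>
    by (auto simp: compositions_def comp_plus_def)
  then show False
    using assms asym[of \<mu> \<eta>] asym[of "comp_plus n \<mu>" "comp_plus n \<eta>"]
    unfolding comp_prec_def by (metis dom_less_def)
qed

section \<open>Eigenvalues\<close>

lemma lprime_eq_card: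
  "1 \<le> i \<Longrightarrow> i \<le> n \<Longrightarrow> lprime n \<eta> i = card {j \<in> {1..n}. (j < i \<and> \<eta> j \<ge> \<eta> i) \<or> (j > i \<and> \<eta> j > \<eta> i)}"
proof -
  assume i: "1 \<le> i" "i \<le> n"
  have "{j \<in> {1..n}. (j < i \<and> \<eta> j \<ge> \<eta> i) \<or> (j > i \<and> \<eta> j > \<eta> i)} =
      {j \<in> {1..<i}. \<eta> j \<ge> \<eta> i} \<union> {j \<in> {i<..n}. \<eta> j > \<eta> i}"
    using i by auto
  also have "card \<dots> = lprime n \<eta> i"
    unfolding lprime_def by (rule card_Un_disjoint) auto
  finally show ?thesis by simp
qed

lemma lprime_eq_sum:
  "1 \<le> i \<Longrightarrow> i \<le> n \<Longrightarrow>
    lprime n \<eta> i = (\<Sum>j=1..n. if (j < i \<and> \<eta> j \<ge> \<eta> i) \<or> (j > i \<and> \<eta> j > \<eta> i) then 1 else 0)"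
  by (simp add: lprime_eq_card sum.If_cases Int_def)

text \<open>\<open>lprime\<close> breaks ties by position, so the count follows the entries when the
  two exchanged ones differ.\<close>

lemma lprime_swap:
  assumes k: "1 \<le> k" "k < n" and ne: "\<eta> k \<noteq> \<eta> (Suc k)" and i: "1 \<le> i" "i \<le> n"
  shows "lprime n (\<eta> \<circ> swap_idx k) i = lprime n \<eta> (swap_idx k i)"
proof -
  have si: "1 \<le> swap_idx k i" "swap_idx k i \<le> n"
    using k i by (auto simp: swap_idx_def)
  let ?h = "\<lambda>j. if (j < i \<and> (\<eta> \<circ> swap_idx k) j \<ge> (\<eta> \<circ> swap_idx k) i) \<or>
      (j > i \<and> (\<eta> \<circ> swap_idx k) j > (\<eta> \<circ> swap_idx k) i) then 1 else 0 :: nat"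
  have "lprime n (\<eta> \<circ> swap_idx k) i = (\<Sum>j=1..n. ?h (swap_idx k j))"
    unfolding lprime_eq_sum[OF i] by (rule sum_swap_idx[OF k, symmetric])
  also have "\<dots> = lprime n \<eta> (swap_idx k i)"
    unfolding lprime_eq_sum[OF si] using ne by (intro sum.cong) (auto simp: swap_idx_def)
  finally show ?thesis .
qed

lemma lprime_Phi_comp:
  assumes n: "n \<ge> 1" and i: "1 \<le> i" "i \<le> n"
  shows "lprime n (Phi_comp n \<eta>) i = (if i = n then lprime n \<eta> 1 else lprime n \<eta> (Suc i))"
proof -
  define i' where "i' = (if i = n then 1 else Suc i)"
  have i': "1 \<le> i'" "i' \<le> n" using n i by (auto simp: i'_def)
  let ?g = "\<lambda>j. if (j < i' \<and> \<eta> j \<ge> \<eta> i') \<or> (j > i' \<and> \<eta> j > \<eta> i') then 1 else 0 :: nat"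
  have "lprime n (Phi_comp n \<eta>) i = (\<Sum>j=1..<n. ?g (Suc j)) + ?g 1"
    unfolding lprime_eq_sum[OF i] sum_split_last[OF n]
    using i n by (intro arg_cong2[where f = "(+)"] sum.cong) (auto simp: Phi_comp_def i'_def)
  also have "\<dots> = lprime n \<eta> i'"
    unfolding lprime_eq_sum[OF i'] by (rule sum_Phi_shift[OF n, symmetric])
  finally show ?thesis by (simp add: i'_def)
qed

lemma lprime_less:
  assumes "1 \<le> i" "i < j" "j \<le> n" "\<eta> i = \<eta> j"
  shows "lprime n \<eta> i < lprime n \<eta> j"
proof -
  let ?A = "\<lambda>i. {l \<in> {1..n}. (l < i \<and> \<eta> l \<ge> \<eta> i) \<or> (l > i \<and> \<eta> l > \<eta> i)}"
  have "1 \<le> j" "i \<le> n" using assms by auto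
  have "l \<in> ?A j" if "l \<in> ?A i" for l
    using that assms(2,4) by (cases l j rule: linorder_cases) auto
  moreover have "i \<in> ?A j" "i \<notin> ?A i" using assms by auto
  ultimately have "?A i \<subset> ?A j" by blast
  then show ?thesis
    unfolding lprime_eq_card[OF assms(1) \<open>i \<le> n\<close>] lprime_eq_card[OF \<open>1 \<le> j\<close> assms(3)]
    by (intro psubset_card_mono) auto
qed

text \<open>Excludes the coincidence of q times the i-th eigenvalue with the j-th one for i < j, at
  which the factor of A_I that closes the cycle would have a zero denominator.\<close>

lemma lprime_Suc_less:
  assumes "1 \<le> i" "i < j" "j \<le> n" "\<eta> j = Suc (\<eta> i)"
  shows "lprime n \<eta> j < lprime n \<eta> i"
proof -
  let ?A = "\<lambda>i. {l \<in> {1..n}. (l < i \<and> \<eta> l \<ge> \<eta> i) \<or> (l > i \<and> \<eta> l > \<eta> i)}"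
  have "1 \<le> j" "i \<le> n" using assms by auto
  have "l \<in> ?A i" if "l \<in> ?A j" for l
    using that assms(2,4) by (cases l i rule: linorder_cases) auto
  moreover have "j \<in> ?A i" "j \<notin> ?A j" using assms by auto
  ultimately have "?A j \<subset> ?A i" by blast
  then show ?thesis
    unfolding lprime_eq_card[OF assms(1) \<open>i \<le> n\<close>] lprime_eq_card[OF \<open>1 \<le> j\<close> assms(3)]
    by (intro psubset_card_mono) auto
qed

lemma lprime_adjacent:
  assumes "1 \<le> k" "k < n" "\<eta> k = \<eta> (Suc k)"
  shows "lprime n \<eta> (Suc k) = Suc (lprime n \<eta> k)"
proof -
  let ?A = "\<lambda>i. {l \<in> {1..n}. (l < i \<and> \<eta> l \<ge> \<eta> i) \<or> (l > i \<and> \<eta> l > \<eta> i)}"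
  have *: "1 \<le> Suc k" "Suc k \<le> n" "k \<le> n" using assms by auto
  have "l \<in> ?A (Suc k) \<longleftrightarrow> l \<in> insert k (?A k)" for l
    using assms by (cases "l = k"; cases "l = Suc k") auto
  then have "?A (Suc k) = insert k (?A k)" by blast
  then show ?thesis
    unfolding lprime_eq_card[OF assms(1) \<open>k \<le> n\<close>] lprime_eq_card[OF *(1,2)] by simp
qed

section \<open>Action on monomials\<close>

global_interpretation mp: vector_space "\<lambda>c (f :: 'a::field mpoly). Const c * f"
  by unfold_locales (simp_all add: algebra_simps)

lemma lin_op_span:
  assumes F: "lin_op F" and x: "x \<in> mp.span B" and B: "\<And>b. b \<in> B \<Longrightarrow> F b \<in> mp.span C"
  shows "F x \<in> mp.span C"
  using x
proof (induction rule: mp.span_induct_alt)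
  case base
  then show ?case by (simp add: lin_op_0[OF F] mp.span_zero)
next
  case (step c x y)
  then show ?case
    by (simp add: lin_op_simps[OF F] mp.span_add mp.span_scale B)
qed

lemma span_image_finite:
  assumes "x \<in> mp.span (f ` S)"
  shows "\<exists>F. finite F \<and> F \<subseteq> S \<and> x \<in> mp.span (f ` F)"
  using assms
proof (induction rule: mp.span_induct_alt)
  case base
  show ?case by (rule exI[of _ "{}"]) simp
next
  case (step c x y)
  then obtain F s where F: "finite F" "F \<subseteq> S" "y \<in> mp.span (f ` F)" and s: "s \<in> S" "x = f s"
    by blast
  have "Const c * x + y \<in> mp.span (f ` insert s F)"
  proof (intro mp.span_add mp.span_scale)
    show "x \<in> mp.span (f ` insert s F)" using s by (intro mp.span_base) auto
    show "y \<in> mp.span (f ` insert s F)" using F(3) mp.span_mono[of "f ` F" "f ` insert s F"] by auto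
  qed
  then show ?case using F s by (intro exI[of _ "insert s F"]) auto
qed

lemma Const_power: "Const (c ^ m) = Const c ^ m"
  by (induction m) simp_all

lemma T_op_pow_right:
  "T_op t k (zvar (Suc k) ^ e) =
    Const t * zvar k ^ e + (Const t - 1) * (\<Sum>i=1..e. zvar k ^ (e - i) * zvar (Suc k) ^ i)"
proof (induction e)
  case (Suc e)
  have "(\<Sum>i=1..Suc e. zvar k ^ (Suc e - i) * zvar (Suc k) ^ i) =
     zvar k * (\<Sum>i=1..e. zvar k ^ (e - i) * zvar (Suc k) ^ i) + (zvar (Suc k) ^ Suc e :: 'a mpoly)"
    by (simp add: sum_distrib_left Suc_diff_le mult.assoc)
  then show ?case
    using Suc by (simp add: T_op_zvar_right del: sum.cl_ivl_Suc) (simp add: algebra_simps)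
qed simp

lemma T_op_pow_left:
  "T_op t k (zvar k ^ e) =
    Const t * zvar (Suc k) ^ e + (1 - Const t) * (\<Sum>i=1..e. zvar k ^ (e - i) * zvar (Suc k) ^ i)"
proof (induction e)
  case (Suc e)
  have "(\<Sum>i=1..Suc e. zvar k ^ (Suc e - i) * zvar (Suc k) ^ i) =
     (\<Sum>i=0..e. zvar k ^ (e - i) * zvar (Suc k) ^ Suc i :: 'a mpoly)"
    using sum.shift_bounds_cl_Suc_ivl[of "\<lambda>i. zvar k ^ (Suc e - i) * zvar (Suc k) ^ i :: 'a mpoly" 0 e] by simp
  also have "\<dots> = zvar (Suc k) * (\<Sum>i=1..e. zvar k ^ (e - i) * zvar (Suc k) ^ i) + zvar (Suc k) * zvar k ^ e"
    by (simp add: sum.atLeast_Suc_atMost sum_distrib_left algebra_simps)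
  finally show ?case
    using Suc by (simp add: T_op_zvar_left del: sum.cl_ivl_Suc) (simp add: algebra_simps)
qed simp

lemma T_op_commute_prod:
  assumes "\<And>j f. j \<in> S \<Longrightarrow> T_op t k (g j * f) = g j * T_op t k f"
  shows "T_op t k (prod g S * f) = prod g S * T_op t k f"
  using assms by (induction S arbitrary: f rule: infinite_finite_induct) (simp_all add: mult.assoc)

lemma T_op_commute_power:
  assumes "\<And>f. T_op t k (g * f) = g * T_op t k f"
  shows "T_op t k (g ^ m * f) = g ^ m * T_op t k f"
  using assms by (induction m) (simp_all add: mult.assoc)

lemma T_op_commute_pair: "T_op t k ((zvar k * zvar (Suc k)) * f) = (zvar k * zvar (Suc k)) * T_op t k f"
  by (simp add: T_op_zvar_left T_op_zvar_right mult.assoc) (simp add: algebra_simps)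

definition zrest :: "nat \<Rightarrow> nat \<Rightarrow> (nat \<Rightarrow> nat) \<Rightarrow> 'a::field mpoly" where
  "zrest n k \<nu> = (\<Prod>j\<in>{1..n} - {k, Suc k}. zvar j ^ \<nu> j)"

lemma zpow_upd:
  assumes "1 \<le> k" "k < n"
  shows "zpow n (\<nu>(k := a, Suc k := b)) = zrest n k \<nu> * (zvar k ^ a * zvar (Suc k) ^ b)"
proof -
  have "zpow n (\<nu>(k := a, Suc k := b)) =
     (\<Prod>j\<in>{1..n} - {k, Suc k}. zvar j ^ (\<nu>(k := a, Suc k := b)) j) * (\<Prod>j\<in>{k, Suc k}. zvar j ^ (\<nu>(k := a, Suc k := b)) j :: 'a mpoly)"
    unfolding zpow_def using assms by (intro prod.subset_diff) auto
  also have "(\<Prod>j\<in>{1..n} - {k, Suc k}. zvar j ^ (\<nu>(k := a, Suc k := b)) j) = (zrest n k \<nu> :: 'a mpoly)"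
    unfolding zrest_def by (intro prod.cong) auto
  also have "(\<Prod>j\<in>{k, Suc k}. zvar j ^ (\<nu>(k := a, Suc k := b)) j) = (zvar k ^ a * zvar (Suc k) ^ b :: 'a mpoly)"
    by simp
  finally show ?thesis .
qed

lemma zpow_split:
  "1 \<le> k \<Longrightarrow> k < n \<Longrightarrow> zpow n \<nu> = zrest n k \<nu> * (zvar k ^ \<nu> k * zvar (Suc k) ^ \<nu> (Suc k))"
  using zpow_upd[of k n \<nu> "\<nu> k" "\<nu> (Suc k)"] by simp

lemma comp_swap_idx_upd: "\<nu> \<circ> swap_idx k = \<nu>(k := \<nu> (Suc k), Suc k := \<nu> k)"
  by (auto simp: fun_eq_iff swap_idx_def)

lemma T_op_zrest: "T_op t k (zrest n k \<nu> * f) = zrest n k \<nu> * T_op t k f"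
  unfolding zrest_def
  by (intro T_op_commute_prod T_op_commute_power T_op_zvar_other) auto

text \<open>The common power of z_k z_(k+1) is symmetric and commutes with T_k, which leaves a power
  of one variable. The sum starts at i = 1, so the exponent pair (M, m) is not in it; if M > m it
  ends with the pair (m, M).\<close>

lemma T_op_zpow:
  fixes \<nu> :: "nat \<Rightarrow> nat"
  assumes k: "1 \<le> k" "k < n"
  defines "m \<equiv> min (\<nu> k) (\<nu> (Suc k))" and "M \<equiv> max (\<nu> k) (\<nu> (Suc k))"
  shows "T_op t k (zpow n \<nu>) = Const t * zpow n (\<nu> \<circ> swap_idx k) +
    Const (if \<nu> k \<le> \<nu> (Suc k) then t - 1 else 1 - t) *
      (\<Sum>i=1..M - m. zpow n (\<nu>(k := M - i, Suc k := m + i)))"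
proof -
  define e where "e = M - m"
  have M: "M = m + e" by (simp add: e_def m_def M_def)
  let ?p = "zrest n k \<nu> * (zvar k * zvar (Suc k)) ^ m :: 'a mpoly"
  have z: "zpow n (\<nu>(k := m + a, Suc k := m + b)) = ?p * (zvar k ^ a * zvar (Suc k) ^ b)" for a b
    unfolding zpow_upd[OF k] by (simp add: power_add power_mult_distrib mult_ac)
  have T: "T_op t k (?p * f) = ?p * T_op t k f" for f
    by (simp only: mult.assoc T_op_zrest T_op_commute_power[OF T_op_commute_pair])
  have sum: "(\<Sum>i=1..e. zpow n (\<nu>(k := M - i, Suc k := m + i))) =
      ?p * (\<Sum>i=1..e. zvar k ^ (e - i) * zvar (Suc k) ^ i)"
    unfolding sum_distrib_left using M by (intro sum.cong refl) (simp add: z[symmetric])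
  show ?thesis
  proof (cases "\<nu> k \<le> \<nu> (Suc k)")
    case True
    then have "\<nu> k = m + 0" "\<nu> (Suc k) = m + e" using M by (simp_all add: m_def M_def)
    then have "zpow n \<nu> = ?p * zvar (Suc k) ^ e" "zpow n (\<nu> \<circ> swap_idx k) = ?p * zvar k ^ e"
      unfolding comp_swap_idx_upd using z[of 0 e] z[of e 0] by (simp_all add: fun_upd_idem)
    then show ?thesis
      using True unfolding e_def[symmetric] sum
      by (simp add: T T_op_pow_right) (simp add: algebra_simps)
  next
    case False
    then have "\<nu> k = m + e" "\<nu> (Suc k) = m + 0" using M by (simp_all add: m_def M_def)
    then have "zpow n \<nu> = ?p * zvar k ^ e" "zpow n (\<nu> \<circ> swap_idx k) = ?p * zvar (Suc k) ^ e"
      unfolding comp_swap_idx_upd using z[of 0 e] z[of e 0] by (simp_all add: fun_upd_idem)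
    then show ?thesis
      using False unfolding e_def[symmetric] sum
      by (simp add: T T_op_pow_left) (simp add: algebra_simps)
  qed
qed

lemma upd_in_compositions:
  "1 \<le> k \<Longrightarrow> k < n \<Longrightarrow> \<nu> \<in> compositions n \<Longrightarrow> \<nu>(k := a, Suc k := b) \<in> compositions n"
  by (auto simp: compositions_def)

definition lower_span :: "nat \<Rightarrow> (nat \<Rightarrow> nat) \<Rightarrow> 'a::field mpoly set" where
  "lower_span n \<eta> = mp.span (zpow n ` {\<nu> \<in> compositions n. aff_le n \<nu> \<eta> \<and> \<nu> \<noteq> \<eta>})"

lemma zpow_in_lower_span:
  "\<nu> \<in> compositions n \<Longrightarrow> aff_le n \<nu> \<eta> \<Longrightarrow> \<nu> \<noteq> \<eta> \<Longrightarrow> zpow n \<nu> \<in> lower_span n \<eta>"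
  unfolding lower_span_def by (intro mp.span_base) auto

lemma lower_span_add: "f \<in> lower_span n \<eta> \<Longrightarrow> g \<in> lower_span n \<eta> \<Longrightarrow> f + g \<in> lower_span n \<eta>"
  and lower_span_diff: "f \<in> lower_span n \<eta> \<Longrightarrow> g \<in> lower_span n \<eta> \<Longrightarrow> f - g \<in> lower_span n \<eta>"
  and lower_span_scale: "f \<in> lower_span n \<eta> \<Longrightarrow> Const c * f \<in> lower_span n \<eta>"
  and lower_span_sum: "(\<And>x. x \<in> S \<Longrightarrow> h x \<in> lower_span n \<eta>) \<Longrightarrow> sum h S \<in> lower_span n \<eta>"
  unfolding lower_span_def by (auto intro: mp.span_add mp.span_diff mp.span_scale mp.span_sum)

text \<open>For eta_k < eta_(k+1) the swapped monomial carries the exponents (M, m), absent from the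
  remaining sum. Hence its coefficient is exactly t, and the other monomials are lower by
  \<open>aff_le_between\<close>.\<close>

lemma T_op_zpow_leading:
  assumes k: "1 \<le> k" "k < n" and \<eta>: "\<eta> \<in> compositions n" and less: "\<eta> k < \<eta> (Suc k)"
  shows "T_op t k (zpow n \<eta>) - Const t * zpow n (\<eta> \<circ> swap_idx k) \<in> lower_span n (\<eta> \<circ> swap_idx k)"
proof -
  have "zpow n (\<eta>(k := \<eta> (Suc k) - i, Suc k := \<eta> k + i)) \<in> lower_span n (\<eta> \<circ> swap_idx k)"
    if i: "i \<in> {1..\<eta> (Suc k) - \<eta> k}" for i
  proof (rule zpow_in_lower_span)
    have "aff_le n ((\<eta> \<circ> swap_idx k)(k := \<eta> (Suc k) - i, Suc k := \<eta> k + i)) (\<eta> \<circ> swap_idx k)"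
      using k i less by (intro aff_le_between) auto
    then show "aff_le n (\<eta>(k := \<eta> (Suc k) - i, Suc k := \<eta> k + i)) (\<eta> \<circ> swap_idx k)"
      by (simp add: comp_swap_idx_upd fun_upd_twist)
    have "(\<eta>(k := \<eta> (Suc k) - i, Suc k := \<eta> k + i)) (Suc k) \<noteq> (\<eta> \<circ> swap_idx k) (Suc k)"
      using i by simp
    then show "\<eta>(k := \<eta> (Suc k) - i, Suc k := \<eta> k + i) \<noteq> \<eta> \<circ> swap_idx k"
      by metis
  qed (use k \<eta> in \<open>auto intro: upd_in_compositions\<close>)
  then have "Const (t - 1) * (\<Sum>i=1..\<eta> (Suc k) - \<eta> k. zpow n (\<eta>(k := \<eta> (Suc k) - i, Suc k := \<eta> k + i)))
      \<in> lower_span n (\<eta> \<circ> swap_idx k)"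
    by (intro lower_span_scale lower_span_sum)
  then show ?thesis
    using T_op_zpow[OF k, of t \<eta>] less by (simp add: min_def max_def)
qed

lemma T_op_zpow_lower:
  assumes k: "1 \<le> k" "k < n" and \<nu>: "\<nu> \<in> compositions n" and \<eta>: "\<eta> \<in> compositions n"
    and le: "aff_le n \<nu> \<eta>" "aff_le n (\<nu> \<circ> swap_idx k) \<eta>" and ne: "\<nu> \<noteq> \<eta>" "\<nu> \<circ> swap_idx k \<noteq> \<eta>"
  shows "T_op t k (zpow n \<nu>) \<in> lower_span n \<eta>"
proof -
  have s: "zpow n (\<nu> \<circ> swap_idx k) \<in> lower_span n \<eta>"
    using k \<nu> le(2) ne(2) by (intro zpow_in_lower_span) auto
  define m where "m = min (\<nu> k) (\<nu> (Suc k))"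
  define M where "M = max (\<nu> k) (\<nu> (Suc k))"
  \<comment> \<open>The arrangement of nu with the larger of the two entries at k. It is nu or its
    swap, and it lies above every monomial of the sum.\<close>
  define \<mu> where "\<mu> = \<nu>(k := M, Suc k := m)"
  have "\<mu> = \<nu> \<or> \<mu> = \<nu> \<circ> swap_idx k"
    unfolding comp_swap_idx_upd \<mu>_def m_def M_def by (auto simp: min_def max_def fun_upd_idem)
  then have \<mu>: "aff_le n \<mu> \<eta>" "\<mu> \<noteq> \<eta>" "\<mu> \<in> compositions n"
    using le ne \<nu> k by auto
  have "zpow n (\<nu>(k := M - i, Suc k := m + i)) \<in> lower_span n \<eta>" if i: "i \<in> {1..M - m}" for i
  proof (rule zpow_in_lower_span)
    show "\<nu>(k := M - i, Suc k := m + i) \<in> compositions n"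
      using k \<nu> by (rule upd_in_compositions)
    have "aff_le n (\<mu>(k := M - i, Suc k := m + i)) \<mu>"
      using k i by (intro aff_le_between) (auto simp: \<mu>_def)
    then have 1: "aff_le n (\<nu>(k := M - i, Suc k := m + i)) \<mu>"
      by (simp add: \<mu>_def fun_upd_twist)
    then show "aff_le n (\<nu>(k := M - i, Suc k := m + i)) \<eta>"
      using \<mu>(1) by (rule aff_le_trans)
    show "\<nu>(k := M - i, Suc k := m + i) \<noteq> \<eta>"
      using 1 \<mu> aff_le_antisym[OF \<mu>(1) _ \<mu>(3) \<eta>] by auto
  qed
  then show ?thesis
    using s unfolding T_op_zpow[OF k] m_def[symmetric] M_def[symmetric]
    by (intro lower_span_add lower_span_scale lower_span_sum)
qed

lemma T_op_zpow_compositions: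
  assumes k: "1 \<le> k" "k < n" and \<nu>: "\<nu> \<in> compositions n"
  shows "T_op t k (zpow n \<nu>) \<in> mp.span (zpow n ` compositions n)"
proof -
  have s: "zpow n \<mu> \<in> mp.span (zpow n ` compositions n)" if "\<mu> \<in> compositions n" for \<mu>
    using that by (intro mp.span_base) auto
  show ?thesis
    unfolding T_op_zpow[OF k]
    by (intro mp.span_add mp.span_scale mp.span_sum s upd_in_compositions k \<nu> swap_in_compositions)
qed

context params
begin

lemma w_prod: "w (prod g S) = (\<Prod>j\<in>S. w (g j))"
  by (induction S rule: infinite_finite_induct) (simp_all add: w_hom)

lemma w_power: "w (f ^ m) = w f ^ m"
  by (induction m) (simp_all add: w_hom)

lemma Phi_zpow: "Phi (zpow n \<nu>) = Const (q ^ \<nu> 1) * zpow n (Phi_comp n \<nu>)"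
proof -
  have "w (zpow n \<nu>) = (\<Prod>j=1..<n. w (zvar (Suc j)) ^ \<nu> (Suc j)) * w (zvar 1) ^ \<nu> 1"
    unfolding zpow_def w_prod w_power by (rule prod_Phi_shift[OF n_pos])
  also have "(\<Prod>j=1..<n. w (zvar (Suc j)) ^ \<nu> (Suc j)) = (\<Prod>j=1..<n. zvar j ^ \<nu> (Suc j))"
    by (intro prod.cong) (auto simp: w_zvar_Suc)
  also have "(\<Prod>j=1..<n. zvar j ^ \<nu> (Suc j)) = (\<Prod>j=1..<n. zvar j ^ Phi_comp n \<nu> j)"
    by (intro prod.cong) (auto simp: Phi_comp_def)
  finally show ?thesis
    unfolding Phi_def zpow_def[of n "Phi_comp n \<nu>"] prod_split_last[OF n_pos]
    by (simp add: Phi_comp_def power_mult_distrib Const_power mult_ac)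
qed

end

section \<open>Existence and uniqueness of the nonsymmetric Macdonald polynomials\<close>

text \<open>Multiplicative independence of q and t makes an eigenvalue determine the pair of entry
  and \<open>lprime\<close>. The condition passes to 1/q, 1/t, so the locale can be instantiated at
  both parameter pairs.\<close>

locale generic = params +
  assumes indep: "q powi a * t powi b = 1 \<Longrightarrow> a = 0 \<and> b = 0"
begin

abbreviation "bar \<equiv> eta_bar n q t"

lemma qt_inject:
  assumes "q powi a * t powi b = q powi c * t powi d"
  shows "a = c \<and> b = d"
proof -
  have "q powi (a - c) * t powi (b - d) = (q powi a * t powi b) / (q powi c * t powi d)"
    by (simp add: power_int_diff)
  also have "\<dots> = 1" using assms by simp
  finally show ?thesis using indep by fastforce
qed

lemma bar_eq: "bar \<eta> i = q powi int (\<eta> i) * t powi (- int (lprime n \<eta> i))"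
  by (simp add: eta_bar_def)

lemma bar_nz [simp]: "bar \<eta> i \<noteq> 0"
  by (simp add: bar_eq)

lemma bar_eq_iff: "bar \<mu> i = bar \<eta> j \<longleftrightarrow> \<mu> i = \<eta> j \<and> lprime n \<mu> i = lprime n \<eta> j"
  using qt_inject[of "int (\<mu> i)" "- int (lprime n \<mu> i)" "int (\<eta> j)" "- int (lprime n \<eta> j)"]
  by (auto simp: bar_eq)

lemma bar_distinct:
  assumes "i \<in> {1..n}" "j \<in> {1..n}" "i \<noteq> j"
  shows "bar \<eta> i \<noteq> bar \<eta> j"
  using lprime_less[of i j n \<eta>] lprime_less[of j i n \<eta>] assms
  by (cases i j rule: linorder_cases) (auto simp: bar_eq_iff)

lemma q_bar_distinct:
  assumes "i \<in> {1..n}" "j \<in> {1..n}" "i \<le> j"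
  shows "q * bar \<eta> i \<noteq> bar \<eta> j"
proof
  assume "q * bar \<eta> i = bar \<eta> j"
  moreover have "q * bar \<eta> i = q powi (int (\<eta> i) + 1) * t powi (- int (lprime n \<eta> i))"
    by (simp add: bar_eq power_int_add)
  ultimately have "q powi (int (\<eta> i) + 1) * t powi (- int (lprime n \<eta> i)) =
      q powi int (\<eta> j) * t powi (- int (lprime n \<eta> j))"
    by (simp add: bar_eq)
  from qt_inject[OF this] have "\<eta> j = Suc (\<eta> i)" "lprime n \<eta> i = lprime n \<eta> j" by auto
  moreover from this have "i \<noteq> j" by auto
  ultimately show False using lprime_Suc_less[of i j n \<eta>] assms by auto
qed

lemma bar_adjacent:
  assumes "1 \<le> k" "k < n" "\<eta> k = \<eta> (Suc k)"
  shows "bar \<eta> k = t * bar \<eta> (Suc k)"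
proof -
  have "t powi (- int m) = inverse t ^ m" for m
    by (simp add: power_int_minus power_inverse)
  then show ?thesis
    unfolding eta_bar_def lprime_adjacent[OF assms] using assms(3) by (simp del: of_nat_Suc)
qed

lemma bar_swap:
  assumes "1 \<le> k" "k < n" "\<eta> k \<noteq> \<eta> (Suc k)" "i \<in> {1..n}"
  shows "bar (\<eta> \<circ> swap_idx k) i = bar \<eta> (swap_idx k i)"
  using lprime_swap[OF assms(1-3), of i] assms(4) by (simp add: bar_eq)

lemma bar_Phi_comp:
  assumes "i \<in> {1..n}"
  shows "bar (Phi_comp n \<eta>) i = (if i = n then q * bar \<eta> 1 else bar \<eta> (Suc i))"
  using lprime_Phi_comp[OF n_pos, of i \<eta>] assms by (auto simp: eta_bar_def Phi_comp_def)

text \<open>Triangularity is taken with respect to \<open>aff_le\<close>, which implies the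
  condition in \<open>is_macdonald\<close>: the induction that builds the polynomials carries a
  property compatible with both the intertwiners and \<open>Phi\<close>.\<close>

definition good :: "(nat \<Rightarrow> nat) \<Rightarrow> 'a mpoly \<Rightarrow> bool" where
  "good \<eta> f \<longleftrightarrow> eigen (bar \<eta>) f \<and> f - zpow n \<eta> \<in> lower_span n \<eta>"

lemma eigen_cong: "(\<And>i. i \<in> {1..n} \<Longrightarrow> y i = y' i) \<Longrightarrow> eigen y f \<Longrightarrow> eigen y' f"
  by (simp add: eigen_def)

lemma T_lower_span:
  assumes k: "1 \<le> k" "k < n" and \<eta>: "\<eta> \<in> compositions n" and less: "\<eta> k < \<eta> (Suc k)"
    and f: "f \<in> lower_span n \<eta>"
  shows "T k f \<in> lower_span n (\<eta> \<circ> swap_idx k)" "f \<in> lower_span n (\<eta> \<circ> swap_idx k)"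
proof -
  have s\<eta>: "\<eta> \<circ> swap_idx k \<in> compositions n" "aff_le n \<eta> (\<eta> \<circ> swap_idx k)" "\<eta> \<noteq> \<eta> \<circ> swap_idx k"
  proof -
    have "\<eta> k \<noteq> (\<eta> \<circ> swap_idx k) k" using less by simp
    then show "\<eta> \<noteq> \<eta> \<circ> swap_idx k" by metis
  qed (use k \<eta> less aff_le_swap[OF k, of \<eta>] in auto)
  have le: "aff_le n \<nu> (\<eta> \<circ> swap_idx k)" "aff_le n (\<nu> \<circ> swap_idx k) (\<eta> \<circ> swap_idx k)"
    "\<nu> \<noteq> \<eta> \<circ> swap_idx k" "\<nu> \<circ> swap_idx k \<noteq> \<eta> \<circ> swap_idx k"
    if "\<nu> \<in> compositions n" "aff_le n \<nu> \<eta>" "\<nu> \<noteq> \<eta>" for \<nu>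
  proof -
    show "aff_le n \<nu> (\<eta> \<circ> swap_idx k)"
      using aff_le_trans[OF that(2) s\<eta>(2)] .
    show "aff_le n (\<nu> \<circ> swap_idx k) (\<eta> \<circ> swap_idx k)"
      using k less that by (intro aff_le_swap_mono) auto
    show "\<nu> \<noteq> \<eta> \<circ> swap_idx k"
      using that s\<eta> aff_le_antisym[of n "\<eta> \<circ> swap_idx k" \<eta>] \<eta> by auto
    have "(\<nu> \<circ> swap_idx k) \<circ> swap_idx k = \<nu>" "(\<eta> \<circ> swap_idx k) \<circ> swap_idx k = \<eta>"
      by (auto simp: fun_eq_iff)
    then show "\<nu> \<circ> swap_idx k \<noteq> \<eta> \<circ> swap_idx k"
      using that(3) by metis
  qed
  show "T k f \<in> lower_span n (\<eta> \<circ> swap_idx k)"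
    unfolding lower_span_def
  proof (rule lin_op_span[OF lin_op_T_op f[unfolded lower_span_def]])
    fix b :: "'a mpoly" assume "b \<in> zpow n ` {\<nu> \<in> compositions n. aff_le n \<nu> \<eta> \<and> \<nu> \<noteq> \<eta>}"
    then show "T k b \<in> mp.span (zpow n ` {\<nu> \<in> compositions n. aff_le n \<nu> (\<eta> \<circ> swap_idx k) \<and> \<nu> \<noteq> \<eta> \<circ> swap_idx k})"
      using T_op_zpow_lower[OF k _ s\<eta>(1) le] unfolding lower_span_def by auto
  qed
  have "lower_span n \<eta> \<subseteq> (lower_span n (\<eta> \<circ> swap_idx k) :: 'a mpoly set)"
    unfolding lower_span_def using le by (intro mp.span_mono image_mono) auto
  then show "f \<in> lower_span n (\<eta> \<circ> swap_idx k)" using f by auto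
qed

text \<open>An ascent makes the swapped composition the higher one, so eta and everything below it
  become lower terms. The factor 1/t normalises the leading coefficient found in
  \<open>T_op_zpow_leading\<close>.\<close>

lemma good_T:
  assumes k: "1 \<le> k" "k < n" and \<eta>: "\<eta> \<in> compositions n" and less: "\<eta> k < \<eta> (Suc k)" and f: "good \<eta> f"
  shows "good (\<eta> \<circ> swap_idx k)
    (Const (inverse t) * (T k f - Const ((t - 1) * bar \<eta> k / (bar \<eta> k - bar \<eta> (Suc k))) * f))"
  unfolding good_def
proof
  define a where "a = (t - 1) * bar \<eta> k / (bar \<eta> k - bar \<eta> (Suc k))"
  have ne: "bar \<eta> k \<noteq> bar \<eta> (Suc k)" using less by (simp add: bar_eq_iff)
  have "eigen (bar \<eta> \<circ> swap_idx k) (T k f - Const a * f)"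
    unfolding a_def using f k ne by (intro eigen_T) (auto simp: good_def)
  then show "eigen (bar (\<eta> \<circ> swap_idx k)) (Const (inverse t) * (T k f - Const a * f))"
    using less bar_swap[OF k, of \<eta>] by (intro eigen_scale) (erule eigen_cong[rotated], simp)
  define r where "r = f - zpow n \<eta>"
  have r: "r \<in> lower_span n \<eta>" using f by (simp add: good_def r_def)
  have fr: "f = zpow n \<eta> + r" by (simp add: r_def)
  have \<eta>': "zpow n \<eta> \<in> lower_span n (\<eta> \<circ> swap_idx k)"
  proof (rule zpow_in_lower_span)
    have "\<eta> k \<noteq> (\<eta> \<circ> swap_idx k) k" using less by simp
    then show "\<eta> \<noteq> \<eta> \<circ> swap_idx k" by metis
  qed (use k \<eta> less in \<open>auto intro: aff_le_swap\<close>)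
  have "(T k (zpow n \<eta>) - Const t * zpow n (\<eta> \<circ> swap_idx k)) + T k r - Const a * (zpow n \<eta> + r)
      \<in> lower_span n (\<eta> \<circ> swap_idx k)"
    using T_lower_span(1)[OF k \<eta> less r] T_lower_span(2)[OF k \<eta> less r]
    by (intro lower_span_diff[OF lower_span_add[OF T_op_zpow_leading[OF k \<eta> less, of t]]]
        lower_span_scale lower_span_add[OF \<eta>'])
  then have "Const (inverse t) * ((T k (zpow n \<eta>) - Const t * zpow n (\<eta> \<circ> swap_idx k)) + T k r - Const a * (zpow n \<eta> + r))
      \<in> lower_span n (\<eta> \<circ> swap_idx k)"
    by (rule lower_span_scale)
  also have "Const (inverse t) * ((T k (zpow n \<eta>) - Const t * zpow n (\<eta> \<circ> swap_idx k)) + T k r - Const a * (zpow n \<eta> + r)) =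
      Const (inverse t) * (T k f - Const a * f) - Const (inverse t) * (Const t * zpow n (\<eta> \<circ> swap_idx k))"
  proof -
    have "T k f = T k (zpow n \<eta>) + T k r" unfolding fr by (rule T_op_lin)
    then have "(T k (zpow n \<eta>) - Const t * zpow n (\<eta> \<circ> swap_idx k)) + T k r - Const a * (zpow n \<eta> + r) =
        (T k f - Const a * f) - Const t * zpow n (\<eta> \<circ> swap_idx k)"
      unfolding fr[symmetric] by simp
    then show ?thesis by (simp only: right_diff_distrib)
  qed
  finally show "Const (inverse t) * (T k f - Const a * f) - zpow n (\<eta> \<circ> swap_idx k) \<in> lower_span n (\<eta> \<circ> swap_idx k)"
    by (simp only: Const_inverse_cancel t_nz not_False_eq_True)
qed

text \<open>The scalar compensates the power q^(eta_1) that \<open>Phi\<close> puts on the leading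
  monomial by substituting q z_n for z_1.\<close>

lemma good_Phi:
  assumes \<eta>: "\<eta> \<in> compositions n" and f: "good \<eta> f"
  shows "good (Phi_comp n \<eta>) (Const (inverse (q ^ \<eta> 1)) * Phi f)"
  unfolding good_def
proof
  have "eigen (\<lambda>j. if j = n then q * bar \<eta> 1 else bar \<eta> (Suc j)) (Phi f)"
    using f by (simp add: good_def eigen_Phi)
  then show "eigen (bar (Phi_comp n \<eta>)) (Const (inverse (q ^ \<eta> 1)) * Phi f)"
    using bar_Phi_comp[of _ \<eta>] by (intro eigen_scale) (erule eigen_cong[rotated], simp)
  define r where "r = f - zpow n \<eta>"
  have r: "r \<in> lower_span n \<eta>" using f by (simp add: good_def r_def)
  have fr: "f = zpow n \<eta> + r" by (simp add: r_def)
  have "Phi r \<in> lower_span n (Phi_comp n \<eta>)"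
    unfolding lower_span_def
  proof (rule lin_op_span[OF lin_op_Phi r[unfolded lower_span_def]])
    fix b :: "'a mpoly" assume "b \<in> zpow n ` {\<nu> \<in> compositions n. aff_le n \<nu> \<eta> \<and> \<nu> \<noteq> \<eta>}"
    then obtain \<nu> where \<nu>: "b = zpow n \<nu>" "\<nu> \<in> compositions n" "aff_le n \<nu> \<eta>" "\<nu> \<noteq> \<eta>" by blast
    have "zpow n (Phi_comp n \<nu>) \<in> (lower_span n (Phi_comp n \<eta>) :: 'a mpoly set)"
      using \<nu> \<eta> n_pos Phi_comp_inject[OF n_pos, of \<nu> \<eta>]
      by (intro zpow_in_lower_span) (auto intro: aff_le_Phi_comp)
    then show "Phi b \<in> mp.span (zpow n ` {\<nu> \<in> compositions n. aff_le n \<nu> (Phi_comp n \<eta>) \<and> \<nu> \<noteq> Phi_comp n \<eta>})"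
      unfolding \<nu>(1) Phi_zpow by (intro mp.span_scale) (simp add: lower_span_def)
  qed
  then have "Const (inverse (q ^ \<eta> 1)) * Phi r \<in> lower_span n (Phi_comp n \<eta>)"
    by (rule lower_span_scale)
  also have "Const (inverse (q ^ \<eta> 1)) * Phi r = Const (inverse (q ^ \<eta> 1)) * Phi f - zpow n (Phi_comp n \<eta>)"
    by (simp add: fr Phi_zpow distrib_left Const_inverse_cancel del: power_inverse)
  finally show "Const (inverse (q ^ \<eta> 1)) * Phi f - zpow n (Phi_comp n \<eta>) \<in> lower_span n (Phi_comp n \<eta>)" .
qed

text \<open>Since T_j 1 = t, the powers of t in Y_i 1 add up to (i - n) + (n - i) - (i - 1), and i -
  1 is the value of \<open>lprime\<close> at i for the zero composition, where all earlier entries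
  are ties.\<close>

lemma good_zero: "good (\<lambda>_. 0) 1"
  unfolding good_def
proof
  have Tc: "T i (Const c) = Const (c * t)" for i c by simp
  have T1: "foldr T [i..<j] (Const c) = Const (c * t ^ (j - i))" for i j c
    by (induction j arbitrary: c) (simp_all add: Tc Suc_diff_le mult_ac del: T_op_Const Const_mult)
  have T'c: "T' i (Const c) = Const (c * inverse t)" for i c
  proof -
    have "T i (Const (c * inverse t)) = Const c" by (simp add: Const_mult[symmetric] del: Const_mult)
    then show ?thesis by (metis T_inv_T_op t_nz)
  qed
  have T'1: "foldr T' [1..<Suc m] (Const c) = Const (c * inverse t ^ m)" for m c
    by (induction m arbitrary: c) (simp_all add: T'c mult_ac del: Const_mult)
  have "Y i 1 = Const (bar (\<lambda>_. 0) i) * 1" if i: "i \<in> {1..n}" for i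
  proof -
    obtain m where m: "i = Suc m" using i by (cases i) auto
    have "{j \<in> {1..<i}. (0::nat) \<ge> 0} = {1..<i}" "{j \<in> {i<..n}. (0::nat) > 0} = {}"
      by auto
    then have "lprime n (\<lambda>_. 0) i = m"
      unfolding lprime_def by (simp only: m) simp
    moreover have "t powi (int i - int n) * t ^ (n - i) = 1"
    proof -
      have "t powi (int i - int n) * t ^ (n - i) = t powi ((int i - int n) + int (n - i))"
        by (simp only: power_int_add t_nz power_int_of_nat simp_thms)
      also have "(int i - int n) + int (n - i) = 0" using i by auto
      finally show ?thesis by simp
    qed
    moreover have "foldr T' [1..<i] 1 = Const (inverse t ^ m)"
      using T'1[of m 1] by (simp add: m)
    ultimately show ?thesis
      using i by (simp add: Y_eq w_hom T1 eta_bar_def mult.left_commute power_int_minus power_inverse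
          Const_mult[symmetric] del: Const_mult)
  qed
  then show "eigen (bar (\<lambda>_. 0)) 1" by (simp add: eigen_def)
  show "1 - zpow n (\<lambda>_. 0) \<in> lower_span n (\<lambda>_. 0)"
    by (simp add: zpow_def lower_span_def mp.span_zero)
qed

lemma ex_Phi_comp_preimage:
  assumes \<eta>: "\<eta> \<in> compositions n" and "\<eta> n > 0"
  shows "\<exists>\<nu>\<in>compositions n. \<eta> = Phi_comp n \<nu>"
proof (intro bexI)
  define \<nu> where "\<nu> j = (if j = 1 then \<eta> n - 1 else if 1 < j \<and> j \<le> n then \<eta> (j - 1) else 0)" for j
  show "\<nu> \<in> compositions n"
    using n_pos by (auto simp: compositions_def \<nu>_def)
  then show "\<eta> = Phi_comp n \<nu>"
    using assms n_pos by (intro compositions_eqI[OF \<eta>]) (auto simp: Phi_comp_def \<nu>_def)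
qed

text \<open>The second measure is the number of trailing zeros. A positive last entry comes from
  \<open>Phi\<close> and a composition of smaller size; otherwise the last nonzero entry, at k < n,
  comes by a swap from position k + 1, where there is one trailing zero less.\<close>

lemma ex_good: "\<eta> \<in> compositions n \<Longrightarrow> \<exists>f. good \<eta> f"
proof (induction \<eta> rule: wf_induct_rule[OF wf_measures[of
      "[csize n, \<lambda>\<eta>. card {j \<in> {1..n}. \<forall>i\<in>{j..n}. \<eta> i = 0}]"]])
  case (1 \<eta>)
  note \<eta> = "1.prems"
  show ?case
  proof (cases "\<exists>j\<in>{1..n}. \<eta> j > 0")
    case False
    then have "\<eta> = (\<lambda>_. 0)"
      using \<eta> by (auto simp: compositions_def fun_eq_iff)
    then show ?thesis using good_zero by blast
  next
    case True
    define k where "k = Max {j \<in> {1..n}. \<eta> j > 0}"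
    have "k \<in> {j \<in> {1..n}. \<eta> j > 0}"
      unfolding k_def using True by (intro Max_in) auto
    then have k: "1 \<le> k" "k \<le> n" "\<eta> k > 0" by auto
    have max: "\<eta> j = 0" if "j > k" for j
    proof (cases "j \<le> n")
      case True
      then show ?thesis
        using that k Max_ge[of "{j \<in> {1..n}. \<eta> j > 0}" j] unfolding k_def[symmetric] by fastforce
    next
      case False
      then show ?thesis using \<eta> by (simp add: compositions_def)
    qed
    show ?thesis
    proof (cases "k = n")
      case True
      then obtain \<nu> where \<nu>: "\<nu> \<in> compositions n" "\<eta> = Phi_comp n \<nu>"
        using ex_Phi_comp_preimage[OF \<eta>] k by auto
      then have "csize n \<nu> < csize n \<eta>"
        using n_pos by (simp add: csize_Phi_comp)
      then obtain f where "good \<nu> f" using 1 \<nu> by auto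
      then show ?thesis using good_Phi[OF \<nu>(1)] \<nu>(2) by blast
    next
      case False
      then have kn: "k < n" using k by simp
      define \<nu> where "\<nu> = \<eta> \<circ> swap_idx k"
      have \<nu>: "\<nu> \<in> compositions n" "csize n \<nu> = csize n \<eta>" "\<nu> k < \<nu> (Suc k)" "\<nu> \<circ> swap_idx k = \<eta>"
        using \<eta> k kn max[of "Suc k"] by (auto simp: \<nu>_def fun_eq_iff)
      have "{j \<in> {1..n}. \<forall>i\<in>{j..n}. \<nu> i = 0} \<subset> {j \<in> {1..n}. \<forall>i\<in>{j..n}. \<eta> i = 0}"
      proof
        show "{j \<in> {1..n}. \<forall>i\<in>{j..n}. \<nu> i = 0} \<subseteq> {j \<in> {1..n}. \<forall>i\<in>{j..n}. \<eta> i = 0}"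
        proof safe
          fix j i assume "\<forall>i\<in>{j..n}. \<nu> i = 0" "j \<in> {1..n}" "i \<in> {j..n}"
          moreover from this have "\<not> j \<le> Suc k"
            using \<nu>(3) kn by (metis Suc_leI atLeastAtMost_iff less_nat_zero_code)
          ultimately show "\<eta> i = 0" using max[of i] by auto
        qed
        have "Suc k \<in> {j \<in> {1..n}. \<forall>i\<in>{j..n}. \<eta> i = 0}" using max kn by auto
        moreover have "Suc k \<notin> {j \<in> {1..n}. \<forall>i\<in>{j..n}. \<nu> i = 0}"
          using \<nu>(3) kn by (auto intro!: bexI[of _ "Suc k"])
        ultimately show "{j \<in> {1..n}. \<forall>i\<in>{j..n}. \<nu> i = 0} \<noteq> {j \<in> {1..n}. \<forall>i\<in>{j..n}. \<eta> i = 0}"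
          by blast
      qed
      then have "card {j \<in> {1..n}. \<forall>i\<in>{j..n}. \<nu> i = 0} < card {j \<in> {1..n}. \<forall>i\<in>{j..n}. \<eta> i = 0}"
        by (intro psubset_card_mono) auto
      then obtain f where "good \<nu> f" using 1 \<nu> by auto
      then show ?thesis using good_T[OF k(1) kn \<nu>(1,3)] \<nu>(4) by metis
    qed
  qed
qed

section \<open>The eigenvector basis and its uniqueness\<close>

definition E :: "(nat \<Rightarrow> nat) \<Rightarrow> 'a mpoly" where
  "E \<eta> = (SOME f. good \<eta> f)"

lemma good_E: "\<eta> \<in> compositions n \<Longrightarrow> good \<eta> (E \<eta>)"
  unfolding E_def by (rule someI_ex[OF ex_good])

lemma Y_E: "\<eta> \<in> compositions n \<Longrightarrow> i \<in> {1..n} \<Longrightarrow> Y i (E \<eta>) = Const (bar \<eta> i) * E \<eta>"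
  using good_E[of \<eta>] by (simp add: good_def eigen_def)

text \<open>Inverts the triangular expansion of the E in monomials: every lower nu has a smaller set
  of compositions below it, since eta is no longer in that set.\<close>

lemma zpow_in_span_E:
  "\<eta> \<in> compositions n \<Longrightarrow> zpow n \<eta> \<in> mp.span (E ` {\<mu> \<in> compositions n. aff_le n \<mu> \<eta>})"
proof (induction "card {\<mu> \<in> compositions n. aff_le n \<mu> \<eta>}" arbitrary: \<eta> rule: less_induct)
  case less
  note \<eta> = less.prems
  have lower: "E \<eta> - zpow n \<eta> \<in> mp.span (E ` {\<mu> \<in> compositions n. aff_le n \<mu> \<eta>})"
  proof (rule lin_op_span[OF lin_op_id])
    show "E \<eta> - zpow n \<eta> \<in> mp.span (zpow n ` {\<nu> \<in> compositions n. aff_le n \<nu> \<eta> \<and> \<nu> \<noteq> \<eta>})"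
      using good_E[OF \<eta>] by (simp add: good_def lower_span_def)
  next
    fix b :: "'a mpoly" assume "b \<in> zpow n ` {\<nu> \<in> compositions n. aff_le n \<nu> \<eta> \<and> \<nu> \<noteq> \<eta>}"
    then obtain \<nu> where \<nu>: "b = zpow n \<nu>" "\<nu> \<in> compositions n" "aff_le n \<nu> \<eta>" "\<nu> \<noteq> \<eta>" by blast
    have sub: "{\<mu> \<in> compositions n. aff_le n \<mu> \<nu>} \<subseteq> {\<mu> \<in> compositions n. aff_le n \<mu> \<eta>}"
      using \<nu>(3) aff_le_trans by blast
    moreover have "\<eta> \<notin> {\<mu> \<in> compositions n. aff_le n \<mu> \<nu>}"
      using \<nu> \<eta> aff_le_antisym by blast
    ultimately have "{\<mu> \<in> compositions n. aff_le n \<mu> \<nu>} \<subset> {\<mu> \<in> compositions n. aff_le n \<mu> \<eta>}"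
      using \<eta> by auto
    moreover have "finite {\<mu> \<in> compositions n. aff_le n \<mu> \<eta>}"
      by (rule finite_subset[OF _ finite_compositions_csize[of n "csize n \<eta>"]]) (auto simp: aff_le_def)
    ultimately have "b \<in> mp.span (E ` {\<mu> \<in> compositions n. aff_le n \<mu> \<nu>})"
      unfolding \<nu>(1) by (intro less.hyps psubset_card_mono \<nu>(2))
    then show "b \<in> mp.span (E ` {\<mu> \<in> compositions n. aff_le n \<mu> \<eta>})"
      using mp.span_mono[OF image_mono[OF sub]] by blast
  qed
  have "E \<eta> \<in> mp.span (E ` {\<mu> \<in> compositions n. aff_le n \<mu> \<eta>})"
    using \<eta> by (intro mp.span_base) auto
  from mp.span_diff[OF this lower] show ?case by simp
qed

text \<open>Joint eigenvectors with different eigenvalues are independent: \<open>f\<close> is freed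
  of one E nu at a time, using an index j at which its eigenvalue differs from that of E nu.\<close>

lemma eigen_eq_0:
  assumes S: "S \<subseteq> compositions n" and f: "f \<in> mp.span (E ` S)" and y: "eigen y f"
    and ne: "\<And>\<nu>. \<nu> \<in> S \<Longrightarrow> \<exists>j\<in>{1..n}. y j \<noteq> bar \<nu> j"
  shows "f = 0"
proof -
  obtain F where F: "finite F" "F \<subseteq> S" "f \<in> mp.span (E ` F)"
    using span_image_finite[OF f] by blast
  have "finite F \<Longrightarrow> F \<subseteq> S \<Longrightarrow> f \<in> mp.span (E ` F) \<Longrightarrow> f = 0"
  proof (induction F rule: finite_induct)
    case (insert \<nu> F)
    then obtain c where c: "f - Const c * E \<nu> \<in> mp.span (E ` F)"
      by (auto simp: mp.span_breakdown_eq)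
    obtain j where j: "j \<in> {1..n}" "y j \<noteq> bar \<nu> j" using ne insert by blast
    \<comment> \<open>The operator Y_j - bar nu_j kills E nu, so the result is a nonzero multiple of
      \<open>f\<close>, while the span of the remaining vectors is preserved.\<close>
    have "Y j (f - Const c * E \<nu>) - Const (bar \<nu> j) * (f - Const c * E \<nu>) \<in> mp.span (E ` F)"
    proof (rule mp.span_diff[OF _ mp.span_scale[OF c]])
      show "Y j (f - Const c * E \<nu>) \<in> mp.span (E ` F)"
      proof (rule lin_op_span[OF lin_op_Y c])
        fix b assume "b \<in> E ` F"
        then obtain \<mu> where \<mu>: "\<mu> \<in> F" "b = E \<mu>" by blast
        then have "\<mu> \<in> compositions n" using insert.prems S by auto
        then have "Y j b = Const (bar \<mu> j) * b" using Y_E \<mu> j by simp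
        then show "Y j b \<in> mp.span (E ` F)"
          using \<mu> by (simp add: mp.span_scale mp.span_base)
      qed
    qed
    also have "Y j (f - Const c * E \<nu>) - Const (bar \<nu> j) * (f - Const c * E \<nu>) = Const (y j - bar \<nu> j) * f"
    proof -
      have "\<nu> \<in> compositions n" using insert.prems S by auto
      then show ?thesis using y j by (simp add: eigen_def Y_E algebra_simps)
    qed
    finally have "Const (inverse (y j - bar \<nu> j)) * (Const (y j - bar \<nu> j) * f) \<in> mp.span (E ` F)"
      by (rule mp.span_scale)
    then have "f \<in> mp.span (E ` F)"
      using j by (simp only: Const_inverse_cancel right_minus_eq not_False_eq_True)
    then show ?case using insert by simp
  qed simp
  then show ?thesis using F by blast
qed

lemma bar_eqD:
  assumes "\<mu> \<in> compositions n" "\<eta> \<in> compositions n" "\<And>j. j \<in> {1..n} \<Longrightarrow> bar \<mu> j = bar \<eta> j"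
  shows "\<mu> = \<eta>"
  using assms by (intro compositions_eqI[OF assms(1,2)]) (auto simp: bar_eq_iff)

lemma compositions_span_E: "mp.span (zpow n ` compositions n) \<subseteq> (mp.span (E ` compositions n) :: 'a mpoly set)"
proof (rule mp.span_minimal)
  have "mp.span (E ` {\<mu> \<in> compositions n. aff_le n \<mu> \<eta>}) \<subseteq> mp.span (E ` compositions n)" for \<eta>
    by (intro mp.span_mono) auto
  then show "zpow n ` compositions n \<subseteq> (mp.span (E ` compositions n) :: 'a mpoly set)"
    using zpow_in_span_E by blast
qed simp

text \<open>Here triangularity is only assumed for \<open>comp_prec\<close>. A monomial nu lower in
  that order expands in E mu with \<open>aff_le n \<mu> \<nu>\<close>, and mu = eta is impossible
  since \<open>aff_le\<close> implies \<open>comp_prec\<close> or equality and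
  \<open>comp_prec\<close> is asymmetric. So f - E eta avoids E eta, and the simple spectrum makes
  it 0.\<close>

lemma E_eqI:
  assumes \<eta>: "\<eta> \<in> compositions n" and y: "eigen (bar \<eta>) f"
    and f: "f - zpow n \<eta> \<in> mp.span (zpow n ` {\<nu> \<in> compositions n. comp_prec n \<nu> \<eta>})"
  shows "f = E \<eta>"
proof -
  let ?L = "mp.span (zpow n ` {\<nu> \<in> compositions n. comp_prec n \<nu> \<eta>}) :: 'a mpoly set"
  have L: "E \<eta> - zpow n \<eta> \<in> ?L"
  proof -
    have "lower_span n \<eta> \<subseteq> ?L"
      unfolding lower_span_def using aff_le_imp_comp_prec by (intro mp.span_mono image_mono) auto
    then show ?thesis using good_E[OF \<eta>] by (auto simp: good_def)
  qed
  from mp.span_diff[OF f L] have "f - E \<eta> \<in> ?L" by simp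
  also have "?L \<subseteq> mp.span (E ` (compositions n - {\<eta>}))"
  proof (rule mp.span_minimal)
    show "zpow n ` {\<nu> \<in> compositions n. comp_prec n \<nu> \<eta>} \<subseteq> (mp.span (E ` (compositions n - {\<eta>})) :: 'a mpoly set)"
    proof
      fix b :: "'a mpoly" assume "b \<in> zpow n ` {\<nu> \<in> compositions n. comp_prec n \<nu> \<eta>}"
      then obtain \<nu> where \<nu>: "b = zpow n \<nu>" "\<nu> \<in> compositions n" "comp_prec n \<nu> \<eta>" by blast
      have "\<not> aff_le n \<eta> \<nu>"
      proof
        assume "aff_le n \<eta> \<nu>"
        then show False
          using aff_le_imp_comp_prec[of n \<eta> \<nu>] comp_prec_asym[of n \<nu> \<eta>] comp_prec_asym[of n \<eta> \<eta>] \<nu> \<eta> by metis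
      qed
      then have "{\<mu> \<in> compositions n. aff_le n \<mu> \<nu>} \<subseteq> compositions n - {\<eta>}" by auto
      then show "b \<in> mp.span (E ` (compositions n - {\<eta>}))"
        using zpow_in_span_E[OF \<nu>(2)] mp.span_mono[OF image_mono] \<nu>(1) by blast
    qed
  qed simp
  finally have "f - E \<eta> \<in> mp.span (E ` (compositions n - {\<eta>}))" .
  moreover have "eigen (bar \<eta>) (f - E \<eta>)"
    using y good_E[OF \<eta>] by (auto simp: good_def intro: eigen_diff)
  ultimately have "f - E \<eta> = 0"
    using bar_eqD[OF _ \<eta>] by (intro eigen_eq_0[of "compositions n - {\<eta>}"]) auto
  then show ?thesis by simp
qed

lemma lower_span_comp_prec: "lower_span n \<eta> \<subseteq> mp.span (zpow n ` {\<nu> \<in> compositions n. comp_prec n \<nu> \<eta>})"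
  unfolding lower_span_def using aff_le_imp_comp_prec by (intro mp.span_mono image_mono) auto

lemma good_imp_E: "\<eta> \<in> compositions n \<Longrightarrow> good \<eta> f \<Longrightarrow> f = E \<eta>"
  using lower_span_comp_prec[of \<eta>] by (intro E_eqI) (auto simp: good_def)

lemma finite_comp_prec: "finite {\<nu>. \<nu> \<in> compositions n \<and> comp_prec n \<nu> \<eta>}"
  by (rule finite_subset[OF _ finite_compositions_csize[of n "csize n \<eta>"]]) (auto simp: comp_prec_def)

lemma is_macdonald_iff:
  assumes \<eta>: "\<eta> \<in> compositions n"
  shows "is_macdonald n q t \<eta> f \<longleftrightarrow> f = E \<eta>"
proof
  assume m: "is_macdonald n q t \<eta> f"
  then obtain b where b: "f = zpow n \<eta> + (\<Sum>\<nu> | \<nu> \<in> compositions n \<and> comp_prec n \<nu> \<eta>. Const (b \<nu>) * zpow n \<nu>)"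
    by (auto simp: is_macdonald_def)
  have "f - zpow n \<eta> \<in> mp.span (zpow n ` {\<nu> \<in> compositions n. comp_prec n \<nu> \<eta>})"
    unfolding b by (simp, intro mp.span_sum mp.span_scale mp.span_base) auto
  then show "f = E \<eta>"
    using m by (intro E_eqI[OF \<eta>]) (auto simp: is_macdonald_def eigen_def)
next
  assume f: "f = E \<eta>"
  let ?A = "{\<nu>. \<nu> \<in> compositions n \<and> comp_prec n \<nu> \<eta>}"
  have "\<exists>b. g = (\<Sum>\<nu>\<in>?A. Const (b \<nu>) * zpow n \<nu>)" if "g \<in> mp.span (zpow n ` ?A)" for g :: "'a mpoly"
    using that
  proof (induction rule: mp.span_induct_alt)
    case base
    show ?case by (rule exI[of _ "\<lambda>_. 0"]) simp
  next
    case (step c x y)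
    then obtain b \<nu> where b: "y = (\<Sum>\<nu>\<in>?A. Const (b \<nu>) * zpow n \<nu>)" and \<nu>: "\<nu> \<in> ?A" "x = zpow n \<nu>" by blast
    have "(\<Sum>\<mu>\<in>?A. Const ((b(\<nu> := b \<nu> + c)) \<mu>) * zpow n \<mu>) =
       (\<Sum>\<mu>\<in>?A. Const (b \<mu>) * zpow n \<mu> + (if \<mu> = \<nu> then Const c * zpow n \<nu> else 0 :: 'a mpoly))"
      by (intro sum.cong) (auto simp: distrib_right)
    also have "\<dots> = Const c * x + y"
      using \<nu> by (simp add: sum.distrib finite_comp_prec b)
    finally show ?case by (intro exI[of _ "b(\<nu> := b \<nu> + c)"]) (rule sym)
  qed
  moreover have "E \<eta> - zpow n \<eta> \<in> mp.span (zpow n ` ?A)"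
    using good_E[OF \<eta>] lower_span_comp_prec[of \<eta>] by (auto simp: good_def)
  ultimately obtain b where "E \<eta> - zpow n \<eta> = (\<Sum>\<nu>\<in>?A. Const (b \<nu>) * zpow n \<nu>)" by blast
  then have "E \<eta> = zpow n \<eta> + (\<Sum>\<nu>\<in>?A. Const (b \<nu>) * zpow n \<nu>)"
    by (simp add: algebra_simps)
  then show "is_macdonald n q t \<eta> f"
    using Y_E[OF \<eta>] f unfolding is_macdonald_def by blast
qed

section \<open>The action of the generators on the polynomials E\<close>

lemma T_E_less:
  assumes k: "1 \<le> k" "k < n" and \<eta>: "\<eta> \<in> compositions n" and less: "\<eta> k < \<eta> (Suc k)"
  shows "T k (E \<eta>) = Const ((t - 1) * bar \<eta> k / (bar \<eta> k - bar \<eta> (Suc k))) * E \<eta> + Const t * E (\<eta> \<circ> swap_idx k)"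
proof -
  define a where "a = (t - 1) * bar \<eta> k / (bar \<eta> k - bar \<eta> (Suc k))"
  have "Const (inverse t) * (T k (E \<eta>) - Const a * E \<eta>) = E (\<eta> \<circ> swap_idx k)"
    using good_T[OF k \<eta> less good_E[OF \<eta>]] good_imp_E[of "\<eta> \<circ> swap_idx k"] k \<eta> unfolding a_def by simp
  then have "Const t * (Const (inverse t) * (T k (E \<eta>) - Const a * E \<eta>)) = Const t * E (\<eta> \<circ> swap_idx k)"
    by simp
  then have "T k (E \<eta>) - Const a * E \<eta> = Const t * E (\<eta> \<circ> swap_idx k)"
    by (simp only: Const_inverse_cancel t_nz not_False_eq_True)
  then show ?thesis unfolding a_def[symmetric] by (simp add: algebra_simps)
qed

text \<open>The intertwiner would produce the eigenvalues of eta with positions k and k + 1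
  exchanged, and no composition has this spectrum; so it gives 0. Its constant is t because bar
  eta_k = t bar eta_(k+1).\<close>

lemma T_E_equal:
  assumes k: "1 \<le> k" "k < n" and \<eta>: "\<eta> \<in> compositions n" and eq: "\<eta> k = \<eta> (Suc k)"
  shows "T k (E \<eta>) = Const t * E \<eta>"
proof -
  have ne: "bar \<eta> k \<noteq> bar \<eta> (Suc k)" using k by (intro bar_distinct) auto
  have t1: "t \<noteq> 1" using ne bar_adjacent[OF k eq] by auto
  have "(t - 1) * bar \<eta> k / (bar \<eta> k - bar \<eta> (Suc k)) = t"
  proof -
    have "bar \<eta> k - bar \<eta> (Suc k) = (t - 1) * bar \<eta> (Suc k)"
      by (simp add: bar_adjacent[OF k eq] algebra_simps)
    then show ?thesis using t1 by (simp add: bar_adjacent[OF k eq])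
  qed
  then have "eigen (bar \<eta> \<circ> swap_idx k) (T k (E \<eta>) - Const t * E \<eta>)"
    using eigen_T[of "bar \<eta>" "E \<eta>" k] good_E[OF \<eta>] k ne by (simp add: good_def)
  moreover have "T k (E \<eta>) - Const t * E \<eta> \<in> mp.span (E ` compositions n)"
  proof -
    have "E \<eta> \<in> mp.span (zpow n ` compositions n)"
    proof -
      have "lower_span n \<eta> \<subseteq> (mp.span (zpow n ` compositions n) :: 'a mpoly set)"
        unfolding lower_span_def by (intro mp.span_mono image_mono) auto
      then have "(E \<eta> - zpow n \<eta>) + zpow n \<eta> \<in> mp.span (zpow n ` compositions n)"
        using good_E[OF \<eta>] \<eta> by (intro mp.span_add) (auto simp: good_def intro: mp.span_base)
      then show ?thesis by simp
    qed
    then have "T k (E \<eta>) \<in> mp.span (zpow n ` compositions n)"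
      by (rule lin_op_span[OF lin_op_T_op]) (use k in \<open>auto intro: T_op_zpow_compositions\<close>)
    then have "T k (E \<eta>) \<in> mp.span (E ` compositions n)"
      using compositions_span_E by blast
    then show ?thesis
      using \<eta> by (intro mp.span_diff mp.span_scale) (auto intro: mp.span_base)
  qed
  \<comment> \<open>Such a nu would have the entries of eta itself, as the two exchanged ones agree;
    but then its spectrum is that of eta, which takes different values at k and k + 1.\<close>
  moreover have "\<exists>j\<in>{1..n}. (bar \<eta> \<circ> swap_idx k) j \<noteq> bar \<nu> j" if \<nu>: "\<nu> \<in> compositions n" for \<nu>
  proof (rule ccontr)
    assume *: "\<not> ?thesis"
    then have "\<nu> j = (\<eta> \<circ> swap_idx k) j" if "j \<in> {1..n}" for j
      using that by (auto simp: bar_eq_iff)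
    moreover have "\<eta> \<circ> swap_idx k = \<eta>" using eq by (auto simp: fun_eq_iff swap_idx_def)
    ultimately have "\<nu> = \<eta>" using \<nu> \<eta> by (intro compositions_eqI[of \<nu> n \<eta>]) auto
    then have "bar \<eta> (Suc k) = bar \<eta> k" using * k by (auto dest: bspec[of _ _ k])
    then show False using ne by simp
  qed
  ultimately have "T k (E \<eta>) - Const t * E \<eta> = 0"
    by (intro eigen_eq_0[of "compositions n"]) auto
  then show ?thesis by simp
qed

lemma Phi_E:
  assumes \<eta>: "\<eta> \<in> compositions n"
  shows "Phi (E \<eta>) = Const (q ^ \<eta> 1) * E (Phi_comp n \<eta>)"
proof -
  have "Const (inverse (q ^ \<eta> 1)) * Phi (E \<eta>) = E (Phi_comp n \<eta>)"
    using good_imp_E[OF _ good_Phi[OF \<eta> good_E[OF \<eta>]]] n_pos by simp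
  then have "Const (q ^ \<eta> 1) * (Const (inverse (q ^ \<eta> 1)) * Phi (E \<eta>)) = Const (q ^ \<eta> 1) * E (Phi_comp n \<eta>)"
    by simp
  moreover have "q ^ \<eta> 1 \<noteq> 0" by simp
  ultimately show ?thesis by (simp only: Const_inverse_cancel not_False_eq_True)
qed

end

section \<open>Ratios of the normalising constants\<close>

lemma card_eq_sum_if: "finite A \<Longrightarrow> card {j \<in> A. P j} = (\<Sum>j\<in>A. if P j then 1 else 0)"
  by (simp add: sum.If_cases Int_def)

lemma leg_eq_sum:
  assumes "1 \<le> i" "i \<le> n"
  shows "leg n \<eta> i j = (\<Sum>m=1..n. if (m > i \<and> j \<le> \<eta> m \<and> \<eta> m \<le> \<eta> i) \<or> (m < i \<and> j \<le> \<eta> m + 1 \<and> \<eta> m + 1 \<le> \<eta> i) then 1 else 0)"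
proof -
  let ?A = "{k \<in> {i<..n}. j \<le> \<eta> k \<and> \<eta> k \<le> \<eta> i}"
  let ?B = "{k \<in> {1..<i}. j \<le> \<eta> k + 1 \<and> \<eta> k + 1 \<le> \<eta> i}"
  have "?A \<inter> ?B = {}" by auto
  then have card: "card (?A \<union> ?B) = leg n \<eta> i j"
    unfolding leg_def by (intro card_Un_disjoint) simp_all
  have set: "{m \<in> {1..n}. (m > i \<and> j \<le> \<eta> m \<and> \<eta> m \<le> \<eta> i) \<or> (m < i \<and> j \<le> \<eta> m + 1 \<and> \<eta> m + 1 \<le> \<eta> i)} = ?A \<union> ?B"
    (is "?C = _")
    using assms by auto
  have "(\<Sum>m=1..n. if (m > i \<and> j \<le> \<eta> m \<and> \<eta> m \<le> \<eta> i) \<or> (m < i \<and> j \<le> \<eta> m + 1 \<and> \<eta> m + 1 \<le> \<eta> i) then 1 else 0) = card ?C"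
    by (rule card_eq_sum_if[symmetric]) simp
  then show ?thesis unfolding set card by (rule sym)
qed

text \<open>An entry left of row i counts in a leg through its value plus one, an entry right of it
  through its value. Moving the smaller entry from the left to the right of the longer row thus
  changes the leg in exactly one column, \<open>\<eta> k + 1\<close>.\<close>

lemma leg_swap:
  assumes k: "1 \<le> k" "k < n" and less: "\<eta> k < \<eta> (Suc k)" and i: "1 \<le> i" "i \<le> n"
  shows "leg n \<eta> i j = leg n (\<eta> \<circ> swap_idx k) (swap_idx k i) j + (if i = Suc k \<and> j = Suc (\<eta> k) then 1 else 0)"
proof -
  have si: "1 \<le> swap_idx k i" "swap_idx k i \<le> n" using k i by (auto simp: swap_idx_def)
  let ?h = "\<lambda>m. if (m > swap_idx k i \<and> j \<le> (\<eta> \<circ> swap_idx k) m \<and> (\<eta> \<circ> swap_idx k) m \<le> (\<eta> \<circ> swap_idx k) (swap_idx k i)) \<or>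
      (m < swap_idx k i \<and> j \<le> (\<eta> \<circ> swap_idx k) m + 1 \<and> (\<eta> \<circ> swap_idx k) m + 1 \<le> (\<eta> \<circ> swap_idx k) (swap_idx k i)) then 1 else 0 :: nat"
  have "leg n \<eta> i j = (\<Sum>m=1..n. ?h (swap_idx k m) + (if m = k then (if i = Suc k \<and> j = Suc (\<eta> k) then 1 else 0) else 0))"
    unfolding leg_eq_sum[OF i] using less by (intro sum.cong) (auto simp: swap_idx_def)
  also have "\<dots> = (\<Sum>m=1..n. ?h (swap_idx k m)) + (if i = Suc k \<and> j = Suc (\<eta> k) then 1 else 0)"
    unfolding sum.distrib using k by simp
  also have "(\<Sum>m=1..n. ?h (swap_idx k m)) = leg n (\<eta> \<circ> swap_idx k) (swap_idx k i) j"
    unfolding leg_eq_sum[OF si] by (rule sum_swap_idx[OF k])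
  finally show ?thesis .
qed

text \<open>Evaluates the exceptional leg of \<open>leg_swap\<close>: together with its arm, the box
  contributes the factor 1 - bar eta_k / bar eta_(k+1).\<close>

lemma leg_plus_lprime:
  assumes k: "1 \<le> k" "k < n" and less: "\<eta> k < \<eta> (Suc k)"
  shows "leg n \<eta> (Suc k) (Suc (\<eta> k)) + lprime n \<eta> (Suc k) = lprime n \<eta> k"
proof -
  have *: "1 \<le> Suc k" "Suc k \<le> n" "k \<le> n" using k by auto
  let ?f = "\<lambda>j. if (j < k \<and> \<eta> j \<ge> \<eta> k) \<or> (j > k \<and> \<eta> j > \<eta> k) then 1 else 0 :: nat"
  have "lprime n \<eta> k = (\<Sum>j=1..n. ?f (swap_idx k j))"
    unfolding lprime_eq_sum[OF k(1) *(3)] by (rule sum_swap_idx[OF k, symmetric])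
  also have "\<dots> = leg n \<eta> (Suc k) (Suc (\<eta> k)) + lprime n \<eta> (Suc k)"
    unfolding lprime_eq_sum[OF *(1,2)] leg_eq_sum[OF *(1,2)] sum.distrib[symmetric]
    using less by (intro sum.cong) (auto simp: swap_idx_def)
  finally show ?thesis ..
qed

lemma leg_Phi_comp:
  assumes n: "n \<ge> 1" and i: "1 \<le> i" "i < n"
  shows "leg n (Phi_comp n \<eta>) i j = leg n \<eta> (Suc i) j"
proof -
  have *: "i \<le> n" "1 \<le> Suc i" "Suc i \<le> n" using i by auto
  let ?g = "\<lambda>m. if (m > Suc i \<and> j \<le> \<eta> m \<and> \<eta> m \<le> \<eta> (Suc i)) \<or> (m < Suc i \<and> j \<le> \<eta> m + 1 \<and> \<eta> m + 1 \<le> \<eta> (Suc i)) then 1 else 0 :: nat"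
  have "leg n (Phi_comp n \<eta>) i j = (\<Sum>m=1..<n. ?g (Suc m)) + ?g 1"
    unfolding leg_eq_sum[OF i(1) *(1)] sum_split_last[OF n]
    using i n by (intro arg_cong2[where f = "(+)"] sum.cong) (auto simp: Phi_comp_def)
  also have "\<dots> = leg n \<eta> (Suc i) j"
    unfolding leg_eq_sum[OF *(2,3)] by (rule sum_Phi_shift[OF n, symmetric])
  finally show ?thesis .
qed

lemma leg_Phi_comp_last:
  assumes n: "n \<ge> 1"
  shows "leg n (Phi_comp n \<eta>) n (Suc j) = leg n \<eta> 1 j"
proof -
  let ?g = "\<lambda>m. if (m > 1 \<and> j \<le> \<eta> m \<and> \<eta> m \<le> \<eta> 1) \<or> (m < 1 \<and> j \<le> \<eta> m + 1 \<and> \<eta> m + 1 \<le> \<eta> 1) then 1 else 0 :: nat"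
  have "leg n (Phi_comp n \<eta>) n (Suc j) = (\<Sum>m=1..<n. ?g (Suc m)) + ?g 1"
    unfolding leg_eq_sum[OF n order_refl] sum_split_last[OF n]
    using n by (intro arg_cong2[where f = "(+)"] sum.cong) (auto simp: Phi_comp_def)
  also have "\<dots> = leg n \<eta> 1 j"
    unfolding leg_eq_sum[OF order_refl n] by (rule sum_Phi_shift[OF n, symmetric])
  finally show ?thesis .
qed

text \<open>Every other entry counts either in the leg of the new box or in \<open>lprime\<close> at
  1, according to whether it is at most eta_1 or larger. This is the origin of the exponent 1 - n in
  B_I.\<close>

lemma leg_Phi_comp_new:
  assumes n: "n \<ge> 1"
  shows "leg n (Phi_comp n \<eta>) n 1 + lprime n \<eta> 1 = n - 1"
proof -
  let ?g = "\<lambda>m. if (m > 1 \<and> 0 \<le> \<eta> m \<and> \<eta> m \<le> \<eta> 1) \<or> (m < 1 \<and> 0 \<le> \<eta> m + 1 \<and> \<eta> m + 1 \<le> \<eta> 1) then 1 else 0 :: nat"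
  have "leg n (Phi_comp n \<eta>) n 1 = leg n \<eta> 1 0"
    using leg_Phi_comp_last[OF n, of \<eta> 0] by simp
  then have "leg n (Phi_comp n \<eta>) n 1 + lprime n \<eta> 1 = leg n \<eta> 1 0 + lprime n \<eta> 1"
    by simp
  also have "\<dots> = (\<Sum>m=1..n. if m = 1 then 0 else 1)"
    unfolding leg_eq_sum[OF order_refl n] lprime_eq_sum[OF order_refl n] sum.distrib[symmetric]
    by (intro sum.cong) auto
  also have "\<dots> = n - 1"
    using sum_Phi_shift[OF n, of "\<lambda>m. if m = 1 then 0 else 1 :: nat"] by simp
  finally show ?thesis .
qed

context generic
begin

definition box :: "(nat \<Rightarrow> nat) \<Rightarrow> nat \<Rightarrow> nat \<Rightarrow> 'a" where
  "box \<eta> i j = 1 - q powi (- int (arm \<eta> i j) - 1) * t powi (- int (leg n \<eta> i j))"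

lemma dprime_inv_eq: "dprime_inv n q t \<eta> = (\<Prod>i=1..n. \<Prod>j=1..\<eta> i. box \<eta> i j)"
  by (simp add: dprime_inv_def box_def)

lemma box_nz: "box \<eta> i j \<noteq> 0"
proof
  assume "box \<eta> i j = 0"
  then have "- int (arm \<eta> i j) - 1 = 0"
    using indep[of "- int (arm \<eta> i j) - 1" "- int (leg n \<eta> i j)"] by (simp add: box_def)
  then show False by simp
qed

lemma k_const_nz [simp]: "k_const n q t \<eta> \<noteq> 0"
  by (simp add: k_const_def dprime_inv_eq box_nz)

lemma dprime_inv_swap:
  assumes k: "1 \<le> k" "k < n" and less: "\<eta> k < \<eta> (Suc k)"
  shows "dprime_inv n q t (\<eta> \<circ> swap_idx k) * (1 - bar \<eta> k / bar \<eta> (Suc k)) =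
    dprime_inv n q t \<eta> * (1 - t * bar \<eta> k / bar \<eta> (Suc k))"
proof -
  define \<eta>' where "\<eta>' = \<eta> \<circ> swap_idx k"
  define a where "a = \<eta> k"
  have same: "box \<eta>' (swap_idx k i) j = box \<eta> i j" if "i \<in> {1..n}" "\<not> (i = Suc k \<and> j = Suc a)" for i j
  proof -
    have "(if i = Suc k \<and> j = Suc (\<eta> k) then 1 else 0 :: nat) = 0"
      using that(2) unfolding a_def by (rule if_not_P)
    then have "leg n \<eta> i j = leg n \<eta>' (swap_idx k i) j"
      using leg_swap[OF k less, of i j] that unfolding \<eta>'_def by simp
    then show ?thesis by (simp add: box_def arm_def \<eta>'_def)
  qed
  have l: "int (leg n \<eta> (Suc k) (Suc a)) = int (lprime n \<eta> k) - int (lprime n \<eta> (Suc k))"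
    using leg_plus_lprime[OF k less] by (simp add: a_def)
  have ratio: "bar \<eta> k / bar \<eta> (Suc k) = q powi (- int (arm \<eta> (Suc k) (Suc a)) - 1) * t powi (- int (leg n \<eta> (Suc k) (Suc a)))"
  proof -
    have "- int (arm \<eta> (Suc k) (Suc a)) - 1 = int (\<eta> k) - int (\<eta> (Suc k))"
      using less by (simp add: arm_def a_def)
    moreover have "- int (leg n \<eta> (Suc k) (Suc a)) = - int (lprime n \<eta> k) - (- int (lprime n \<eta> (Suc k)))"
      using l by simp
    ultimately show ?thesis
      by (simp only: bar_eq power_int_diff q_nz t_nz simp_thms) simp
  qed
  have box1: "box \<eta> (Suc k) (Suc a) = 1 - bar \<eta> k / bar \<eta> (Suc k)"
    by (simp add: box_def ratio)
  have box2: "box \<eta>' k (Suc a) = 1 - t * bar \<eta> k / bar \<eta> (Suc k)"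
  proof -
    have "leg n \<eta> (Suc k) (Suc a) = Suc (leg n \<eta>' k (Suc a))"
      using leg_swap[OF k less, of "Suc k" "Suc a"] k by (simp add: \<eta>'_def a_def)
    then have "- int (leg n \<eta>' k (Suc a)) = 1 + - int (leg n \<eta> (Suc k) (Suc a))" by simp
    then have "t powi (- int (leg n \<eta>' k (Suc a))) = t * t powi (- int (leg n \<eta> (Suc k) (Suc a)))"
      by (simp only: power_int_add t_nz simp_thms power_int_1_right)
    moreover have "arm \<eta>' k (Suc a) = arm \<eta> (Suc k) (Suc a)"
      by (simp add: arm_def \<eta>'_def)
    ultimately have "box \<eta>' k (Suc a) = 1 - t * (q powi (- int (arm \<eta> (Suc k) (Suc a)) - 1) * t powi (- int (leg n \<eta> (Suc k) (Suc a))))"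
      by (simp add: box_def)
    then show ?thesis unfolding ratio[symmetric] by simp
  qed
  have sk: "Suc k \<in> {1..n}" using k by auto
  have sa: "Suc a \<in> {1..\<eta> (Suc k)}" using less by (auto simp: a_def)
  \<comment> \<open>All box factors of eta except the one at row k + 1, column a + 1; they agree
    with the corresponding factors of the swapped composition.\<close>
  define R where "R = (\<Prod>j\<in>{1..\<eta> (Suc k)} - {Suc a}. box \<eta> (Suc k) j) *
     (\<Prod>i\<in>{1..n} - {Suc k}. \<Prod>j=1..\<eta> i. box \<eta> i j)"
  have "dprime_inv n q t \<eta>' = (\<Prod>i=1..n. \<Prod>j=1..\<eta>' (swap_idx k i). box \<eta>' (swap_idx k i) j)"
    unfolding dprime_inv_eq by (rule prod_swap_idx[OF k, symmetric])
  also have "\<dots> = (\<Prod>i=1..n. \<Prod>j=1..\<eta> i. box \<eta>' (swap_idx k i) j)"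
    by (simp add: \<eta>'_def)
  also have "\<dots> = (\<Prod>j=1..\<eta> (Suc k). box \<eta>' (swap_idx k (Suc k)) j) *
      (\<Prod>i\<in>{1..n} - {Suc k}. \<Prod>j=1..\<eta> i. box \<eta>' (swap_idx k i) j)"
    by (rule prod.remove[OF _ sk]) simp
  also have "(\<Prod>j=1..\<eta> (Suc k). box \<eta>' (swap_idx k (Suc k)) j) =
      box \<eta>' (swap_idx k (Suc k)) (Suc a) * (\<Prod>j\<in>{1..\<eta> (Suc k)} - {Suc a}. box \<eta>' (swap_idx k (Suc k)) j)"
    by (rule prod.remove[OF _ sa]) simp
  also have "(\<Prod>j\<in>{1..\<eta> (Suc k)} - {Suc a}. box \<eta>' (swap_idx k (Suc k)) j) = (\<Prod>j\<in>{1..\<eta> (Suc k)} - {Suc a}. box \<eta> (Suc k) j)"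
    by (intro prod.cong refl same) (use sk in auto)
  also have "(\<Prod>i\<in>{1..n} - {Suc k}. \<Prod>j=1..\<eta> i. box \<eta>' (swap_idx k i) j) = (\<Prod>i\<in>{1..n} - {Suc k}. \<Prod>j=1..\<eta> i. box \<eta> i j)"
    by (intro prod.cong refl same) auto
  finally have 1: "dprime_inv n q t \<eta>' = box \<eta>' k (Suc a) * R"
    by (simp add: R_def mult.assoc)
  have "dprime_inv n q t \<eta> = (\<Prod>j=1..\<eta> (Suc k). box \<eta> (Suc k) j) * (\<Prod>i\<in>{1..n} - {Suc k}. \<Prod>j=1..\<eta> i. box \<eta> i j)"
    unfolding dprime_inv_eq by (rule prod.remove[OF _ sk]) simp
  also have "(\<Prod>j=1..\<eta> (Suc k). box \<eta> (Suc k) j) = box \<eta> (Suc k) (Suc a) * (\<Prod>j\<in>{1..\<eta> (Suc k)} - {Suc a}. box \<eta> (Suc k) j)"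
    by (rule prod.remove[OF _ sa]) simp
  finally have 2: "dprime_inv n q t \<eta> = box \<eta> (Suc k) (Suc a) * R"
    by (simp add: R_def mult.assoc)
  show ?thesis
    unfolding \<eta>'_def[symmetric] 1 2 box1 box2 by simp
qed

text \<open>The product of powers of eigenvalues is only permuted, so the ratio comes from the one
  exceptional box and equals (1 - t x/y) / (1 - x/y) with x, y the eigenvalues at k, k + 1.\<close>

lemma k_const_swap:
  assumes k: "1 \<le> k" "k < n" and less: "\<eta> k < \<eta> (Suc k)"
  shows "k_const n q t (\<eta> \<circ> swap_idx k) = k_const n q t \<eta> * b_hat t (bar \<eta> (Suc k)) (bar \<eta> k)"
proof -
  define x where "x = bar \<eta> k"
  define y where "y = bar \<eta> (Suc k)"
  have xy: "x \<noteq> 0" "y \<noteq> 0" "y - x \<noteq> 0"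
    using less by (auto simp: x_def y_def bar_eq_iff)
  have p: "(\<Prod>i=1..n. bar (\<eta> \<circ> swap_idx k) i ^ (\<eta> \<circ> swap_idx k) i) = (\<Prod>i=1..n. bar \<eta> i ^ \<eta> i)"
  proof -
    have "(\<Prod>i=1..n. bar (\<eta> \<circ> swap_idx k) i ^ (\<eta> \<circ> swap_idx k) i) = (\<Prod>i=1..n. bar \<eta> (swap_idx k i) ^ \<eta> (swap_idx k i))"
      using bar_swap[OF k, of \<eta>] less by (intro prod.cong) auto
    also have "\<dots> = (\<Prod>i=1..n. bar \<eta> i ^ \<eta> i)"
      by (rule prod_swap_idx[OF k])
    finally show ?thesis .
  qed
  define d where "d = dprime_inv n q t \<eta>"
  define d' where "d' = dprime_inv n q t (\<eta> \<circ> swap_idx k)"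
  have "d' * (1 - x / y) = d * (1 - t * x / y)"
    using dprime_inv_swap[OF k less] by (simp add: x_def y_def d_def d'_def)
  then have "d' * (1 - x / y) * y = d * (1 - t * x / y) * y" by simp
  then have "d' * (y - x) = d * (y - t * x)"
    using xy by (simp add: algebra_simps)
  then have "d' = d * ((y - t * x) / (y - x))"
    using xy by (simp add: nonzero_eq_divide_eq)
  then show ?thesis
    unfolding k_const_def p by (simp add: b_hat_def x_def y_def d_def d'_def)
qed

text \<open>The eigenvalue q bar eta_1 now has the exponent eta_1 + 1. This yields q^(eta_1), later
  cancelled by the scalar of \<open>Phi\<close>, and one extra factor q bar eta_1, which times the
  new box gives the difference.\<close>

lemma k_const_Phi_comp:
  "k_const n q t (Phi_comp n \<eta>) = k_const n q t \<eta> * (q ^ \<eta> 1 * (q * bar \<eta> 1 - t powi (- int n + 1)))"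
proof -
  have p: "(\<Prod>i=1..n. bar (Phi_comp n \<eta>) i ^ Phi_comp n \<eta> i) = (\<Prod>i=1..n. bar \<eta> i ^ \<eta> i) * (q ^ \<eta> 1 * (q * bar \<eta> 1))"
  proof -
    have "(\<Prod>i=1..n. bar (Phi_comp n \<eta>) i ^ Phi_comp n \<eta> i) =
        (\<Prod>i=1..<n. bar \<eta> (Suc i) ^ \<eta> (Suc i)) * (q * bar \<eta> 1) ^ Suc (\<eta> 1)"
      unfolding prod_split_last[OF n_pos]
      using n_pos by (intro arg_cong2[where f = "(*)"] prod.cong) (auto simp: bar_Phi_comp Phi_comp_def)
    also have "\<dots> = ((\<Prod>i=1..<n. bar \<eta> (Suc i) ^ \<eta> (Suc i)) * bar \<eta> 1 ^ \<eta> 1) * (q ^ \<eta> 1 * (q * bar \<eta> 1))"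
      by (simp add: power_mult_distrib mult_ac)
    also have "(\<Prod>i=1..<n. bar \<eta> (Suc i) ^ \<eta> (Suc i)) * bar \<eta> 1 ^ \<eta> 1 = (\<Prod>i=1..n. bar \<eta> i ^ \<eta> i)"
      by (rule prod_Phi_shift[OF n_pos, symmetric])
    finally show ?thesis .
  qed
  have box_new: "q * bar \<eta> 1 * box (Phi_comp n \<eta>) n 1 = q * bar \<eta> 1 - t powi (- int n + 1)"
  proof -
    define L where "L = leg n (Phi_comp n \<eta>) n 1"
    have L: "int L + int (lprime n \<eta> 1) = int n - 1"
      using leg_Phi_comp_new[OF n_pos, of \<eta>] n_pos unfolding L_def by linarith
    have b: "q * bar \<eta> 1 = q powi (int (\<eta> 1) + 1) * t powi (- int (lprime n \<eta> 1))"
      by (simp add: bar_eq power_int_add)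
    have "q * bar \<eta> 1 * (q powi (- int (\<eta> 1) - 1) * t powi (- int L)) =
        q powi ((int (\<eta> 1) + 1) + (- int (\<eta> 1) - 1)) * t powi (- int (lprime n \<eta> 1) + - int L)"
      unfolding b by (simp only: power_int_add q_nz t_nz simp_thms) (simp add: mult_ac)
    also have "(int (\<eta> 1) + 1) + (- int (\<eta> 1) - 1) = 0" by simp
    also have "- int (lprime n \<eta> 1) + - int L = - int n + 1" using L by simp
    finally have "q * bar \<eta> 1 * (q powi (- int (\<eta> 1) - 1) * t powi (- int L)) = t powi (- int n + 1)" by simp
    then show ?thesis
      by (simp add: box_def arm_def Phi_comp_def L_def right_diff_distrib)
  qed
  have d: "dprime_inv n q t (Phi_comp n \<eta>) = dprime_inv n q t \<eta> * box (Phi_comp n \<eta>) n 1"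
  proof -
    have 1: "(\<Prod>j=1..Suc m. f j) = f 1 * (\<Prod>j=1..m. f (Suc j))" for m and f :: "nat \<Rightarrow> 'a"
      using prod_Phi_shift[of "Suc m" f] by (simp add: atLeastLessThanSuc_atLeastAtMost mult.commute)
    have "(\<Prod>j=1..Phi_comp n \<eta> n. box (Phi_comp n \<eta>) n j) = (\<Prod>j=1..Suc (\<eta> 1). box (Phi_comp n \<eta>) n j)"
      by (simp add: Phi_comp_def)
    also have "\<dots> = box (Phi_comp n \<eta>) n 1 * (\<Prod>j=1..\<eta> 1. box (Phi_comp n \<eta>) n (Suc j))"
      by (rule 1)
    also have "(\<Prod>j=1..\<eta> 1. box (Phi_comp n \<eta>) n (Suc j)) = (\<Prod>j=1..\<eta> 1. box \<eta> 1 j)"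
      by (intro prod.cong) (simp_all add: box_def leg_Phi_comp_last[OF n_pos] arm_def Phi_comp_def)
    finally have last: "(\<Prod>j=1..Phi_comp n \<eta> n. box (Phi_comp n \<eta>) n j) = box (Phi_comp n \<eta>) n 1 * (\<Prod>j=1..\<eta> 1. box \<eta> 1 j)" .
    have "(\<Prod>i=1..<n. \<Prod>j=1..Phi_comp n \<eta> i. box (Phi_comp n \<eta>) i j) = (\<Prod>i=1..<n. \<Prod>j=1..\<eta> (Suc i). box \<eta> (Suc i) j)"
    proof (rule prod.cong)
      fix i assume i: "i \<in> {1..<n}"
      then have "Phi_comp n \<eta> i = \<eta> (Suc i)" by (simp add: Phi_comp_def)
      moreover have "box (Phi_comp n \<eta>) i j = box \<eta> (Suc i) j" for j
        using i leg_Phi_comp[OF n_pos, of i \<eta> j] by (simp add: box_def arm_def Phi_comp_def)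
      ultimately show "(\<Prod>j=1..Phi_comp n \<eta> i. box (Phi_comp n \<eta>) i j) = (\<Prod>j=1..\<eta> (Suc i). box \<eta> (Suc i) j)"
        by simp
    qed simp
    then show ?thesis
      unfolding dprime_inv_eq prod_split_last[OF n_pos, of "\<lambda>i. \<Prod>j=1..Phi_comp n \<eta> i. box (Phi_comp n \<eta>) i j"]
        prod_Phi_shift[OF n_pos, of "\<lambda>i. \<Prod>j=1..\<eta> i. box \<eta> i j"] last
      by (simp add: mult_ac)
  qed
  show ?thesis
    unfolding k_const_def p d box_new[symmetric] by (simp add: mult_ac)
qed

end

section \<open>Multiplication by a variable in terms of Hecke and creation operators\<close>

context params
begin

text \<open>Iterates z_i = t T_i^(-1) z_(i+1) T_i^(-1). The inner inverses are encoded by requiring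
  that T_i ... T_(n-1) sends \<open>h\<close> to t^(n-i) f.\<close>

lemma zvar_conjugate:
  assumes "i \<le> n" "foldr T [i..<n] h = Const (t ^ (n - i)) * f"
  shows "zvar i * f = foldr T' [i..<n] (zvar n * h)"
  using assms
proof (induction i arbitrary: f rule: inc_induct)
  case (step i)
  have sp: "[i..<n] = i # [Suc i..<n]" using step by (simp add: upt_conv_Cons)
  have "T' i (T i (foldr T [Suc i..<n] h)) = T' i (Const (t ^ (n - i)) * f)"
    using step.prems by (simp add: sp)
  then have "foldr T [Suc i..<n] h = Const (t ^ (n - i)) * T' i f"
    by (simp add: lin_op_scale[OF lin_op_T_inv])
  also have "t ^ (n - i) = t ^ (n - Suc i) * t"
    using step.hyps by (metis Suc_diff_Suc power_Suc2)
  finally have "foldr T [Suc i..<n] h = Const (t ^ (n - Suc i)) * (Const t * T' i f)"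
    by (simp only: Const_mult mult.assoc)
  from step.IH[OF this] have "foldr T' [i..<n] (zvar n * h) = T' i (zvar (Suc i) * (Const t * T' i f))"
    by (simp add: sp)
  also have "\<dots> = zvar i * f"
    by (simp add: T_inv_zvar_right mult.left_commute[of "zvar i"] Const_inverse_cancel)
  finally show ?case ..
qed simp

lemma foldr_T_inject: "foldr T xs f = foldr T xs g \<Longrightarrow> f = g"
proof (induction xs)
  case (Cons k xs)
  then have "T' k (T k (foldr T xs f)) = T' k (T k (foldr T xs g))" by simp
  then show ?case using Cons.IH by simp
qed simp

text \<open>Y_1 = t^(1-n) T_1 ... T_(n-1) omega lets \<open>zvar_conjugate\<close> be expressed
  through \<open>Phi\<close>. The inverse of Y_1 is avoided by prescribing Y_1 g: for a sum of
  eigenvectors with nonzero eigenvalues such a g is immediate. At the inverted parameters the scalar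
  1/t becomes t.\<close>

lemma zvar_expand:
  assumes i: "1 \<le> i" "i \<le> n"
    and g: "Y 1 g = foldr (\<lambda>k h. Const (inverse t) * T k h) [1..<i] f"
  shows "zvar i * f = foldr T' [i..<n] (Phi g)"
proof -
  obtain m where m: "i = Suc m" using i by (cases i) auto
  have lin: "lin_op (foldr T xs)" for xs by (simp add: lin_op_foldr)
  have "foldr (\<lambda>k h. Const (inverse t) * T k h) xs f = Const (inverse t ^ length xs) * foldr T xs f" for xs
  proof (induction xs)
    case (Cons k xs)
    show ?case
      by (simp only: foldr.simps o_apply Cons.IH T_op_lin(2) list.size(4) add_Suc_right add_0_right power_Suc Const_mult mult.assoc)
  qed simp
  then have 1: "foldr (\<lambda>k h. Const (inverse t) * T k h) [1..<i] f = Const (inverse t ^ m) * foldr T [1..<i] f"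
    by (metis m length_upt diff_Suc_1)
  have "1 - int n = - int (n - 1)" using n_pos by simp
  then have "t powi (1 - int n) = inverse t ^ (n - 1)"
    by (simp only: power_int_minus power_int_of_nat power_inverse)
  moreover have "[1..<n] = [1..<i] @ [i..<n]" using i by (rule upt_split)
  ultimately have "Y 1 g = Const (inverse t ^ (n - 1)) * foldr T [1..<i] (foldr T [i..<n] (w g))"
    by (simp add: Y_eq)
  then have "foldr T [1..<i] (Const (inverse t ^ (n - 1)) * foldr T [i..<n] (w g)) = foldr T [1..<i] (Const (inverse t ^ m) * f)"
    using g 1 by (simp add: lin_op_scale[OF lin])
  then have "Const (inverse t ^ (n - 1)) * foldr T [i..<n] (w g) = Const (inverse t ^ m) * f"
    by (rule foldr_T_inject)
  then have eq: "Const (t ^ (n - 1)) * (Const (inverse t ^ (n - 1)) * foldr T [i..<n] (w g)) = Const (t ^ (n - 1)) * (Const (inverse t ^ m) * f)"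
    by simp
  have "foldr T [i..<n] (w g) = Const (t ^ (n - 1) * inverse t ^ m) * f"
  proof -
    have nz: "t ^ (n - 1) \<noteq> 0" by simp
    show ?thesis
      using eq unfolding Const_inverse_cancel(1)[OF nz, folded power_inverse]
      by (simp only: Const_mult mult.assoc)
  qed
  also have "t ^ (n - 1) * inverse t ^ m = t ^ (n - i)"
  proof -
    have "n - 1 = (n - i) + m" using i m by simp
    then show ?thesis by (simp add: power_add power_inverse)
  qed
  finally have "foldr T [i..<n] (w g) = Const (t ^ (n - i)) * f" .
  then show ?thesis
    unfolding Phi_def by (rule zvar_conjugate[OF i(2)])
qed

end

section \<open>Expanding products of Hecke operators\<close>

text \<open>
  A value \<open>u p\<close> is carried from position \<open>p\<close> down to position \<open>k\<close>, meeting \<open>u j\<close> at each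
  step: either the two are exchanged, or (for \<open>j \<in> I\<close>) the carried value stays and
  \<open>u j\<close> is carried on. \<open>carried p I u j\<close> is the value that meets \<open>u j\<close>.
\<close>

definition carried :: "nat \<Rightarrow> nat set \<Rightarrow> (nat \<Rightarrow> 'b) \<Rightarrow> nat \<Rightarrow> 'b" where
  "carried p I u j = (if \<exists>x\<in>I. j < x then u (Min {x \<in> I. j < x}) else u p)"

text \<open>I consists of the positions where the carried value stays behind and the one met there
  is carried on. At the others the two change places, a term that is present only for different
  first components.\<close>

definition walk_sets :: "nat \<Rightarrow> nat \<Rightarrow> (nat \<Rightarrow> nat \<times> 'b) \<Rightarrow> nat set set" where
  "walk_sets k p u = {I. I \<subseteq> {k..<p} \<and> (\<forall>j\<in>{k..<p} - I. fst (u j) \<noteq> fst (carried p I u j))}"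

text \<open>The step at position j fixes what stays at j + 1, hence the shift by one. The value
  still carried after the last step ends at k; the argument \<open>k - 1\<close> of
  \<open>carried\<close> makes k itself count among the later elements.\<close>

definition walk_end :: "nat \<Rightarrow> nat \<Rightarrow> nat set \<Rightarrow> (nat \<Rightarrow> 'b) \<Rightarrow> nat \<Rightarrow> 'b" where
  "walk_end k p I u j =
    (if j = k then carried p I u (k - 1)
     else if k < j \<and> j \<le> p then if j - 1 \<in> I then carried p I u (j - 1) else u (j - 1)
     else u j)"

definition walk_coeff :: "('c \<Rightarrow> 'c \<Rightarrow> 'a::field) \<Rightarrow> ('c \<Rightarrow> 'c \<Rightarrow> 'a) \<Rightarrow> nat \<Rightarrow> nat \<Rightarrow> nat set \<Rightarrow> (nat \<Rightarrow> nat \<times> 'c) \<Rightarrow> 'a" where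
  "walk_coeff al be k p I u = (\<Prod>j\<in>I. al (snd (carried p I u j)) (snd (u j))) *
     (\<Prod>j\<in>{k..<p} - I. be (snd (carried p I u j)) (snd (u j)))"

lemma carried_insert:
  assumes "k \<le> j"
  shows "carried p (insert k I) u j = carried p I u j"
proof -
  have "{x \<in> insert k I. j < x} = {x \<in> I. j < x}" using assms by auto
  then show ?thesis using assms by (auto simp: carried_def)
qed

lemma carried_pred:
  assumes "1 \<le> k" "k \<notin> I"
  shows "carried p I u (k - 1) = carried p I u k"
proof -
  have "k - 1 < x \<longleftrightarrow> k < x" if "x \<in> I" for x
  proof -
    have "x \<noteq> k" using that assms by auto
    then show ?thesis using assms by auto
  qed
  then have "{x \<in> I. k - 1 < x} = {x \<in> I. k < x}" "(\<exists>x\<in>I. k - 1 < x) \<longleftrightarrow> (\<exists>x\<in>I. k < x)" by auto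
  then show ?thesis by (simp add: carried_def)
qed

lemma carried_insert_pred:
  assumes "1 \<le> k" "I \<subseteq> {Suc k..<p}"
  shows "carried p (insert k I) u (k - 1) = u k"
proof -
  have "finite I" using assms(2) finite_subset by blast
  have "{x \<in> insert k I. k - 1 < x} = insert k I" using assms by fastforce
  moreover have "Min (insert k I) = k"
    using assms \<open>finite I\<close> by (intro Min_eqI) auto
  ultimately show ?thesis using assms by (auto simp: carried_def)
qed

lemma walk_sets_subset: "I \<in> walk_sets k p u \<Longrightarrow> I \<subseteq> {k..<p}"
  by (simp add: walk_sets_def)

text \<open>\<open>foldr\<close> applies the operator at k last, and the choice made there does not
  affect the values carried at higher positions. Keeping adds k to the set; exchanging requires
  different entries.\<close>

lemma walk_sets_step:
  assumes "1 \<le> k" "k < p"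
  shows "walk_sets k p u =
    insert k ` walk_sets (Suc k) p u \<union> {I \<in> walk_sets (Suc k) p u. fst (u k) \<noteq> fst (carried p I u k)}"
proof (intro equalityI subsetI)
  fix I assume I: "I \<in> walk_sets k p u"
  show "I \<in> insert k ` walk_sets (Suc k) p u \<union> {I \<in> walk_sets (Suc k) p u. fst (u k) \<noteq> fst (carried p I u k)}"
  proof (cases "k \<in> I")
    case True
    then have ins: "insert k (I - {k}) = I" by blast
    have "fst (u j) \<noteq> fst (carried p (I - {k}) u j)" if "j \<in> {Suc k..<p} - (I - {k})" for j
    proof -
      have "j \<in> {k..<p} - I" using that by auto
      moreover have "carried p (I - {k}) u j = carried p I u j"
        using carried_insert[of k j p "I - {k}" u] that ins by auto
      ultimately show ?thesis using I by (auto simp: walk_sets_def)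
    qed
    moreover have "I - {k} \<subseteq> {Suc k..<p}" using I by (fastforce simp: walk_sets_def)
    ultimately have "I - {k} \<in> walk_sets (Suc k) p u" by (auto simp: walk_sets_def)
    then have "insert k (I - {k}) \<in> insert k ` walk_sets (Suc k) p u" by (rule imageI)
    then show ?thesis unfolding ins by (rule UnI1)
  next
    case False
    moreover have "I \<subseteq> {Suc k..<p}"
    proof
      fix x assume "x \<in> I"
      moreover from this have "x \<in> {k..<p}" using walk_sets_subset[OF I] by blast
      ultimately show "x \<in> {Suc k..<p}" using False by (cases "x = k") auto
    qed
    ultimately show ?thesis
      using I assms by (auto simp: walk_sets_def)
  qed
next
  fix I assume "I \<in> insert k ` walk_sets (Suc k) p u \<union> {I \<in> walk_sets (Suc k) p u. fst (u k) \<noteq> fst (carried p I u k)}"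
  then show "I \<in> walk_sets k p u"
  proof
    assume "I \<in> insert k ` walk_sets (Suc k) p u"
    then obtain J where J: "J \<in> walk_sets (Suc k) p u" "I = insert k J" by blast
    then show ?thesis
      using assms by (auto simp: walk_sets_def carried_insert)
  next
    assume *: "I \<in> {I \<in> walk_sets (Suc k) p u. fst (u k) \<noteq> fst (carried p I u k)}"
    then have "I \<subseteq> {Suc k..<p}" by (simp add: walk_sets_def)
    then have "I \<subseteq> {k..<p}" by fastforce
    moreover have "fst (u j) \<noteq> fst (carried p I u j)" if "j \<in> {k..<p} - I" for j
      using * that by (cases "j = k") (auto simp: walk_sets_def)
    ultimately show ?thesis by (simp add: walk_sets_def)
  qed
qed

lemma walk_end_insert:
  assumes "1 \<le> k" "k < p" "I \<subseteq> {Suc k..<p}"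
  shows "walk_end k p (insert k I) u = walk_end (Suc k) p I u"
proof
  fix j
  have [simp]: "carried p (insert k I) u (k - Suc 0) = u k"
    using carried_insert_pred[OF assms(1,3)] by simp
  consider "j < k" | "j = k" | "j = Suc k" | "Suc k < j" by linarith
  then show "walk_end k p (insert k I) u j = walk_end (Suc k) p I u j"
    using assms by cases (auto simp: walk_end_def carried_insert)
qed

lemma walk_end_swap:
  assumes "1 \<le> k" "k < p" "I \<subseteq> {Suc k..<p}"
  shows "walk_end k p I u = walk_end (Suc k) p I u \<circ> swap_idx k"
proof
  fix j
  have k: "k \<notin> I" using assms by auto
  have [simp]: "carried p I u (k - Suc 0) = carried p I u k"
    using carried_pred[OF assms(1) k] by simp
  consider "j < k" | "j = k" | "j = Suc k" | "Suc k < j" by linarith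
  then show "walk_end k p I u j = (walk_end (Suc k) p I u \<circ> swap_idx k) j"
    using assms k by cases (auto simp: walk_end_def swap_idx_def)
qed

lemma walk_coeff_insert:
  assumes "1 \<le> k" "k < p" "I \<subseteq> {Suc k..<p}"
  shows "walk_coeff al be k p (insert k I) u = al (snd (carried p I u k)) (snd (u k)) * walk_coeff al be (Suc k) p I u"
proof -
  have "finite I" using assms(3) finite_subset by blast
  moreover have "k \<notin> I" using assms by auto
  moreover have "{k..<p} - insert k I = {Suc k..<p} - I" by auto
  moreover have "(\<Prod>j\<in>I. al (snd (carried p (insert k I) u j)) (snd (u j))) = (\<Prod>j\<in>I. al (snd (carried p I u j)) (snd (u j)))"
    using assms by (intro prod.cong) (auto simp: carried_insert)
  moreover have "(\<Prod>j\<in>{Suc k..<p} - I. be (snd (carried p (insert k I) u j)) (snd (u j))) =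
      (\<Prod>j\<in>{Suc k..<p} - I. be (snd (carried p I u j)) (snd (u j)))"
    by (intro prod.cong) (auto simp: carried_insert)
  ultimately show ?thesis
    by (simp add: walk_coeff_def carried_insert)
qed

lemma walk_coeff_swap:
  assumes "1 \<le> k" "k < p" "I \<subseteq> {Suc k..<p}"
  shows "walk_coeff al be k p I u = be (snd (carried p I u k)) (snd (u k)) * walk_coeff al be (Suc k) p I u"
proof -
  have "{k..<p} - I = insert k ({Suc k..<p} - I)" using assms by auto
  then show ?thesis by (simp add: walk_coeff_def)
qed

lemma finite_walk_sets: "finite (walk_sets k p u)"
  by (rule finite_subset[of _ "Pow {k..<p}"]) (auto simp: walk_sets_def)

text \<open>Abstract in the operator, its two coefficients and the invariant \<open>valid\<close>,
  since it serves twice: for t T_k at positions below i and for T_k^(-1) at positions from i on,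
  which differ in the coefficient of keeping.\<close>

lemma walk_sum:
  fixes H :: "(nat \<Rightarrow> nat \<times> 'c) \<Rightarrow> 'a::field mpoly"
  assumes lin: "\<And>k. lin_op (F k)"
    and swap: "\<And>v k. valid v \<Longrightarrow> 1 \<le> k \<Longrightarrow> k < n \<Longrightarrow> fst (v k) \<noteq> fst (v (Suc k)) \<Longrightarrow> valid (v \<circ> swap_idx k)"
    and step: "\<And>v k. valid v \<Longrightarrow> 1 \<le> k \<Longrightarrow> k < n \<Longrightarrow>
      F k (H v) = Const (al (snd (v (Suc k))) (snd (v k))) * H v +
        (if fst (v k) = fst (v (Suc k)) then 0 else Const (be (snd (v (Suc k))) (snd (v k))) * H (v \<circ> swap_idx k))"
    and u: "valid u" and "k \<le> p" "1 \<le> k" "p \<le> n"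
  shows "foldr F [k..<p] (H u) = (\<Sum>I\<in>walk_sets k p u. Const (walk_coeff al be k p I u) * H (walk_end k p I u)) \<and>
    (\<forall>I\<in>walk_sets k p u. valid (walk_end k p I u))"
  using \<open>k \<le> p\<close> \<open>1 \<le> k\<close>
proof (induction rule: inc_induct)
  case base
  have "walk_sets p p u = {{}}" by (auto simp: walk_sets_def)
  moreover have "walk_end p p {} u = u" by (auto simp: walk_end_def carried_def fun_eq_iff)
  ultimately show ?case using u by (simp add: walk_coeff_def)
next
  case (step k)
  let ?W = "walk_sets (Suc k) p u"
  let ?W2 = "{I \<in> ?W. fst (u k) \<noteq> fst (carried p I u k)}"
  have k: "1 \<le> k" "k < p" "k < n" using step assms by auto
  have IH: "foldr F [Suc k..<p] (H u) = (\<Sum>I\<in>?W. Const (walk_coeff al be (Suc k) p I u) * H (walk_end (Suc k) p I u))"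
    "\<And>I. I \<in> ?W \<Longrightarrow> valid (walk_end (Suc k) p I u)"
    using step by auto
  have sub: "I \<subseteq> {Suc k..<p}" if "I \<in> ?W" for I
    using that by (rule walk_sets_subset)
  have at: "walk_end (Suc k) p I u k = u k" "walk_end (Suc k) p I u (Suc k) = carried p I u k" for I
    by (simp_all add: walk_end_def)
  have one: "F k (Const (walk_coeff al be (Suc k) p I u) * H (walk_end (Suc k) p I u)) =
      Const (walk_coeff al be k p (insert k I) u) * H (walk_end k p (insert k I) u) +
      (if fst (u k) \<noteq> fst (carried p I u k) then Const (walk_coeff al be k p I u) * H (walk_end k p I u) else 0)"
    if "I \<in> ?W" for I
    unfolding lin_op_scale[OF lin] assms(3)[OF IH(2)[OF that] k(1,3)] at walk_coeff_insert[OF k(1,2) sub[OF that]]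
      walk_coeff_swap[OF k(1,2) sub[OF that]] walk_end_insert[OF k(1,2) sub[OF that]] walk_end_swap[OF k(1,2) sub[OF that]]
    by (auto simp: algebra_simps)
  have inj: "inj_on (insert k) ?W"
  proof (rule inj_onI)
    fix I J assume "I \<in> ?W" "J \<in> ?W" "insert k I = insert k J"
    moreover from this have "k \<notin> I" "k \<notin> J" using sub by fastforce+
    ultimately show "I = J" by (metis insert_ident)
  qed
  have disj: "insert k ` ?W \<inter> ?W2 = {}"
    using sub by fastforce
  have "foldr F [k..<p] (H u) = F k (foldr F [Suc k..<p] (H u))"
    using k by (simp add: upt_conv_Cons)
  also have "\<dots> = (\<Sum>I\<in>?W. Const (walk_coeff al be k p (insert k I) u) * H (walk_end k p (insert k I) u)) +
      (\<Sum>I\<in>?W. if fst (u k) \<noteq> fst (carried p I u k) then Const (walk_coeff al be k p I u) * H (walk_end k p I u) else 0)"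
    unfolding IH(1) lin_op_sum[OF lin] sum.distrib[symmetric] by (intro sum.cong refl one)
  also have "(\<Sum>I\<in>?W. Const (walk_coeff al be k p (insert k I) u) * H (walk_end k p (insert k I) u)) =
      (\<Sum>I\<in>insert k ` ?W. Const (walk_coeff al be k p I u) * H (walk_end k p I u))"
    by (simp add: sum.reindex[OF inj])
  also have "(\<Sum>I\<in>?W. if fst (u k) \<noteq> fst (carried p I u k) then Const (walk_coeff al be k p I u) * H (walk_end k p I u) else 0) =
      (\<Sum>I\<in>?W2. Const (walk_coeff al be k p I u) * H (walk_end k p I u))"
    by (rule sum.inter_filter[symmetric]) (rule finite_walk_sets)
  also have "(\<Sum>I\<in>insert k ` ?W. Const (walk_coeff al be k p I u) * H (walk_end k p I u)) +
      (\<Sum>I\<in>?W2. Const (walk_coeff al be k p I u) * H (walk_end k p I u)) =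
      (\<Sum>I\<in>walk_sets k p u. Const (walk_coeff al be k p I u) * H (walk_end k p I u))"
    unfolding walk_sets_step[OF k(1,2)]
    by (rule sum.union_disjoint[symmetric]) (use disj finite_walk_sets[of "Suc k" p u] in auto)
  finally have "foldr F [k..<p] (H u) = (\<Sum>I\<in>walk_sets k p u. Const (walk_coeff al be k p I u) * H (walk_end k p I u))" .
  moreover have "valid (walk_end k p I u)" if "I \<in> walk_sets k p u" for I
    using that unfolding walk_sets_step[OF k(1,2)]
  proof
    assume "I \<in> insert k ` ?W"
    then obtain J where "J \<in> ?W" "I = insert k J" by blast
    moreover from this have "walk_end k p I u = walk_end (Suc k) p J u"
      using walk_end_insert[OF k(1,2) sub] by metis
    ultimately show ?thesis using IH(2) by metis
  next
    assume I: "I \<in> ?W2"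
    then have "walk_end k p I u = walk_end (Suc k) p I u \<circ> swap_idx k"
      by (intro walk_end_swap[OF k(1,2) sub]) blast
    moreover have "valid (walk_end (Suc k) p I u \<circ> swap_idx k)"
      by (rule assms(2)[OF IH(2) k(1,3)]) (use I at in auto)
    ultimately show ?thesis by metis
  qed
  ultimately show ?case by blast
qed

section \<open>The Pieri formula over a generic field\<close>

text \<open>
  Eigenvalues and coefficients are taken at \<open>(q, t)\<close>, the operators and polynomials of \<open>dual\<close>
  at the inverted parameters.
\<close>

locale pieri = generic n q t + dual: generic n "inverse q" "inverse t"
  for n :: nat and q t :: "'a::field"
begin

lemma dual_bar: "eta_bar n (inverse q) (inverse t) \<eta> i = inverse (bar \<eta> i)"
  by (simp add: eta_bar_def power_inverse power_int_inverse)

definition hE :: "(nat \<Rightarrow> nat) \<Rightarrow> 'a mpoly" where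
  "hE \<eta> = Const (inverse (k_const n q t \<eta>)) * dual.E \<eta>"

definition F :: "nat \<Rightarrow> 'a mpoly \<Rightarrow> 'a mpoly" where
  "F k f = Const t * T_op (inverse t) k f"

lemma lin_op_F: "lin_op (F k)"
  unfolding F_def by (intro lin_op_mult lin_op_T_op)

lemma F_quadratic: "F k (F k f) = Const (1 - t) * F k f + Const t * f"
proof -
  have "F k (F k f) = Const t * (Const t * T_op (inverse t) k (T_op (inverse t) k f))"
    by (simp add: F_def)
  also have "\<dots> = Const t * (Const (t * (inverse t - 1)) * T_op (inverse t) k f + Const (t * inverse t) * f)"
    unfolding T_op_quadratic by (simp only: Const_mult Const_diff Const_1 distrib_left mult.assoc)
  also have "t * (inverse t - 1) = 1 - t"
    by (simp add: algebra_simps)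
  also have "t * inverse t = 1"
    by simp
  finally show ?thesis
    by (simp only: F_def distrib_left Const_1 mult_1_left mult.left_commute[of "Const t" "Const (1 - t)"])
qed

lemma F_hE_less:
  assumes k: "1 \<le> k" "k < n" and \<eta>: "\<eta> \<in> compositions n" and less: "\<eta> k < \<eta> (Suc k)"
  shows "F k (hE \<eta>) = Const (- a_hat t (bar \<eta> (Suc k)) (bar \<eta> k)) * hE \<eta> +
    Const (b_hat t (bar \<eta> (Suc k)) (bar \<eta> k)) * hE (\<eta> \<circ> swap_idx k)"
proof -
  define x where "x = bar \<eta> k"
  define y where "y = bar \<eta> (Suc k)"
  define c where "c = k_const n q t \<eta>"
  define b where "b = b_hat t y x"
  have c': "k_const n q t (\<eta> \<circ> swap_idx k) = c * b"
    using k_const_swap[OF k less] by (simp add: c_def b_def x_def y_def)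
  then have b: "b \<noteq> 0" and c: "c \<noteq> 0"
    using k_const_nz[of "\<eta> \<circ> swap_idx k"] by (auto simp: c_def)
  have xy: "x \<noteq> 0" "y \<noteq> 0" "x \<noteq> y" using less by (auto simp: x_def y_def bar_eq_iff)
  then have xy': "inverse x - inverse y \<noteq> 0" "y - x \<noteq> 0" by auto
  \<comment> \<open>Passing to inverse eigenvalues: multiplying numerator and denominator by x y
    turns the intertwiner constant at 1/q, 1/t into \<open>- a_hat t y x\<close>.\<close>
  have a: "t * ((inverse t - 1) * inverse x / (inverse x - inverse y)) = - a_hat t y x"
    using xy xy' by (simp add: a_hat_def divide_simps) (simp add: algebra_simps)
  have "T_op (inverse t) k (dual.E \<eta>) = Const ((inverse t - 1) * inverse x / (inverse x - inverse y)) * dual.E \<eta>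
      + Const (inverse t) * dual.E (\<eta> \<circ> swap_idx k)"
    using dual.T_E_less[OF k \<eta> less] by (simp only: dual_bar x_def y_def)
  then have "F k (hE \<eta>) = Const (t * ((inverse t - 1) * inverse x / (inverse x - inverse y))) * (Const (inverse c) * dual.E \<eta>) +
      Const (t * inverse t * inverse c) * dual.E (\<eta> \<circ> swap_idx k)"
    by (simp only: F_def hE_def T_op_lin c_def[symmetric] Const_mult distrib_left mult.assoc
        mult.left_commute[of "Const (inverse c)"])
  \<comment> \<open>The exchange coefficient is 1 before normalisation; the ratio b of the two
    constants is what turns it into \<open>b_hat\<close>.\<close>
  also have "t * inverse t * inverse c = b * inverse (c * b)"
    using b c by simp
  finally show ?thesis
    unfolding a hE_def c' c_def[symmetric] x_def[symmetric] y_def[symmetric] b_def[symmetric]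
    by (simp only: Const_mult mult.assoc)
qed

text \<open>The intertwiner covers an ascent. For a descent the formula of the swapped composition
  is applied twice and the quadratic relation solved for F_k on eta. Equal entries fit in because
  eigenvalues in ratio t make the coefficient of keeping 1.\<close>

lemma F_hE:
  assumes k: "1 \<le> k" "k < n" and \<eta>: "\<eta> \<in> compositions n"
  shows "F k (hE \<eta>) = Const (- a_hat t (bar \<eta> (Suc k)) (bar \<eta> k)) * hE \<eta> +
    (if \<eta> k = \<eta> (Suc k) then 0 else Const (b_hat t (bar \<eta> (Suc k)) (bar \<eta> k)) * hE (\<eta> \<circ> swap_idx k))"
proof -
  consider "\<eta> k < \<eta> (Suc k)" | "\<eta> k = \<eta> (Suc k)" | "\<eta> (Suc k) < \<eta> k" by linarith
  then show ?thesis
  proof cases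
    case 1
    then show ?thesis using F_hE_less[OF k \<eta>] by simp
  next
    case 2
    define y where "y = bar \<eta> (Suc k)"
    have x: "bar \<eta> k = t * y" using bar_adjacent[OF k 2] by (simp add: y_def)
    have "bar \<eta> k \<noteq> y" unfolding y_def using k by (intro bar_distinct) auto
    then have "y - t * y \<noteq> 0" "y \<noteq> 0" using x by auto
    then have "- a_hat t y (t * y) = 1"
      by (simp add: a_hat_def divide_simps) (simp add: algebra_simps)
    moreover have "F k (hE \<eta>) = hE \<eta>"
      using dual.T_E_equal[OF k \<eta> 2] by (simp add: F_def hE_def Const_inverse_cancel mult.left_commute[of "Const t"])
    ultimately show ?thesis using 2 x by (simp only: y_def[symmetric]) simp
  next
    case 3
    define \<mu> where "\<mu> = \<eta> \<circ> swap_idx k"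
    define x where "x = bar \<eta> k"
    define y where "y = bar \<eta> (Suc k)"
    have \<mu>: "\<mu> \<in> compositions n" "\<mu> k < \<mu> (Suc k)" "\<mu> \<circ> swap_idx k = \<eta>"
      using k \<eta> 3 by (auto simp: \<mu>_def fun_eq_iff)
    have bars: "bar \<mu> k = y" "bar \<mu> (Suc k) = x"
      using bar_swap[OF k, of \<eta>] 3 k by (auto simp: \<mu>_def x_def y_def)
    have xy: "x - y \<noteq> 0" "y - x \<noteq> 0" using 3 by (auto simp: x_def y_def bar_eq_iff)
    define \<alpha> where "\<alpha> = - a_hat t x y"
    define \<beta> where "\<beta> = b_hat t x y"
    have 1: "F k (hE \<mu>) = Const \<alpha> * hE \<mu> + Const \<beta> * hE \<eta>"
      using F_hE_less[OF k \<mu>(1,2)] by (simp only: bars \<mu>(3) \<alpha>_def \<beta>_def)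
    have \<beta>: "\<beta> \<noteq> 0"
      using k_const_swap[OF k \<mu>(2)] k_const_nz[of \<eta>] by (auto simp: \<mu>(3) bars \<beta>_def)
    have "F k (F k (hE \<mu>)) = Const \<alpha> * F k (hE \<mu>) + Const \<beta> * F k (hE \<eta>)"
      by (subst 1) (simp only: lin_op_simps[OF lin_op_F])
    then have "Const \<beta> * F k (hE \<eta>) = Const (1 - t - \<alpha>) * F k (hE \<mu>) + Const t * hE \<mu>"
      by (simp add: F_quadratic algebra_simps)
    also have "\<dots> = Const ((1 - t - \<alpha>) * \<alpha> + t) * hE \<mu> + Const (\<beta> * (1 - t - \<alpha>)) * hE \<eta>"
      unfolding 1
      by (simp only: Const_mult Const_add distrib_left distrib_right mult.assoc mult.left_commute[of "Const \<beta>"] add_ac)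
    also have "1 - t - \<alpha> = - a_hat t y x"
      using xy by (simp add: \<alpha>_def a_hat_def divide_simps) (simp add: algebra_simps)
    \<comment> \<open>The Hecke relation in coefficient form: the exchange coefficients of an ascent
      and of its reverse multiply to t + a(x,y) a(y,x).\<close>
    also have "(- a_hat t y x) * \<alpha> + t = \<beta> * b_hat t y x"
    proof -
      define d where "d = x - y"
      have d: "d \<noteq> 0" "x - y = d" "y - x = - d" using xy by (simp_all add: d_def)
      have "- ((t - 1) * (t - 1) * x * y) + t * (d * d) = (x - t * y) * (t * x - y)"
        unfolding d_def by (simp add: algebra_simps)
      note num = this
      have "(- ((t - 1) * y / (- d))) * (- ((t - 1) * x / d)) + t =
          (- ((t - 1) * (t - 1) * x * y) + t * (d * d)) / (d * d)"
        using d(1) by (simp add: divide_simps)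
      also have "\<dots> = (x - t * y) / d * ((t * x - y) / d)"
        unfolding num by simp
      also have "(t * x - y) / d = (y - t * x) / (- d)"
        by (metis minus_diff_eq minus_divide_divide)
      finally show ?thesis
        unfolding \<alpha>_def \<beta>_def a_hat_def b_hat_def d(2,3) .
    qed
    finally have "Const (inverse \<beta>) * (Const \<beta> * F k (hE \<eta>)) =
        Const (inverse \<beta>) * (Const (\<beta> * b_hat t y x) * hE \<mu> + Const (\<beta> * (- a_hat t y x)) * hE \<eta>)"
      by simp
    also have "\<dots> = Const (b_hat t y x) * hE \<mu> + Const (- a_hat t y x) * hE \<eta>"
      by (simp only: distrib_left Const_mult[of \<beta>] mult.assoc Const_inverse_cancel \<beta> not_False_eq_True)
    finally have "F k (hE \<eta>) = Const (b_hat t y x) * hE \<mu> + Const (- a_hat t y x) * hE \<eta>"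
      by (simp only: Const_inverse_cancel \<beta> not_False_eq_True)
    then show ?thesis using 3 by (simp add: \<mu>_def x_def y_def)
  qed
qed

text \<open>At the inverted parameter T_k^(-1) = t T_k + (t - 1). Only the coefficient of keeping
  changes: - a(y,x) + (t - 1) = a(x,y).\<close>

lemma T_inv_hE:
  assumes k: "1 \<le> k" "k < n" and \<eta>: "\<eta> \<in> compositions n"
  shows "T_inv (inverse t) k (hE \<eta>) = Const (a_hat t (bar \<eta> k) (bar \<eta> (Suc k))) * hE \<eta> +
    (if \<eta> k = \<eta> (Suc k) then 0 else Const (b_hat t (bar \<eta> (Suc k)) (bar \<eta> k)) * hE (\<eta> \<circ> swap_idx k))"
proof -
  define x where "x = bar \<eta> k"
  define y where "y = bar \<eta> (Suc k)"
  have "x \<noteq> y" unfolding x_def y_def using k by (intro bar_distinct) auto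
  then have "x - y \<noteq> 0" "y - x \<noteq> 0" by auto
  then have a: "- a_hat t y x + (t - 1) = a_hat t x y"
    by (simp add: a_hat_def divide_simps) (simp add: algebra_simps)
  have "T_inv (inverse t) k (hE \<eta>) = F k (hE \<eta>) + Const (t * (1 - inverse t)) * hE \<eta>"
    by (simp add: T_inv_def F_def distrib_left mult.assoc)
  also have "t * (1 - inverse t) = t - 1" by (simp add: algebra_simps)
  also have "F k (hE \<eta>) + Const (t - 1) * hE \<eta> = Const (- a_hat t y x + (t - 1)) * hE \<eta> +
     (if \<eta> k = \<eta> (Suc k) then 0 else Const (b_hat t y x) * hE (\<eta> \<circ> swap_idx k))"
    unfolding F_hE[OF k \<eta>] x_def[symmetric] y_def[symmetric] by (simp only: Const_add distrib_right) simp
  finally show ?thesis unfolding a unfolding x_def y_def .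
qed

lemma Phi_hE:
  assumes "\<eta> \<in> compositions n"
  shows "dual.Phi (hE \<eta>) = Const (q * bar \<eta> 1 - t powi (- int n + 1)) * hE (Phi_comp n \<eta>)"
proof -
  define c where "c = k_const n q t \<eta>"
  define d where "d = q * bar \<eta> 1 - t powi (- int n + 1)"
  have k: "k_const n q t (Phi_comp n \<eta>) = c * (q ^ \<eta> 1 * d)"
    unfolding k_const_Phi_comp c_def d_def ..
  then have nz: "c \<noteq> 0" "d \<noteq> 0"
    using k_const_nz[of "Phi_comp n \<eta>"] by auto
  have "dual.Phi (hE \<eta>) = Const (inverse c * inverse q ^ \<eta> 1) * dual.E (Phi_comp n \<eta>)"
    unfolding hE_def dual.Phi_lin dual.Phi_E[OF assms] c_def[symmetric] by (simp only: Const_mult mult.assoc)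
  also have "inverse c * inverse q ^ \<eta> 1 = d * inverse (c * (q ^ \<eta> 1 * d))"
    using nz by (simp add: field_simps)
  finally show ?thesis
    unfolding hE_def k d_def[symmetric] by (simp only: Const_mult mult.assoc)
qed

lemma Y_hE: "\<eta> \<in> compositions n \<Longrightarrow> dual.Y 1 (hE \<eta>) = Const (inverse (bar \<eta> 1)) * hE \<eta>"
  using dual.Y_E[of \<eta> 1] n_pos by (simp add: hE_def dual_bar mult.left_commute)

text \<open>
  A composition and its spectral vector are moved around together, as a function to pairs.
\<close>

definition valid :: "(nat \<Rightarrow> nat \<times> 'a) \<Rightarrow> bool" where
  "valid v \<longleftrightarrow> fst \<circ> v \<in> compositions n \<and> (\<forall>j\<in>{1..n}. snd (v j) = bar (fst \<circ> v) j)"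

definition H :: "(nat \<Rightarrow> nat \<times> 'a) \<Rightarrow> 'a mpoly" where
  "H v = hE (fst \<circ> v)"

definition Phi_val :: "(nat \<Rightarrow> nat \<times> 'a) \<Rightarrow> nat \<Rightarrow> nat \<times> 'a" where
  "Phi_val v j = (if j = n then map_prod Suc (\<lambda>x. q * x) (v 1) else if 1 \<le> j \<and> j < n then v (Suc j) else v j)"

text \<open>Eigenvalues move with entries that differ, so permuting pairs agrees with recomputing
  the spectral vector of the new composition. Ties, broken by position, would spoil this.\<close>

lemma valid_swap:
  assumes "valid v" "1 \<le> k" "k < n" "fst (v k) \<noteq> fst (v (Suc k))"
  shows "valid (v \<circ> swap_idx k)"
  unfolding valid_def
proof (intro conjI ballI)
  have "fst \<circ> (v \<circ> swap_idx k) = (fst \<circ> v) \<circ> swap_idx k" by auto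
  note e = this
  show "fst \<circ> (v \<circ> swap_idx k) \<in> compositions n"
    unfolding e using assms by (intro swap_in_compositions) (auto simp: valid_def)
  fix j assume j: "j \<in> {1..n}"
  then have "swap_idx k j \<in> {1..n}" using assms swap_idx_in_iff[of k n j] by blast
  then have "snd (v (swap_idx k j)) = bar (fst \<circ> v) (swap_idx k j)" using assms(1) by (simp add: valid_def)
  also have "\<dots> = bar ((fst \<circ> v) \<circ> swap_idx k) j"
    using assms j by (intro bar_swap[symmetric]) auto
  finally show "snd ((v \<circ> swap_idx k) j) = bar (fst \<circ> (v \<circ> swap_idx k)) j"
    unfolding e by simp
qed

lemma fst_Phi_val:
  assumes "valid v"
  shows "fst \<circ> Phi_val v = Phi_comp n (fst \<circ> v)"
proof
  fix j
  have "fst (v j) = 0" if "j = 0 \<or> j > n"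
    using assms that by (auto simp: valid_def compositions_def)
  then show "(fst \<circ> Phi_val v) j = Phi_comp n (fst \<circ> v) j"
    by (auto simp: Phi_val_def Phi_comp_def)
qed

lemma valid_Phi_val:
  assumes "valid v"
  shows "valid (Phi_val v)"
proof -
  have "snd (Phi_val v j) = bar (Phi_comp n (fst \<circ> v)) j" if "j \<in> {1..n}" for j
    using assms that n_pos by (auto simp: bar_Phi_comp Phi_val_def valid_def)
  then show ?thesis
    using n_pos by (simp add: valid_def[of "Phi_val v"] fst_Phi_val[OF assms])
qed

lemma F_H:
  assumes "valid v" "1 \<le> k" "k < n"
  shows "F k (H v) = Const (- a_hat t (snd (v (Suc k))) (snd (v k))) * H v +
    (if fst (v k) = fst (v (Suc k)) then 0 else Const (b_hat t (snd (v (Suc k))) (snd (v k))) * H (v \<circ> swap_idx k))"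
  using F_hE[OF assms(2,3), of "fst \<circ> v"] assms by (simp add: valid_def H_def comp_assoc)

lemma T_inv_H:
  assumes "valid v" "1 \<le> k" "k < n"
  shows "T_inv (inverse t) k (H v) = Const (a_hat t (snd (v k)) (snd (v (Suc k)))) * H v +
    (if fst (v k) = fst (v (Suc k)) then 0 else Const (b_hat t (snd (v (Suc k))) (snd (v k))) * H (v \<circ> swap_idx k))"
  using T_inv_hE[OF assms(2,3), of "fst \<circ> v"] assms by (simp add: valid_def H_def comp_assoc)

lemma Phi_H:
  "valid v \<Longrightarrow> dual.Phi (H v) = Const (q * snd (v 1) - t powi (- int n + 1)) * H (Phi_val v)"
  using Phi_hE[of "fst \<circ> v"] n_pos by (simp add: H_def fst_Phi_val) (simp add: valid_def)

lemma Y_H: "valid v \<Longrightarrow> dual.Y 1 (H v) = Const (inverse (snd (v 1))) * H v"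
  using Y_hE[of "fst \<circ> v"] n_pos by (simp add: H_def valid_def)

lemma snd_valid_nz: "valid v \<Longrightarrow> j \<in> {1..n} \<Longrightarrow> snd (v j) \<noteq> 0"
  by (simp add: valid_def)

text \<open>
  For \<open>j \<in> I\<close> this is the entry of \<open>c\<^sub>I\<close> at \<open>j\<close>, and for \<open>j \<notin> I\<close> the value that maximality
  forbids at \<open>j\<close>; the second components are the arguments \<open>z\<^sub>t\<^sub>u\<close> and \<open>q z\<^sub>t\<^sub>1\<close> of
  \<open>A\<^sub>I\<close> and \<open>B\<^sub>I\<close>.
\<close>

definition cyc :: "nat set \<Rightarrow> (nat \<Rightarrow> nat \<times> 'a) \<Rightarrow> nat \<Rightarrow> nat \<times> 'a" where
  "cyc I v j = (if \<exists>x\<in>I. j < x then v (Min {x \<in> I. j < x}) else map_prod Suc (\<lambda>x. q * x) (v (Min I)))"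

lemma walk_expansion:
  assumes v: "valid v" and i: "i \<in> {1..n}"
  shows "zvar i * H v = (\<Sum>(J, K)\<in>Sigma (walk_sets 1 i v) (\<lambda>J. walk_sets i n (Phi_val (walk_end 1 i J v))).
    Const (walk_coeff (\<lambda>y x. - a_hat t y x) (b_hat t) 1 i J v * snd (walk_end 1 i J v 1) *
        (q * snd (walk_end 1 i J v 1) - t powi (- int n + 1)) *
        walk_coeff (\<lambda>y x. a_hat t x y) (b_hat t) i n K (Phi_val (walk_end 1 i J v))) *
      H (walk_end i n K (Phi_val (walk_end 1 i J v))))"
proof -
  define W where "W = walk_sets 1 i v"
  define c1 where "c1 J = walk_coeff (\<lambda>y x. - a_hat t y x) (b_hat t) 1 i J v" for J
  define v1 where "v1 J = walk_end 1 i J v" for J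
  define u where "u J = Phi_val (v1 J)" for J
  define e where "e J = c1 J * snd (v1 J 1) * (q * snd (v1 J 1) - t powi (- int n + 1))" for J
  define c2 where "c2 J K = walk_coeff (\<lambda>y x. a_hat t x y) (b_hat t) i n K (u J)" for J K
  have i': "1 \<le> i" "i \<le> n" using i by auto
  have "foldr F [1..<i] (H v) = (\<Sum>J\<in>W. Const (c1 J) * H (v1 J)) \<and> (\<forall>J\<in>W. valid (v1 J))"
    unfolding W_def c1_def v1_def
    by (rule walk_sum[where valid = valid and n = n, OF lin_op_F valid_swap F_H v]) (use i' in auto)
  then have 1: "foldr F [1..<i] (H v) = (\<Sum>J\<in>W. Const (c1 J) * H (v1 J))" "\<And>J. J \<in> W \<Longrightarrow> valid (v1 J)"
    by auto
  \<comment> \<open>A preimage under Y_1: on each term its eigenvalue is the inverse of the first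
    spectral value, so the coefficient is multiplied by that value.\<close>
  define g where "g = (\<Sum>J\<in>W. Const (c1 J * snd (v1 J 1)) * H (v1 J))"
  have "dual.Y 1 g = (\<Sum>J\<in>W. Const (c1 J) * H (v1 J))"
    unfolding g_def lin_op_sum[OF dual.lin_op_Y]
  proof (rule sum.cong)
    fix J assume J: "J \<in> W"
    have nz: "snd (v1 J 1) \<noteq> 0" using snd_valid_nz[OF 1(2)[OF J], of 1] n_pos by simp
    show "dual.Y 1 (Const (c1 J * snd (v1 J 1)) * H (v1 J)) = Const (c1 J) * H (v1 J)"
      unfolding dual.Y_lin Y_H[OF 1(2)[OF J]] by (simp only: Const_mult mult.assoc Const_inverse_cancel nz not_False_eq_True)
  qed simp
  also have "\<dots> = foldr (\<lambda>k h. Const (inverse (inverse t)) * T_op (inverse t) k h) [1..<i] (H v)"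
    unfolding 1(1)[symmetric] by (simp add: F_def[abs_def])
  finally have "zvar i * H v = foldr (T_inv (inverse t)) [i..<n] (dual.Phi g)"
    by (rule dual.zvar_expand[OF i'])
  also have "dual.Phi g = (\<Sum>J\<in>W. Const (e J) * H (u J))"
    unfolding g_def lin_op_sum[OF dual.lin_op_Phi] u_def
    by (intro sum.cong refl) (simp only: dual.Phi_lin Phi_H 1(2) e_def Const_mult mult.assoc)
  also have "foldr (T_inv (inverse t)) [i..<n] \<dots> = (\<Sum>J\<in>W. Const (e J) * foldr (T_inv (inverse t)) [i..<n] (H (u J)))"
  proof -
    have lin: "lin_op (foldr (T_inv (inverse t)) [i..<n])" by (simp add: lin_op_foldr)
    show ?thesis unfolding lin_op_sum[OF lin] lin_op_scale[OF lin] ..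
  qed
  also have "\<dots> = (\<Sum>J\<in>W. \<Sum>K\<in>walk_sets i n (u J). Const (e J * c2 J K) * H (walk_end i n K (u J)))"
  proof (rule sum.cong)
    fix J assume J: "J \<in> W"
    have u: "valid (u J)" unfolding u_def by (intro valid_Phi_val 1(2) J)
    have eq: "foldr (T_inv (inverse t)) [i..<n] (H (u J)) =
        (\<Sum>K\<in>walk_sets i n (u J). Const (c2 J K) * H (walk_end i n K (u J))) \<and>
      (\<forall>K\<in>walk_sets i n (u J). valid (walk_end i n K (u J)))"
      unfolding c2_def
      by (rule walk_sum[where valid = valid and n = n, OF lin_op_T_inv valid_swap T_inv_H u]) (use i' in auto)
    show "Const (e J) * foldr (T_inv (inverse t)) [i..<n] (H (u J)) =
        (\<Sum>K\<in>walk_sets i n (u J). Const (e J * c2 J K) * H (walk_end i n K (u J)))"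
      unfolding conjunct1[OF eq] sum_distrib_left Const_mult mult.assoc ..
  qed simp
  also have "\<dots> = (\<Sum>(J, K)\<in>Sigma W (\<lambda>J. walk_sets i n (u J)). Const (e J * c2 J K) * H (walk_end i n K (u J)))"
    by (rule sum.Sigma) (auto simp: W_def finite_walk_sets)
  finally show ?thesis
    unfolding W_def e_def c1_def c2_def u_def v1_def .
qed

end

text \<open>At an element of J the carried value is v at the next element, and v i at the last one.
  The two products thus differ only in their ends: v i against v at the least element, which is
  \<open>carried i J v 0\<close>.\<close>

lemma carried_telescope:
  assumes "finite J" "J \<subseteq> {1..<i}"
  shows "(\<Prod>j\<in>J. snd (carried i J v j)) * snd (carried i J v 0) = (\<Prod>j\<in>J. snd (v j)) * (snd (v i) :: 'a::field)"
  using assms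
proof (induction J rule: finite_linorder_min_induct)
  case empty
  then show ?case by (simp add: carried_def)
next
  case (insert b J)
  have b: "b \<notin> J" "1 \<le> b" using insert by auto
  have J: "J \<subseteq> {Suc b..<i}" using insert by force
  have 0: "carried i (insert b J) v 0 = v b"
  proof -
    have "{x \<in> insert b J. 0 < x} = {x \<in> insert b J. b - 1 < x}" using insert by force
    moreover have "(\<exists>x\<in>insert b J. 0 < x) \<longleftrightarrow> (\<exists>x\<in>insert b J. b - 1 < x)" using b by auto
    ultimately have "carried i (insert b J) v 0 = carried i (insert b J) v (b - 1)"
      by (simp add: carried_def)
    then show ?thesis using carried_insert_pred[OF b(2) J] by simp
  qed
  have "carried i (insert b J) v b = carried i J v b"
    by (rule carried_insert) simp
  moreover have "carried i J v b = carried i J v 0"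
  proof -
    have "b < x \<longleftrightarrow> 0 < x" if "x \<in> J" for x using subsetD[OF J that] by simp
    then have "{x \<in> J. b < x} = {x \<in> J. 0 < x}" "(\<exists>x\<in>J. b < x) \<longleftrightarrow> (\<exists>x\<in>J. 0 < x)"
      by auto
    then show ?thesis by (simp only: carried_def)
  qed
  moreover have "(\<Prod>j\<in>J. snd (carried i (insert b J) v j)) = (\<Prod>j\<in>J. snd (carried i J v j))"
    using J by (intro prod.cong) (auto simp: carried_insert)
  ultimately show ?case
    using insert b 0 by (simp add: mult_ac)
qed

section \<open>Merging the two walks into one index set\<close>

lemma Suc_Min_filter:
  assumes "finite K" "\<exists>y\<in>K. m < y" and "J \<subseteq> {..<i}" "i \<le> Suc m"
  shows "Min {x \<in> insert i (J \<union> Suc ` K). Suc m < x} = Suc (Min {y \<in> K. m < y})" (is "Min ?A = Suc (Min ?B)")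
proof -
  have "?A = Suc ` ?B" using assms(3,4) by auto
  moreover have "Min (Suc ` ?B) = Suc (Min ?B)"
    using assms by (intro mono_Min_commute[symmetric]) (auto intro: monoI)
  ultimately show ?thesis by simp
qed

text \<open>The second walk runs after \<open>Phi\<close> has moved the entries down by one, so its
  position m stands for the original position m + 1; hence the shift of K.\<close>

lemma complement_shift:
  assumes JK: "J \<subseteq> {1..<i}" "K \<subseteq> {i..<n}" and i: "1 \<le> i" "i \<le> n"
  shows "{1..n} - insert i (J \<union> Suc ` K) = ({1..<i} - J) \<union> Suc ` ({i..<n} - K)"
proof (intro equalityI subsetI)
  fix x assume x: "x \<in> {1..n} - insert i (J \<union> Suc ` K)"
  then consider "x < i" | "i < x" by fastforce
  then show "x \<in> ({1..<i} - J) \<union> Suc ` ({i..<n} - K)"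
  proof cases
    case 2
    then have "x = Suc (x - 1)" by simp
    moreover from this have "x - 1 \<notin> K" using x by (metis DiffD2 UnI2 imageI insertI2)
    then have "x - 1 \<in> {i..<n} - K" using x 2 by auto
    ultimately show ?thesis by blast
  qed (use x in auto)
next
  fix x assume "x \<in> ({1..<i} - J) \<union> Suc ` ({i..<n} - K)"
  then show "x \<in> {1..n} - insert i (J \<union> Suc ` K)"
    using JK i by fastforce
qed

context pieri
begin

lemma cyc_low:
  assumes JK: "J \<subseteq> {1..<i}" "K \<subseteq> {i..<n}" and j: "j < i"
  shows "cyc (insert i (J \<union> Suc ` K)) v j = carried i J v j"
proof -
  have Jm: "\<And>x. x \<in> J \<Longrightarrow> 1 \<le> x \<and> x < i" and Km: "\<And>x. x \<in> K \<Longrightarrow> i \<le> x \<and> x < n"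
    using JK by auto
  let ?I = "insert i (J \<union> Suc ` K)"
  have fin: "finite J" "finite K" using JK finite_subset by blast+
  have ex: "\<exists>x\<in>?I. j < x" using j by auto
  show ?thesis
  proof (cases "\<exists>x\<in>J. j < x")
    case True
    define m where "m = Min {x \<in> J. j < x}"
    have m: "m \<in> {x \<in> J. j < x}" "\<And>x. x \<in> {x \<in> J. j < x} \<Longrightarrow> m \<le> x"
      unfolding m_def using fin True by (intro Min_in Min_le; auto)+
    then have mi: "m < i" using JK by auto
    have "m \<le> x" if "x \<in> {x \<in> ?I. j < x}" for x
    proof -
      from that consider "x \<in> J" "j < x" | "x = i" | y where "x = Suc y" "y \<in> K" by auto
      then show ?thesis
      proof cases
        case 3
        then have "i \<le> y" using JK by auto
        then show ?thesis using 3 mi by simp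
      qed (use m mi in auto)
    qed
    then have "Min {x \<in> ?I. j < x} = m"
      using fin m(1) by (intro Min_eqI) auto
    then show ?thesis using ex True by (simp add: cyc_def carried_def m_def)
  next
    case False
    have "Min {x \<in> ?I. j < x} = i"
      using fin j False JK by (intro Min_eqI) (auto dest: Jm Km)
    then show ?thesis using ex False unfolding cyc_def carried_def by (simp only: if_True if_False)
  qed
qed

lemma cyc_Min:
  fixes v :: "nat \<Rightarrow> nat \<times> 'a"
  assumes JK: "J \<subseteq> {1..<i}" "K \<subseteq> {i..<n}" and i: "1 \<le> i"
  shows "v (Min (insert i (J \<union> Suc ` K))) = walk_end 1 i J v 1"
proof -
  let ?I = "insert i (J \<union> Suc ` K)"
  \<comment> \<open>At position 0, below all of I, \<open>cyc\<close> returns the value at the least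
    element, so the claim becomes an instance of \<open>cyc_low\<close>.\<close>
  have "{x \<in> ?I. 0 < x} = ?I" using JK i by force
  moreover have "\<exists>x\<in>?I. 0 < x" using i by auto
  ultimately have "cyc ?I v 0 = v (Min ?I)" by (simp only: cyc_def if_True)
  then show ?thesis
    using cyc_low[OF JK, of 0 v] i by (simp add: walk_end_def)
qed

text \<open>The value fed into the second walk at n is the one that the first walk left at position
  1, altered by \<open>Phi\<close>: v at the least element of I, with entry raised by one and
  eigenvalue multiplied by q. This is the closing value of the cycle.\<close>

lemma cyc_high:
  assumes JK: "J \<subseteq> {1..<i}" "K \<subseteq> {i..<n}" and i: "1 \<le> i" and m: "i \<le> Suc m" "m < n"
  shows "cyc (insert i (J \<union> Suc ` K)) v (Suc m) = carried n K (Phi_val (walk_end 1 i J v)) m"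
proof -
  have Jm: "\<And>x. x \<in> J \<Longrightarrow> 1 \<le> x \<and> x < i" and Km: "\<And>x. x \<in> K \<Longrightarrow> i \<le> x \<and> x < n"
    using JK by auto
  let ?I = "insert i (J \<union> Suc ` K)"
  have fin: "finite J" "finite K" using JK finite_subset by blast+
  have ex: "(\<exists>x\<in>?I. Suc m < x) \<longleftrightarrow> (\<exists>y\<in>K. m < y)"
    using JK m by (auto dest: Jm Km)
  show ?thesis
  proof (cases "\<exists>y\<in>K. m < y")
    case True
    define k where "k = Min {y \<in> K. m < y}"
    have "k \<in> {y \<in> K. m < y}"
      unfolding k_def using fin True by (intro Min_in) auto
    then have k: "i \<le> k" "k < n" using JK by auto
    have "Min {x \<in> ?I. Suc m < x} = Suc k"
      unfolding k_def using JK m by (intro Suc_Min_filter[OF fin(2) True]) auto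
    then have "cyc ?I v (Suc m) = v (Suc k)"
      using ex True unfolding cyc_def by (simp only: if_True)
    also have "\<dots> = Phi_val (walk_end 1 i J v) k"
      using k i by (simp add: Phi_val_def walk_end_def)
    also have "\<dots> = carried n K (Phi_val (walk_end 1 i J v)) m"
      using True by (simp add: carried_def k_def)
    finally show ?thesis .
  next
    case False
    then have "cyc ?I v (Suc m) = map_prod Suc (\<lambda>x. q * x) (v (Min ?I))"
      using ex unfolding cyc_def by (simp only: if_False)
    also have "\<dots> = Phi_val (walk_end 1 i J v) n"
      unfolding cyc_Min[OF JK i] by (simp add: Phi_val_def)
    also have "\<dots> = carried n K (Phi_val (walk_end 1 i J v)) m"
      using False by (simp add: carried_def)
    finally show ?thesis .
  qed
qed

lemma Phi_val_walk_end:
  assumes "1 \<le> i" "i \<le> m" "m < n"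
  shows "Phi_val (walk_end 1 i J v) m = v (Suc m)"
  using assms by (simp add: Phi_val_def walk_end_def)

lemma walk_end_eq_cyc:
  assumes JK: "J \<subseteq> {1..<i}" "K \<subseteq> {i..<n}" and i: "1 \<le> i" "i \<le> n" and j: "j \<in> {1..n}"
  defines "I \<equiv> insert i (J \<union> Suc ` K)"
  shows "walk_end i n K (Phi_val (walk_end 1 i J v)) j = (if j \<in> I then cyc I v j else v j)"
proof -
  have Jm: "\<And>x. x \<in> J \<Longrightarrow> 1 \<le> x \<and> x < i" and Km: "\<And>x. x \<in> K \<Longrightarrow> i \<le> x \<and> x < n"
    using JK by auto
  consider "j < i" | "j = i" | m where "j = Suc m" "i \<le> m" "m < n"
  proof -
    assume a: "j < i \<Longrightarrow> thesis" "j = i \<Longrightarrow> thesis" "\<And>m. j = Suc m \<Longrightarrow> i \<le> m \<Longrightarrow> m < n \<Longrightarrow> thesis"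
    show thesis using a(1,2) a(3)[of "j - 1"] j by (cases "j < i"; cases "j = i") auto
  qed
  then show ?thesis
  proof cases
    case 1
    have "j \<in> I \<longleftrightarrow> j \<in> J" using 1 JK by (auto simp: I_def dest: Jm Km)
    moreover have "walk_end i n K (Phi_val (walk_end 1 i J v)) j = walk_end 1 i J v (Suc j)"
      using 1 j i by (auto simp: walk_end_def[of i n] Phi_val_def)
    ultimately show ?thesis
      using 1 j cyc_low[OF JK 1, of v] by (simp add: walk_end_def I_def)
  next
    case 2
    then have "walk_end i n K (Phi_val (walk_end 1 i J v)) j = carried n K (Phi_val (walk_end 1 i J v)) (i - 1)"
      by (simp add: walk_end_def)
    also have "\<dots> = cyc I v i"
      using cyc_high[OF JK i(1), of "i - 1" v] i by (simp add: I_def)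
    finally show ?thesis using 2 by (simp add: I_def)
  next
    case 3
    have "j \<in> I \<longleftrightarrow> m \<in> K" using 3 JK by (auto simp: I_def dest: Jm Km)
    then show ?thesis
      using 3 cyc_high[OF JK i(1), of m v] Phi_val_walk_end[OF i(1), of m J v]
      by (simp add: walk_end_def[of i n] I_def)
  qed
qed

lemma walk_sets_iff_cyc:
  assumes JK: "J \<subseteq> {1..<i}" "K \<subseteq> {i..<n}" and i: "1 \<le> i" "i \<le> n"
  defines "I \<equiv> insert i (J \<union> Suc ` K)"
  shows "J \<in> walk_sets 1 i v \<and> K \<in> walk_sets i n (Phi_val (walk_end 1 i J v)) \<longleftrightarrow>
    (\<forall>j\<in>{1..n} - I. fst (v j) \<noteq> fst (cyc I v j))"
proof -
  have Jm: "\<And>x. x \<in> J \<Longrightarrow> 1 \<le> x \<and> x < i" and Km: "\<And>x. x \<in> K \<Longrightarrow> i \<le> x \<and> x < n"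
    using JK by auto
  note split = complement_shift[OF JK i, folded I_def]
  have "J \<in> walk_sets 1 i v \<longleftrightarrow> (\<forall>j\<in>{1..<i} - J. fst (v j) \<noteq> fst (cyc I v j))"
    using JK cyc_low[OF JK, of _ v] by (simp add: walk_sets_def I_def)
  moreover have "K \<in> walk_sets i n (Phi_val (walk_end 1 i J v)) \<longleftrightarrow> (\<forall>j\<in>Suc ` ({i..<n} - K). fst (v j) \<noteq> fst (cyc I v j))"
    using JK i cyc_high[OF JK i(1), of _ v] Phi_val_walk_end[OF i(1), of _ J v] by (simp add: walk_sets_def I_def)
  ultimately show ?thesis unfolding split by blast
qed

lemma walk_coeff_eq_cyc:
  assumes JK: "J \<subseteq> {1..<i}" "K \<subseteq> {i..<n}" and i: "1 \<le> i" "i \<le> n" and v: "valid v"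
  defines "I \<equiv> insert i (J \<union> Suc ` K)"
  shows "walk_coeff (\<lambda>y x. - a_hat t y x) (b_hat t) 1 i J v * snd (walk_end 1 i J v 1) *
        (q * snd (walk_end 1 i J v 1) - t powi (- int n + 1)) *
        walk_coeff (\<lambda>y x. a_hat t x y) (b_hat t) i n K (Phi_val (walk_end 1 i J v)) =
      snd (v i) * (q * snd (v (Min I)) - t powi (- int n + 1)) *
        (\<Prod>j\<in>I - {i}. a_hat t (snd (v j)) (snd (cyc I v j))) *
        (\<Prod>j\<in>{1..n} - I. b_hat t (snd (cyc I v j)) (snd (v j)))"
proof -
  have Jm: "\<And>x. x \<in> J \<Longrightarrow> 1 \<le> x \<and> x < i" and Km: "\<And>x. x \<in> K \<Longrightarrow> i \<le> x \<and> x < n"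
    using JK by auto
  have fin: "finite J" "finite K" using JK finite_subset by blast+
  let ?z = "\<lambda>j. snd (v j)"
  let ?c = "\<lambda>j. snd (cyc I v j)"
  have low: "carried i J v j = cyc I v j" if "j < i" for j
    using cyc_low[OF JK that] by (simp add: I_def)
  have high: "carried n K (Phi_val (walk_end 1 i J v)) m = cyc I v (Suc m)" if "i \<le> Suc m" "m < n" for m
    using cyc_high[OF JK i(1) that] by (simp add: I_def)
  have min: "walk_end 1 i J v 1 = v (Min I)" using cyc_Min[OF JK i(1), of v] by (simp add: I_def)
  have c1: "walk_coeff (\<lambda>y x. - a_hat t y x) (b_hat t) 1 i J v =
      (\<Prod>j\<in>J. - a_hat t (?c j) (?z j)) * (\<Prod>j\<in>{1..<i} - J. b_hat t (?c j) (?z j))"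
    unfolding walk_coeff_def using JK by (intro arg_cong2[where f = "(*)"] prod.cong) (auto simp: low dest: Jm Km)
  have c2: "walk_coeff (\<lambda>y x. a_hat t x y) (b_hat t) i n K (Phi_val (walk_end 1 i J v)) =
      (\<Prod>m\<in>K. a_hat t (?z (Suc m)) (?c (Suc m))) * (\<Prod>m\<in>{i..<n} - K. b_hat t (?c (Suc m)) (?z (Suc m)))"
  proof -
    define U where "U = Phi_val (walk_end 1 i J v)"
    have "snd (U m) = ?z (Suc m)" "snd (carried n K U m) = ?c (Suc m)" if "i \<le> m" "m < n" for m
      using that high[of m] Phi_val_walk_end[OF i(1), of m J v] unfolding U_def by auto
    then show ?thesis
      unfolding walk_coeff_def U_def[symmetric]
      by (intro arg_cong2[where f = "(*)"] prod.cong refl) (auto dest: Km)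
  qed
  have z: "?z j \<noteq> 0" if "j \<in> {1..n}" for j using snd_valid_nz[OF v that] .
  \<comment> \<open>Combines the telescoped product with the termwise reversal of the arguments of
    \<open>a_hat\<close>, in a form free of quotients; Z will be the product of the eigenvalues over
    J.\<close>
  have cancel: "P * m = Q * x" if "C * m = Z * x" "P * Z = Q * C" "Z \<noteq> 0" for P Q C Z m x :: 'a
  proof -
    have "Z * (P * m) = (P * Z) * m" by (simp only: mult_ac)
    also have "\<dots> = Q * (C * m)" by (simp only: that(2) mult.assoc)
    also have "\<dots> = Z * (Q * x)" by (simp only: that(1) mult.left_commute)
    finally show ?thesis using that(3) by simp
  qed
  have tele: "(\<Prod>j\<in>J. - a_hat t (?c j) (?z j)) * ?z (Min I) = (\<Prod>j\<in>J. a_hat t (?z j) (?c j)) * ?z i"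
  proof -
    have "(\<Prod>j\<in>J. ?c j) * ?z (Min I) = (\<Prod>j\<in>J. ?z j) * ?z i"
    proof -
      have "(\<Prod>j\<in>J. snd (carried i J v j)) = (\<Prod>j\<in>J. ?c j)"
        using JK by (intro prod.cong) (auto simp: low dest: Jm Km)
      moreover have "carried i J v 0 = v (Min I)"
        using min by (simp add: walk_end_def)
      ultimately show ?thesis
        using carried_telescope[OF fin(1) JK(1), of v] by simp
    qed
    moreover have "(\<Prod>j\<in>J. - a_hat t (?c j) (?z j)) * (\<Prod>j\<in>J. ?z j) = (\<Prod>j\<in>J. a_hat t (?z j) (?c j)) * (\<Prod>j\<in>J. ?c j)"
      unfolding prod.distrib[symmetric]
    proof (rule prod.cong)
      fix j
      have "- ((t - 1) * ?c j / (?c j - ?z j)) = (t - 1) * ?c j / (?z j - ?c j)"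
        by (metis minus_diff_eq minus_divide_right)
      then show "- a_hat t (?c j) (?z j) * ?z j = a_hat t (?z j) (?c j) * ?c j"
        by (simp add: a_hat_def)
    qed simp
    moreover have "(\<Prod>j\<in>J. ?z j) \<noteq> 0"
      using fin JK i z by (auto dest: Jm Km)
    ultimately show ?thesis
      by (rule cancel)
  qed
  have I1: "I - {i} = J \<union> Suc ` K" using JK by (auto simp: I_def dest: Jm Km)
  have A: "(\<Prod>j\<in>I - {i}. a_hat t (?z j) (?c j)) = (\<Prod>j\<in>J. a_hat t (?z j) (?c j)) * (\<Prod>m\<in>K. a_hat t (?z (Suc m)) (?c (Suc m)))"
  proof -
    have "J \<inter> Suc ` K = {}" using Jm Km by fastforce
    then show ?thesis
      unfolding I1 using fin by (simp add: prod.union_disjoint prod.reindex)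
  qed
  note I2 = complement_shift[OF JK i, folded I_def]
  have B: "(\<Prod>j\<in>{1..n} - I. b_hat t (?c j) (?z j)) =
      (\<Prod>j\<in>{1..<i} - J. b_hat t (?c j) (?z j)) * (\<Prod>m\<in>{i..<n} - K. b_hat t (?c (Suc m)) (?z (Suc m)))"
  proof -
    have "({1..<i} - J) \<inter> Suc ` ({i..<n} - K) = {}" by auto
    then show ?thesis
      unfolding I2 by (simp add: prod.union_disjoint prod.reindex)
  qed
  show ?thesis
    unfolding c1 c2 A B min using tele by (simp add: mult_ac)
qed

lemma pieri_cyc:
  assumes v: "valid v" and i: "i \<in> {1..n}"
  shows "zvar i * H v =
    (\<Sum>I | I \<subseteq> {1..n} \<and> i \<in> I \<and> (\<forall>j\<in>{1..n} - I. fst (v j) \<noteq> fst (cyc I v j)).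
      Const (snd (v i) * (q * snd (v (Min I)) - t powi (- int n + 1)) *
          (\<Prod>j\<in>I - {i}. a_hat t (snd (v j)) (snd (cyc I v j))) *
          (\<Prod>j\<in>{1..n} - I. b_hat t (snd (cyc I v j)) (snd (v j)))) *
        hE (\<lambda>j. if j \<in> I then fst (cyc I v j) else fst (v j)))"
  unfolding walk_expansion[OF v i]
\<comment> \<open>I decomposes into its part J below i, the element i itself, and its part above i,
  which shifted down by one is K.\<close>
proof (rule sum.reindex_bij_witness[where
      i = "\<lambda>I. (I \<inter> {1..<i}, {m \<in> {i..<n}. Suc m \<in> I})" and j = "\<lambda>(J, K). insert i (J \<union> Suc ` K)"])
  have i': "1 \<le> i" "i \<le> n" using i by auto
  let ?S = "Sigma (walk_sets 1 i v) (\<lambda>J. walk_sets i n (Phi_val (walk_end 1 i J v)))"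
  let ?h = "\<lambda>I. Const (snd (v i) * (q * snd (v (Min I)) - t powi (- int n + 1)) *
      (\<Prod>j\<in>I - {i}. a_hat t (snd (v j)) (snd (cyc I v j))) *
      (\<Prod>j\<in>{1..n} - I. b_hat t (snd (cyc I v j)) (snd (v j)))) *
    hE (\<lambda>j. if j \<in> I then fst (cyc I v j) else fst (v j))"
  let ?T = "{I. I \<subseteq> {1..n} \<and> i \<in> I \<and> (\<forall>j\<in>{1..n} - I. fst (v j) \<noteq> fst (cyc I v j))}"
  {
    fix a assume a: "a \<in> ?S"
    obtain J K where JK: "a = (J, K)" by (cases a)
    have sub: "J \<subseteq> {1..<i}" "K \<subseteq> {i..<n}"
      using a walk_sets_subset unfolding JK by blast+
    let ?I = "insert i (J \<union> Suc ` K)"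
    have Jm: "\<And>x. x \<in> J \<Longrightarrow> 1 \<le> x \<and> x < i" and Km: "\<And>x. x \<in> K \<Longrightarrow> i \<le> x \<and> x < n"
      using sub by auto
    have J: "?I \<inter> {1..<i} = J" by (auto dest: Jm Km)
    have K: "{m \<in> {i..<n}. Suc m \<in> ?I} = K" by (auto dest: Jm Km)
    show "(case a of (J, K) \<Rightarrow> insert i (J \<union> Suc ` K)) \<in> ?T"
      using a walk_sets_iff_cyc[OF sub i', of v] i' unfolding JK by (auto dest: Jm Km)
    show "((case a of (J, K) \<Rightarrow> insert i (J \<union> Suc ` K)) \<inter> {1..<i},
        {m \<in> {i..<n}. Suc m \<in> (case a of (J, K) \<Rightarrow> insert i (J \<union> Suc ` K))}) = a"
      unfolding JK prod.case J K ..
    have "H (walk_end i n K (Phi_val (walk_end 1 i J v))) = hE (\<lambda>j. if j \<in> ?I then fst (cyc ?I v j) else fst (v j))"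
      unfolding H_def
    proof (rule arg_cong[where f = hE], rule ext)
      fix j
      show "(fst \<circ> walk_end i n K (Phi_val (walk_end 1 i J v))) j = (if j \<in> ?I then fst (cyc ?I v j) else fst (v j))"
      proof (cases "j \<in> {1..n}")
        case True
        then show ?thesis using walk_end_eq_cyc[OF sub i' True, of v] by simp
      next
        case False
        then have "j \<notin> ?I" using i' by (auto dest: Jm Km)
        moreover have "walk_end i n K (Phi_val (walk_end 1 i J v)) j = v j"
          using False i' by (auto simp: walk_end_def Phi_val_def)
        ultimately show ?thesis by simp
      qed
    qed
    then show "?h (case a of (J, K) \<Rightarrow> insert i (J \<union> Suc ` K)) =
      (case a of (J, K) \<Rightarrow> Const (walk_coeff (\<lambda>y x. - a_hat t y x) (b_hat t) 1 i J v * snd (walk_end 1 i J v 1) *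
        (q * snd (walk_end 1 i J v 1) - t powi (- int n + 1)) *
        walk_coeff (\<lambda>y x. a_hat t x y) (b_hat t) i n K (Phi_val (walk_end 1 i J v))) *
      H (walk_end i n K (Phi_val (walk_end 1 i J v))))"
      unfolding JK prod.case walk_coeff_eq_cyc[OF sub i' v] by simp
  }
  {
    fix I assume I: "I \<in> ?T"
    let ?J = "I \<inter> {1..<i}"
    let ?K = "{m \<in> {i..<n}. Suc m \<in> I}"
    have eq: "insert i (?J \<union> Suc ` ?K) = I"
    proof (intro equalityI subsetI)
      fix x assume x: "x \<in> I"
      consider "x < i" | "x = i" | "i < x" by linarith
      then show "x \<in> insert i (?J \<union> Suc ` ?K)"
      proof cases
        case 1
        then show ?thesis using x I by (auto dest!: subsetD)
      next
        case 3
        then have "x - 1 \<in> ?K" "x = Suc (x - 1)" using x I by (auto dest!: subsetD)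
        then show ?thesis by blast
      qed simp
    qed (use I in auto)
    then show "(case (?J, ?K) of (J, K) \<Rightarrow> insert i (J \<union> Suc ` K)) = I" by simp
    have sub: "?J \<subseteq> {1..<i}" "?K \<subseteq> {i..<n}" by auto
    show "(?J, ?K) \<in> ?S"
      using walk_sets_iff_cyc[OF sub i', of v] I unfolding eq by auto
  }
qed

end

section \<open>The index set of the formula\<close>

lemma elt_facts:
  assumes I: "I \<subseteq> {1..n}" "I \<noteq> {}"
  shows elt_0: "elt I 0 = 0"
    and elt_mem: "\<And>u. u \<in> {1..card I} \<Longrightarrow> elt I u \<in> I"
    and elt_less: "\<And>u u'. u < u' \<Longrightarrow> u' \<le> card I \<Longrightarrow> elt I u < elt I u'"
    and elt_ex: "\<And>j. j \<in> I \<Longrightarrow> \<exists>u\<in>{1..card I}. j = elt I u"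
proof -
  have fin: "finite I" using I finite_subset by blast
  define xs where "xs = sorted_list_of_set I"
  have xs: "set xs = I" "length xs = card I" "sorted_wrt (<) xs"
    using fin by (simp_all add: xs_def)
  have e: "elt I (Suc u) = xs ! u" for u by (simp add: elt_def xs_def)
  show 0: "elt I 0 = 0" by (simp add: elt_def)
  show mem: "elt I u \<in> I" if "u \<in> {1..card I}" for u
    using that xs by (cases u) (auto simp: e)
  show "elt I u < elt I u'" if uu: "u < u'" "u' \<le> card I" for u u'
  proof (cases u)
    case 0
    then have "elt I u' \<in> I" using uu by (intro mem) auto
    then show ?thesis using I 0 \<open>elt I 0 = 0\<close> by (auto dest!: subsetD)
  next
    case (Suc k)
    then obtain k' where k': "u' = Suc k'" using uu by (cases u') auto
    have "k < k'" "k' < length xs" using uu Suc k' xs(2) by auto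
    then show ?thesis
      unfolding Suc k' e by (rule sorted_wrt_nth_less[OF xs(3)])
  qed
  show "\<exists>u\<in>{1..card I}. j = elt I u" if "j \<in> I" for j
  proof -
    have "j \<in> set xs" using that xs(1) by simp
    then obtain k where "k < length xs" "xs ! k = j" by (auto simp: in_set_conv_nth)
    then have "j = elt I (Suc k)" "Suc k \<in> {1..card I}" using xs(2) by (simp_all only: e atLeastAtMost_iff) auto
    then show ?thesis by blast
  qed
qed

lemma elt_less_iff:
  assumes I: "I \<subseteq> {1..n}" "I \<noteq> {}" and "u \<le> card I" "u' \<le> card I"
  shows "elt I u < elt I u' \<longleftrightarrow> u < u'"
  using elt_less[OF I, of u u'] elt_less[OF I, of u' u] assms(3,4)
  by (cases u u' rule: linorder_cases) auto

lemma bij_betw_elt: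
  assumes I: "I \<subseteq> {1..n}" "I \<noteq> {}"
  shows "bij_betw (elt I) {1..card I} I"
proof (rule bij_betw_imageI)
  show "inj_on (elt I) {1..card I}"
  proof (rule inj_onI)
    fix u u' assume "u \<in> {1..card I}" "u' \<in> {1..card I}" "elt I u = elt I u'"
    then show "u = u'"
      using elt_less[OF I, of u u'] elt_less[OF I, of u' u] by (cases u u' rule: linorder_cases) auto
  qed
  show "elt I ` {1..card I} = I"
    using elt_mem[OF I] elt_ex[OF I] by blast
qed

lemma idx_elt:
  assumes I: "I \<subseteq> {1..n}" "I \<noteq> {}" and u: "u \<in> {1..card I}"
  shows "idx I (elt I u) = u"
proof -
  have "{x \<in> I. x \<le> elt I u} = elt I ` {1..u}"
  proof (intro equalityI subsetI)
    fix x assume x: "x \<in> {x \<in> I. x \<le> elt I u}"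
    then obtain u' where u': "u' \<in> {1..card I}" "x = elt I u'" using elt_ex[OF I] by blast
    then have "u' \<le> u" using x elt_less[OF I, of u u'] by (cases "u' \<le> u") auto
    then show "x \<in> elt I ` {1..u}" using u' by auto
  next
    fix x assume "x \<in> elt I ` {1..u}"
    then obtain u' where u': "u' \<in> {1..u}" "x = elt I u'" by blast
    then have "x \<in> I" using elt_mem[OF I, of u'] u by auto
    moreover have "elt I u' \<le> elt I u"
      using u' u elt_less[OF I, of u' u] by (cases "u' = u") auto
    ultimately show "x \<in> {x \<in> I. x \<le> elt I u}" using u' by simp
  qed
  moreover have "inj_on (elt I) {1..u}"
    using bij_betw_elt[OF I] u by (auto simp: bij_betw_def intro: inj_on_subset)
  ultimately show ?thesis by (simp add: idx_def card_image)
qed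

lemma Min_elt:
  assumes I: "I \<subseteq> {1..n}" "I \<noteq> {}"
  shows "Min I = elt I 1"
proof -
  have fin: "finite I" using I finite_subset by blast
  then have c: "card I \<ge> 1" using I by (simp add: Suc_leI card_gt_0_iff)
  show ?thesis
  proof (rule Min_eqI[OF fin])
    fix x assume "x \<in> I"
    then obtain u where u: "u \<in> {1..card I}" "x = elt I u" using elt_ex[OF I] by blast
    then show "elt I 1 \<le> x" using elt_less[OF I, of 1 u] by (cases "u = 1") auto
  qed (use elt_mem[OF I] c in auto)
qed

lemma Min_greater_elt:
  assumes I: "I \<subseteq> {1..n}" "I \<noteq> {}" and u: "u \<in> {1..card I}" and j: "elt I (u - 1) \<le> j" "j < elt I u"
  shows "Min {x \<in> I. j < x} = elt I u"
proof (rule Min_eqI)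
  show "finite {x \<in> I. j < x}" using I finite_subset by fastforce
  show "elt I u \<in> {x \<in> I. j < x}" using elt_mem[OF I u] j by simp
  fix x assume "x \<in> {x \<in> I. j < x}"
  then obtain u' where u': "u' \<in> {1..card I}" "x = elt I u'" "j < x" using elt_ex[OF I] by blast
  have "u - 1 \<le> card I" using u by auto
  then have "\<not> u' \<le> u - 1"
    using elt_less[OF I, of u' "u - 1"] u u' j by (cases "u' = u - 1") auto
  then have "u \<le> u'" using u by simp
  then show "elt I u \<le> x"
    using elt_less[OF I, of u u'] u' by (cases "u = u'") auto
qed

lemma none_greater_elt_last:
  assumes I: "I \<subseteq> {1..n}" "I \<noteq> {}" and j: "elt I (card I) \<le> j"
  shows "\<not> (\<exists>x\<in>I. j < x)"
proof
  assume "\<exists>x\<in>I. j < x"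
  then obtain u where "u \<in> {1..card I}" "j < elt I u" using elt_ex[OF I] by blast
  then show False using elt_less[OF I, of u "card I"] j by (cases "u = card I") auto
qed

lemma gap_exists:
  assumes I: "I \<subseteq> {1..n}" "I \<noteq> {}" and j: "j < elt I (card I)" "1 \<le> j" "j \<notin> I"
  shows "\<exists>u\<in>{1..card I}. j \<in> {elt I (u - 1)<..<elt I u}"
proof -
  \<comment> \<open>The first element of I beyond j. Minimality puts the previous one at or below j,
    and \<open>elt I 0 = 0\<close> covers the gap before the first element.\<close>
  define u where "u = (LEAST u. j < elt I u)"
  have u: "j < elt I u" "u \<le> card I"
    unfolding u_def by (rule LeastI, rule j(1), rule Least_le, rule j(1))
  have "u \<noteq> 0" using u(1) elt_0[OF I] by (cases u) auto
  moreover have "\<not> j < elt I (u - 1)"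
    using not_less_Least[of "u - 1" "\<lambda>u. j < elt I u"] \<open>u \<noteq> 0\<close> unfolding u_def by simp
  moreover have "elt I (u - 1) \<noteq> j"
  proof
    assume e: "elt I (u - 1) = j"
    then have "u - 1 \<noteq> 0" using j(2) elt_0[OF I] by (cases "u - 1 = 0") auto
    then have "u - 1 \<in> {1..card I}" using u(2) by auto
    then show False using elt_mem[OF I] e j(3) by blast
  qed
  ultimately show ?thesis using u by (intro bexI[of _ u]) auto
qed

text \<open>The gaps between consecutive elements and the tail are the ranges over which maximality
  is tested and the products of B_I are taken; on each of them \<open>cyc\<close> is
  constant.\<close>

lemma complement_eq:
  assumes I: "I \<subseteq> {1..n}" "I \<noteq> {}"
  shows "{1..n} - I = (\<Union>u\<in>{1..card I}. {elt I (u - 1)<..<elt I u}) \<union> {elt I (card I)<..n}"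
proof (intro equalityI subsetI)
  fix j assume j: "j \<in> {1..n} - I"
  have c: "card I \<in> {1..card I}" using I finite_subset[OF I(1)] by (simp add: Suc_leI card_gt_0_iff)
  have "j \<noteq> elt I (card I)" using j elt_mem[OF I c] by auto
  then consider "elt I (card I) < j" | "j < elt I (card I)" by linarith
  then show "j \<in> (\<Union>u\<in>{1..card I}. {elt I (u - 1)<..<elt I u}) \<union> {elt I (card I)<..n}"
    using gap_exists[OF I, of j] j by cases auto
next
  fix j assume "j \<in> (\<Union>u\<in>{1..card I}. {elt I (u - 1)<..<elt I u}) \<union> {elt I (card I)<..n}"
  then show "j \<in> {1..n} - I"
  proof
    assume "j \<in> (\<Union>u\<in>{1..card I}. {elt I (u - 1)<..<elt I u})"
    then obtain u where u: "u \<in> {1..card I}" "elt I (u - 1) < j" "j < elt I u" by auto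
    have "j \<notin> I"
    proof
      assume "j \<in> I"
      then obtain u' where u': "u' \<in> {1..card I}" "j = elt I u'" using elt_ex[OF I] by blast
      have "u - 1 < u'" "u' < u"
        using u u' elt_less_iff[OF I, of "u - 1" u'] elt_less_iff[OF I, of u' u] by auto
      then show False by simp
    qed
    moreover have "elt I u \<le> n" using elt_mem[OF I u(1)] I by auto
    ultimately show ?thesis using u by auto
  next
    assume j: "j \<in> {elt I (card I)<..n}"
    then have "j \<notin> I" using none_greater_elt_last[OF I order_refl] by auto
    then show ?thesis using j by auto
  qed
qed

context pieri
begin

lemma t_ne_1: "t \<noteq> 1"
  using indep[of 0 1] by auto

definition spec :: "(nat \<Rightarrow> nat) \<Rightarrow> nat \<Rightarrow> nat \<times> 'a" where
  "spec \<eta> j = (\<eta> j, bar \<eta> j)"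

lemma cyc_gap:
  assumes I: "I \<subseteq> {1..n}" "I \<noteq> {}" and u: "u \<in> {1..card I}" and j: "elt I (u - 1) \<le> j" "j < elt I u"
  shows "cyc I v j = v (elt I u)"
  using Min_greater_elt[OF I u j] elt_mem[OF I u] j by (auto simp: cyc_def)

lemma cyc_last:
  assumes I: "I \<subseteq> {1..n}" "I \<noteq> {}" and j: "elt I (card I) \<le> j"
  shows "cyc I v j = map_prod Suc (\<lambda>x. q * x) (v (elt I 1))"
  using none_greater_elt_last[OF I j] by (simp only: cyc_def if_False Min_elt[OF I])

lemma cyc_elt:
  assumes I: "I \<subseteq> {1..n}" "I \<noteq> {}" and u: "u \<in> {1..card I}"
  shows "cyc I v (elt I u) = (if u < card I then v (elt I (u + 1)) else map_prod Suc (\<lambda>x. q * x) (v (elt I 1)))"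
proof (cases "u < card I")
  case True
  then show ?thesis
    using cyc_gap[OF I, of "u + 1" "elt I u" v] elt_less[OF I, of u "u + 1"] by simp
next
  case False
  then have "u = card I" using u by simp
  then show ?thesis using cyc_last[OF I, of "elt I u" v] by simp
qed

lemma all_complement_iff:
  assumes I: "I \<subseteq> {1..n}" "I \<noteq> {}"
  shows "(\<forall>j\<in>{1..n} - I. P (v j) (cyc I v j)) \<longleftrightarrow>
    (\<forall>u\<in>{1..card I}. \<forall>j\<in>{elt I (u - 1)<..<elt I u}. P (v j) (v (elt I u))) \<and>
    (\<forall>j\<in>{elt I (card I)<..n}. P (v j) (map_prod Suc (\<lambda>x. q * x) (v (elt I 1))))"
proof -
  have "cyc I v j = v (elt I u)" if "u \<in> {1..card I}" "j \<in> {elt I (u - 1)<..<elt I u}" for u j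
    using that by (intro cyc_gap[OF I]) auto
  moreover have "cyc I v j = map_prod Suc (\<lambda>x. q * x) (v (elt I 1))" if "j \<in> {elt I (card I)<..n}" for j
    using that by (intro cyc_last[OF I]) auto
  ultimately show ?thesis
    unfolding complement_eq[OF I] by (simp only: ball_Un ball_UN cong: ball_cong)
qed

lemma prod_complement:
  assumes I: "I \<subseteq> {1..n}" "I \<noteq> {}"
  shows "(\<Prod>j\<in>{1..n} - I. g (v j) (cyc I v j)) =
    (\<Prod>u\<in>{1..card I}. \<Prod>j\<in>{elt I (u - 1)<..<elt I u}. g (v j) (v (elt I u))) *
    (\<Prod>j\<in>{elt I (card I)<..n}. g (v j) (map_prod Suc (\<lambda>x. q * x) (v (elt I 1))) :: 'a)"
proof -
  let ?G = "\<lambda>u. {elt I (u - 1)<..<elt I u}"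
  have mono: "elt I u \<le> elt I u'" if "u \<le> u'" "u' \<le> card I" for u u'
    using elt_less[OF I, of u u'] that by (cases "u = u'") auto
  have "(\<Prod>j\<in>{1..n} - I. g (v j) (cyc I v j)) =
      (\<Prod>j\<in>(\<Union>u\<in>{1..card I}. ?G u). g (v j) (cyc I v j)) * (\<Prod>j\<in>{elt I (card I)<..n}. g (v j) (cyc I v j))"
    unfolding complement_eq[OF I]
  proof (rule prod.union_disjoint)
    have "\<not> elt I (card I) < j" if "u \<in> {1..card I}" "j < elt I u" for u j
      using that mono[of u "card I"] by auto
    then show "(\<Union>u\<in>{1..card I}. ?G u) \<inter> {elt I (card I)<..n} = {}" by fastforce
  qed auto
  also have "(\<Prod>j\<in>(\<Union>u\<in>{1..card I}. ?G u). g (v j) (cyc I v j)) = (\<Prod>u\<in>{1..card I}. \<Prod>j\<in>?G u. g (v j) (cyc I v j))"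
  proof (rule prod.UNION_disjoint)
    have "?G u \<inter> ?G u' = {}" if "u < u'" "u' \<le> card I" for u u'
    proof -
      have "elt I u \<le> elt I (u' - 1)" using that by (intro mono) auto
      then show ?thesis by auto
    qed
    then show "\<forall>u\<in>{1..card I}. \<forall>u'\<in>{1..card I}. u \<noteq> u' \<longrightarrow> ?G u \<inter> ?G u' = {}"
      by (metis atLeastAtMost_iff inf_commute linorder_neqE_nat)
  qed auto
  also have "\<dots> = (\<Prod>u\<in>{1..card I}. \<Prod>j\<in>?G u. g (v j) (v (elt I u)))"
    by (intro prod.cong refl) (use cyc_gap[OF I] in auto)
  also have "(\<Prod>j\<in>{elt I (card I)<..n}. g (v j) (cyc I v j)) =
      (\<Prod>j\<in>{elt I (card I)<..n}. g (v j) (map_prod Suc (\<lambda>x. q * x) (v (elt I 1))))"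
    by (intro prod.cong refl) (use cyc_last[OF I] in auto)
  finally show ?thesis .
qed

lemma maximal_sets_iff:
  "I \<in> maximal_sets n \<eta> \<longleftrightarrow>
    I \<noteq> {} \<and> I \<subseteq> {1..n} \<and> (\<forall>j\<in>{1..n} - I. fst (spec \<eta> j) \<noteq> fst (cyc I (spec \<eta>) j))"
proof (cases "I \<noteq> {} \<and> I \<subseteq> {1..n}")
  case True
  then have I: "I \<subseteq> {1..n}" "I \<noteq> {}" by auto
  have "I \<in> maximal_sets n \<eta> \<longleftrightarrow>
     (\<forall>u\<in>{1..card I}. \<forall>j\<in>{elt I (u - 1)<..<elt I u}. fst (spec \<eta> j) \<noteq> fst (spec \<eta> (elt I u))) \<and>
     (\<forall>j\<in>{elt I (card I)<..n}. fst (spec \<eta> j) \<noteq> fst (map_prod Suc (\<lambda>x. q * x) (spec \<eta> (elt I 1))))"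
    using I by (simp add: maximal_sets_def spec_def)
  also have "\<dots> \<longleftrightarrow> (\<forall>j\<in>{1..n} - I. fst (spec \<eta> j) \<noteq> fst (cyc I (spec \<eta>) j))"
    by (rule all_complement_iff[OF I, symmetric])
  finally show ?thesis using I by simp
next
  case False
  then show ?thesis by (auto simp: maximal_sets_def)
qed

lemma c_comp_eq:
  assumes I: "I \<subseteq> {1..n}" "I \<noteq> {}"
  shows "c_comp I \<eta> = (\<lambda>j. if j \<in> I then fst (cyc I (spec \<eta>) j) else fst (spec \<eta> j))"
proof
  fix j
  show "c_comp I \<eta> j = (if j \<in> I then fst (cyc I (spec \<eta>) j) else fst (spec \<eta> j))"
  proof (cases "j \<in> I")
    case True
    then obtain u where u: "u \<in> {1..card I}" "j = elt I u" using elt_ex[OF I] by blast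
    show ?thesis
      using True cyc_elt[OF I u(1)] idx_elt[OF I u(1)] unfolding u(2) by (simp add: c_comp_def spec_def)
  qed (simp add: c_comp_def spec_def)
qed

text \<open>\<open>a_hat\<close> is homogeneous of degree 0, so the closing factor at z_{t_s}/q and
  z_{t_1} equals the one at z_{t_s} and q z_{t_1}, and A_I becomes a uniform product over I.\<close>

lemma A_coef_eq:
  assumes I: "I \<subseteq> {1..n}" "I \<noteq> {}"
  shows "A_coef q t I (bar \<eta>) = (\<Prod>j\<in>I. a_hat t (snd (spec \<eta> j)) (snd (cyc I (spec \<eta>) j)))"
proof -
  have c: "1 \<le> card I" using I finite_subset[OF I(1)] by (simp add: Suc_leI card_gt_0_iff)
  let ?f = "\<lambda>j. a_hat t (snd (spec \<eta> j)) (snd (cyc I (spec \<eta>) j))"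
  have "(\<Prod>j\<in>I. ?f j) = (\<Prod>u=1..card I. ?f (elt I u))"
    by (rule prod.reindex_bij_betw[OF bij_betw_elt[OF I], symmetric])
  also have "\<dots> = (\<Prod>u=1..<card I. ?f (elt I u)) * ?f (elt I (card I))"
    by (rule prod_split_last[OF c])
  also have "(\<Prod>u=1..<card I. ?f (elt I u)) = (\<Prod>u=1..<card I. a_hat t (bar \<eta> (elt I u)) (bar \<eta> (elt I (u + 1))))"
    using cyc_elt[OF I] by (intro prod.cong) (auto simp: spec_def)
  also have "?f (elt I (card I)) = a_hat t (bar \<eta> (elt I (card I))) (q * bar \<eta> (elt I 1))"
    using cyc_elt[OF I, of "card I"] c by (simp add: spec_def)
  also have "\<dots> = a_hat t (bar \<eta> (elt I (card I)) / q) (bar \<eta> (elt I 1))"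
  proof -
    have "a_hat t x (q * y) = a_hat t (x / q) y" for x y
    proof -
      have "x / q - y = (x - q * y) / q" by (simp add: diff_divide_distrib)
      then show ?thesis by (simp add: a_hat_def)
    qed
    then show ?thesis by simp
  qed
  finally show ?thesis by (simp add: A_coef_def mult.commute)
qed

text \<open>The coefficient chi replaces the factor of A_I at i by z_i. The cancellation needs this
  factor to be nonzero: its denominator is a difference of distinct values, in the closing case by
  \<open>q_bar_distinct\<close>, and t differs from 1.\<close>

lemma chi_A_eq:
  assumes I: "I \<subseteq> {1..n}" "i \<in> I"
  shows "chi_coef q t I i (bar \<eta>) * A_coef q t I (bar \<eta>) =
    bar \<eta> i * (\<Prod>j\<in>I - {i}. a_hat t (snd (spec \<eta> j)) (snd (cyc I (spec \<eta>) j)))"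
proof -
  have I': "I \<noteq> {}" and fin: "finite I" using I finite_subset[OF I(1)] by auto
  obtain u where u: "u \<in> {1..card I}" "i = elt I u" using elt_ex[OF I(1) I'] I(2) by blast
  define a where "a = a_hat t (snd (spec \<eta> i)) (snd (cyc I (spec \<eta>) i))"
  have "chi_coef q t I i (bar \<eta>) = bar \<eta> i / a"
    using cyc_elt[OF I(1) I' u(1), of "spec \<eta>"] idx_elt[OF I(1) I' u(1)]
    by (simp add: chi_coef_def a_def u(2) spec_def)
  moreover have "A_coef q t I (bar \<eta>) = a * (\<Prod>j\<in>I - {i}. a_hat t (snd (spec \<eta> j)) (snd (cyc I (spec \<eta>) j)))"
    unfolding A_coef_eq[OF I(1) I'] a_def by (rule prod.remove[OF fin I(2)])
  moreover have "a \<noteq> 0"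
  proof -
    have "snd (spec \<eta> i) \<noteq> snd (cyc I (spec \<eta>) i)"
    proof (cases "u < card I")
      case True
      then have "elt I (u + 1) \<in> I" using elt_mem[OF I(1) I', of "u + 1"] by simp
      moreover have "elt I u < elt I (u + 1)" using elt_less[OF I(1) I', of u "u + 1"] True by simp
      ultimately have "bar \<eta> (elt I u) \<noteq> bar \<eta> (elt I (u + 1))"
        using I u by (intro bar_distinct) auto
      then show ?thesis using True cyc_elt[OF I(1) I' u(1)] by (simp add: u(2) spec_def)
    next
      case False
      have "elt I 1 \<in> I" using elt_mem[OF I(1) I', of 1] u by simp
      moreover have "elt I 1 \<le> elt I u"
        using elt_less[OF I(1) I', of 1 u] u by (cases "u = 1") auto
      ultimately have "q * bar \<eta> (elt I 1) \<noteq> bar \<eta> (elt I u)"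
        using I u by (intro q_bar_distinct) auto
      then show ?thesis using False cyc_elt[OF I(1) I' u(1), of "spec \<eta>"] by (simp add: u(2) spec_def)
    qed
    then show ?thesis using t_ne_1 by (simp add: a_def a_hat_def spec_def)
  qed
  ultimately show ?thesis by simp
qed

lemma B_coef_eq:
  assumes I: "I \<subseteq> {1..n}" "I \<noteq> {}"
  shows "B_coef n q t I (bar \<eta>) = (q * snd (spec \<eta> (Min I)) - t powi (- int n + 1)) *
    (\<Prod>j\<in>{1..n} - I. b_hat t (snd (cyc I (spec \<eta>) j)) (snd (spec \<eta> j)))"
  using prod_complement[OF I, of "\<lambda>x y. b_hat t (snd y) (snd x)" "spec \<eta>"]
  by (simp add: B_coef_def Min_elt[OF I] spec_def mult.assoc)

lemma c_comp_in_compositions: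
  "I \<subseteq> {1..n} \<Longrightarrow> \<eta> \<in> compositions n \<Longrightarrow> c_comp I \<eta> \<in> compositions n"
  by (auto simp: compositions_def c_comp_def)

text \<open>The walks compute with E divided by its constant k; undoing this normalisation on both
  sides produces the ratio of constants.\<close>

theorem pieri_formula:
  assumes \<eta>: "\<eta> \<in> compositions n" and i: "i \<in> {1..n}"
  shows "zvar i * dual.E \<eta> = (\<Sum>I | I \<in> maximal_sets n \<eta> \<and> i \<in> I.
    Const (chi_coef q t I i (bar \<eta>) * A_coef q t I (bar \<eta>) * B_coef n q t I (bar \<eta>) *
        k_const n q t \<eta> / k_const n q t (c_comp I \<eta>)) * dual.E (c_comp I \<eta>))"
proof -
  define k where "k = k_const n q t \<eta>"
  have "fst \<circ> spec \<eta> = \<eta>" by (auto simp: spec_def)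
  then have v: "valid (spec \<eta>)" and H: "H (spec \<eta>) = hE \<eta>"
    using \<eta> by (simp_all add: valid_def H_def) (simp add: spec_def)
  have "zvar i * dual.E \<eta> = Const k * (zvar i * H (spec \<eta>))"
    by (simp add: H hE_def k_def mult.left_commute[of "zvar i"] Const_inverse_cancel)
  also have "\<dots> = (\<Sum>I | I \<subseteq> {1..n} \<and> i \<in> I \<and> (\<forall>j\<in>{1..n} - I. fst (spec \<eta> j) \<noteq> fst (cyc I (spec \<eta>) j)).
      Const k * (Const (snd (spec \<eta> i) * (q * snd (spec \<eta> (Min I)) - t powi (- int n + 1)) *
          (\<Prod>j\<in>I - {i}. a_hat t (snd (spec \<eta> j)) (snd (cyc I (spec \<eta>) j))) *
          (\<Prod>j\<in>{1..n} - I. b_hat t (snd (cyc I (spec \<eta>) j)) (snd (spec \<eta> j)))) *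
        hE (\<lambda>j. if j \<in> I then fst (cyc I (spec \<eta>) j) else fst (spec \<eta> j))))"
    unfolding pieri_cyc[OF v i] by (rule sum_distrib_left)
  also have "\<dots> = (\<Sum>I | I \<in> maximal_sets n \<eta> \<and> i \<in> I.
    Const (chi_coef q t I i (bar \<eta>) * A_coef q t I (bar \<eta>) * B_coef n q t I (bar \<eta>) *
        k_const n q t \<eta> / k_const n q t (c_comp I \<eta>)) * dual.E (c_comp I \<eta>))"
  proof (rule sum.cong)
    show "{I. I \<subseteq> {1..n} \<and> i \<in> I \<and> (\<forall>j\<in>{1..n} - I. fst (spec \<eta> j) \<noteq> fst (cyc I (spec \<eta>) j))} =
        {I. I \<in> maximal_sets n \<eta> \<and> i \<in> I}"
      unfolding maximal_sets_iff by blast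
    fix I assume "I \<in> {I. I \<in> maximal_sets n \<eta> \<and> i \<in> I}"
    then have I: "I \<subseteq> {1..n}" "I \<noteq> {}" "i \<in> I" by (auto simp: maximal_sets_def)
    let ?x = "snd (spec \<eta> i) * (q * snd (spec \<eta> (Min I)) - t powi (- int n + 1)) *
          (\<Prod>j\<in>I - {i}. a_hat t (snd (spec \<eta> j)) (snd (cyc I (spec \<eta>) j))) *
          (\<Prod>j\<in>{1..n} - I. b_hat t (snd (cyc I (spec \<eta>) j)) (snd (spec \<eta> j)))"
    have "chi_coef q t I i (bar \<eta>) * A_coef q t I (bar \<eta>) * B_coef n q t I (bar \<eta>) * k /
        k_const n q t (c_comp I \<eta>) = k * (?x * inverse (k_const n q t (c_comp I \<eta>)))"
      unfolding chi_A_eq[OF I(1,3)] B_coef_eq[OF I(1,2)] divide_inverse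
      by (simp only: spec_def snd_conv mult_ac)
    then show "Const k * (Const ?x * hE (\<lambda>j. if j \<in> I then fst (cyc I (spec \<eta>) j) else fst (spec \<eta> j))) =
        Const (chi_coef q t I i (bar \<eta>) * A_coef q t I (bar \<eta>) * B_coef n q t I (bar \<eta>) *
          k_const n q t \<eta> / k_const n q t (c_comp I \<eta>)) * dual.E (c_comp I \<eta>)"
      unfolding c_comp_eq[OF I(1,2), symmetric] hE_def k_def[symmetric] by (simp only: Const_mult mult.assoc)
  qed
  finally show ?thesis .
qed

end

section \<open>Inverting the parameters\<close>

definition rhom :: "('a::comm_ring_1 \<Rightarrow> 'b::comm_ring_1) \<Rightarrow> bool" where
  "rhom h \<longleftrightarrow> h 0 = 0 \<and> h 1 = 1 \<and> (\<forall>x y. h (x + y) = h x + h y) \<and> (\<forall>x y. h (x * y) = h x * h y)"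

lemma rhom_simps:
  assumes "rhom h"
  shows "h 0 = 0" "h 1 = 1" "h (x + y) = h x + h y" "h (x * y) = h x * h y" "h (- x) = - h x" "h (x - y) = h x - h y"
proof -
  show a: "h 0 = 0" "h 1 = 1" "h (x + y) = h x + h y" "h (x * y) = h x * h y" for x y
    using assms by (simp_all add: rhom_def)
  show u: "h (- x) = - h x" for x
    using a(3)[of x "- x"] a(1) by (simp add: eq_neg_iff_add_eq_0 add.commute)
  show "h (x - y) = h x - h y"
    using a(3)[of x "- y"] u[of y] by simp
qed

lemma rhom_sum: "rhom h \<Longrightarrow> h (sum f S) = (\<Sum>x\<in>S. h (f x))"
  by (induction S rule: infinite_finite_induct) (simp_all add: rhom_simps)

lemma rhom_power: "rhom h \<Longrightarrow> h (x ^ m) = h x ^ m"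
  by (induction m) (simp_all add: rhom_simps)

lemma rhom_poly_map_poly:
  assumes h: "rhom h"
  shows "rhom (\<lambda>p. poly (map_poly h p) x)"
proof -
  have h0: "h 0 = 0" by (rule rhom_simps[OF h])
  have "map_poly h (p + r) = map_poly h p + map_poly h r" for p r
    by (rule poly_eqI) (simp add: coeff_map_poly h0 rhom_simps[OF h])
  moreover have "map_poly h (p * r) = map_poly h p * map_poly h r" for p r
    by (rule poly_eqI) (simp add: coeff_map_poly h0 coeff_mult rhom_sum[OF h] rhom_simps[OF h])
  ultimately show ?thesis
    by (simp add: rhom_def map_poly_1' rhom_simps[OF h])
qed

definition eval_t :: "ratfun_qt \<Rightarrow> rat poly \<Rightarrow> ratfun_qt" where
  "eval_t y r = poly (map_poly (\<lambda>c. to_fract [:[:c:]:]) r) y"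

lemma rhom_const_embedding: "rhom (\<lambda>c. to_fract [:[:c:]:])"
  by (simp add: rhom_def to_fract_add[symmetric] to_fract_mult[symmetric] one_pCons[symmetric] del: to_fract_add to_fract_mult)

lemma rhom_eval_t: "rhom (eval_t y)"
  unfolding eval_t_def[abs_def] by (rule rhom_poly_map_poly[OF rhom_const_embedding])

lemma eval_qt_eq: "eval_qt p x y = poly (map_poly (eval_t y) p) x"
  by (simp add: eval_qt_def eval_t_def[abs_def])

lemma rhom_eval_qt: "rhom (\<lambda>p. eval_qt p x y)"
  unfolding eval_qt_eq by (rule rhom_poly_map_poly[OF rhom_eval_t])

lemma poly_map_poly_eq_sum:
  fixes h :: "'a::comm_ring_1 \<Rightarrow> 'b::comm_ring_1"
  assumes "h 0 = 0" "degree p \<le> N"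
  shows "poly (map_poly h p) x = (\<Sum>i\<le>N. h (coeff p i) * x ^ i)"
proof -
  have deg: "degree (map_poly h p) \<le> degree p"
    by (rule degree_le) (simp add: coeff_map_poly assms(1) coeff_eq_0)
  have "poly (map_poly h p) x = (\<Sum>i\<le>degree (map_poly h p). coeff (map_poly h p) i * x ^ i)"
    by (rule poly_altdef)
  also have "\<dots> = (\<Sum>i\<le>N. coeff (map_poly h p) i * x ^ i)"
    using assms deg by (intro sum.mono_neutral_left) (auto simp: coeff_eq_0)
  finally show ?thesis using assms(1) by (simp add: coeff_map_poly)
qed

text \<open>If \<open>f\<close> lists the coefficients of a polynomial of degree at most N, this is
  x^N times its value at 1/x.\<close>

definition rev_poly :: "nat \<Rightarrow> (nat \<Rightarrow> 'a::comm_ring_1) \<Rightarrow> 'a poly" where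
  "rev_poly N f = (\<Sum>i\<le>N. monom (f i) (N - i))"

lemma coeff_rev_poly: "i \<le> N \<Longrightarrow> coeff (rev_poly N f) (N - i) = f i"
proof -
  assume i: "i \<le> N"
  have "coeff (rev_poly N f) (N - i) = (\<Sum>j\<le>N. if j = i then f i else 0)"
    unfolding rev_poly_def coeff_sum using i by (intro sum.cong) auto
  then show ?thesis using i by simp
qed

lemma t_var_power: "t_var ^ m = to_fract [:monom 1 m:]"
proof (induction m)
  case (Suc m)
  have "[:monom 1 (Suc m):] = [:[:0, 1:]:] * [:monom (1::rat) m:]"
    by (simp add: monom_Suc)
  then show ?case using Suc by (metis power_Suc t_var_def to_fract_mult)
qed (simp add: one_pCons[symmetric])

lemma q_var_power: "q_var ^ m = to_fract (monom 1 m)"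
proof (induction m)
  case (Suc m)
  have "monom 1 (Suc m) = [:0, 1:] * monom (1::rat poly) m"
    by (simp add: monom_Suc)
  then show ?case using Suc by (metis power_Suc q_var_def to_fract_mult)
qed simp

lemma q_var_nz [simp]: "q_var \<noteq> 0" and t_var_nz [simp]: "t_var \<noteq> 0"
  by (simp_all add: q_var_def t_var_def)

lemma eval_t_inverse:
  assumes "degree r \<le> M"
  shows "t_var ^ M * eval_t (inverse t_var) r = to_fract [:rev_poly M (coeff r):]"
proof -
  have "t_var ^ M * eval_t (inverse t_var) r = (\<Sum>i\<le>M. to_fract [:[:coeff r i:]:] * (t_var ^ M * inverse t_var ^ i))"
    unfolding eval_t_def poly_map_poly_eq_sum[where h = "\<lambda>c. to_fract [:[:c:]:]", OF rhom_simps(1)[OF rhom_const_embedding] assms]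
    by (simp add: sum_distrib_left mult_ac)
  also have "\<dots> = (\<Sum>i\<le>M. to_fract [:monom (coeff r i) (M - i):])"
  proof (rule sum.cong)
    fix i assume "i \<in> {..M}"
    then have "t_var ^ M * inverse t_var ^ i = t_var ^ (M - i)"
      by (simp add: power_inverse power_diff divide_inverse)
    moreover have "[:[:coeff r i:]:] * [:monom 1 (M - i):] = [:monom (coeff r i) (M - i):]"
      by (simp add: smult_monom)
    ultimately show "to_fract [:[:coeff r i:]:] * (t_var ^ M * inverse t_var ^ i) = to_fract [:monom (coeff r i) (M - i):]"
      unfolding t_var_power by (metis to_fract_mult)
  qed simp
  also have "\<dots> = to_fract (\<Sum>i\<le>M. [:monom (coeff r i) (M - i):])"
    by simp
  also have "(\<Sum>i\<le>M. [:monom (coeff r i) (M - i):]) = [:rev_poly M (coeff r):]"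
    unfolding rev_poly_def by (rule poly_eqI) (simp add: coeff_sum coeff_pCons split: nat.split)
  finally show ?thesis .
qed

text \<open>Multiplying by q^N t^M turns the value at the inverted indeterminates into the
  polynomial with both coefficient sequences reversed, which vanishes only with p. So
  \<open>invert_qt\<close> never divides by zero.\<close>

lemma eval_qt_inverse_eq_0:
  assumes "eval_qt p (inverse q_var) (inverse t_var) = 0"
  shows "p = 0"
proof -
  define N where "N = degree p"
  define M where "M = Max ((\<lambda>i. degree (coeff p i)) ` {..N})"
  have M: "degree (coeff p i) \<le> M" if "i \<le> N" for i
    unfolding M_def using that by (intro Max_ge) auto
  define P where "P = rev_poly N (\<lambda>i. rev_poly M (coeff (coeff p i)))"
  have "q_var ^ N * t_var ^ M * eval_qt p (inverse q_var) (inverse t_var) =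
      (\<Sum>i\<le>N. (t_var ^ M * eval_t (inverse t_var) (coeff p i)) * (q_var ^ N * inverse q_var ^ i))"
    unfolding eval_qt_eq poly_map_poly_eq_sum[where h = "eval_t (inverse t_var)" and p = p, OF rhom_simps(1)[OF rhom_eval_t] order_refl] N_def
    by (simp add: sum_distrib_left mult_ac)
  also have "\<dots> = (\<Sum>i\<le>N. to_fract (monom (rev_poly M (coeff (coeff p i))) (N - i)))"
  proof (rule sum.cong)
    fix i assume i: "i \<in> {..N}"
    then have "q_var ^ N * inverse q_var ^ i = q_var ^ (N - i)"
      by (simp add: power_inverse power_diff divide_inverse)
    moreover have "[:rev_poly M (coeff (coeff p i)):] * monom 1 (N - i) = monom (rev_poly M (coeff (coeff p i))) (N - i)"
      by (simp add: smult_monom)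
    moreover have "t_var ^ M * eval_t (inverse t_var) (coeff p i) = to_fract [:rev_poly M (coeff (coeff p i)):]"
      using i by (intro eval_t_inverse M) auto
    ultimately show "(t_var ^ M * eval_t (inverse t_var) (coeff p i)) * (q_var ^ N * inverse q_var ^ i) =
        to_fract (monom (rev_poly M (coeff (coeff p i))) (N - i))"
      unfolding q_var_power by (metis to_fract_mult)
  qed simp
  also have "\<dots> = to_fract P" by (simp add: P_def rev_poly_def)
  finally have P: "P = 0" using assms by simp
  have "coeff (coeff p i) j = 0" if "i \<le> N" "j \<le> M" for i j
    using coeff_rev_poly[OF that(1), of "\<lambda>i. rev_poly M (coeff (coeff p i))"] coeff_rev_poly[OF that(2), of "coeff (coeff p i)"] P
    by (simp add: P_def)
  then have "coeff p i = 0" if "i \<le> N" for i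
    using that M[OF that] by (metis coeff_eq_0 leading_coeff_0_iff)
  then show "p = 0" unfolding N_def by (metis leading_coeff_0_iff order_refl)
qed

text \<open>The definition uses the reduced fraction. Every other representation gives the same
  value by cross multiplication, as evaluation is a ring homomorphism that keeps denominators
  nonzero. Sums and products of fractions are rarely reduced as written, so the homomorphism
  property rests on this.\<close>

lemma invert_qt_divide:
  assumes "b \<noteq> 0"
  shows "invert_qt (to_fract a / to_fract b) =
    eval_qt a (inverse q_var) (inverse t_var) / eval_qt b (inverse q_var) (inverse t_var)"
proof -
  let ?e = "\<lambda>p. eval_qt p (inverse q_var) (inverse t_var)"
  define x where "x = to_fract a / to_fract b"
  define c where "c = fst (quot_of_fract x)"
  define d where "d = snd (quot_of_fract x)"
  have d: "d \<noteq> 0" by (simp add: d_def)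
  have "x = to_fract c / to_fract d"
    using Fract_quot_of_fract[of x] by (simp add: c_def d_def Fract_conv_to_fract)
  then have "to_fract a * to_fract d = to_fract c * to_fract b"
    using assms d by (simp add: x_def divide_simps mult.commute)
  then have "a * d = c * b" by (simp only: to_fract_mult[symmetric] to_fract_eq_iff)
  then have "?e (a * d) = ?e (c * b)" by simp
  then have "?e a * ?e d = ?e c * ?e b" by (simp only: rhom_simps(4)[OF rhom_eval_qt])
  moreover have "?e b \<noteq> 0" "?e d \<noteq> 0" using eval_qt_inverse_eq_0 assms d by blast+
  ultimately have "?e c / ?e d = ?e a / ?e b" by (simp add: divide_simps)
  moreover have "invert_qt x = ?e c / ?e d"
    by (simp add: invert_qt_def c_def d_def case_prod_beta Let_def)
  ultimately show ?thesis by (simp add: x_def)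
qed

lemma rhom_invert_qt: "rhom invert_qt"
proof -
  let ?e = "\<lambda>p. eval_qt p (inverse q_var) (inverse t_var)"
  note e = rhom_simps[OF rhom_eval_qt[of "inverse q_var" "inverse t_var"]]
  have ex: "\<exists>a b. b \<noteq> 0 \<and> x = to_fract a / to_fract b" for x :: ratfun_qt
    using Fract_quot_of_fract[of x] by (metis Fract_conv_to_fract snd_quot_of_fract_nonzero)
  have nz: "?e b \<noteq> 0" if "b \<noteq> 0" for b using eval_qt_inverse_eq_0 that by blast
  have "invert_qt (x + y) = invert_qt x + invert_qt y \<and> invert_qt (x * y) = invert_qt x * invert_qt y" for x y
  proof -
    obtain a b c d where ab: "b \<noteq> 0" "x = to_fract a / to_fract b" and cd: "d \<noteq> 0" "y = to_fract c / to_fract d"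
      using ex by meson
    have bd: "b * d \<noteq> 0" using ab cd by simp
    have sum: "x + y = to_fract (a * d + c * b) / to_fract (b * d)"
      using ab cd by (simp add: add_frac_eq)
    have prod: "x * y = to_fract (a * c) / to_fract (b * d)"
      using ab cd by simp
    have "invert_qt (x + y) = ?e (a * d + c * b) / ?e (b * d)"
      unfolding sum by (rule invert_qt_divide[OF bd])
    moreover have "invert_qt (x * y) = ?e (a * c) / ?e (b * d)"
      unfolding prod by (rule invert_qt_divide[OF bd])
    moreover have "invert_qt x = ?e a / ?e b"
      unfolding ab(2) by (rule invert_qt_divide[OF ab(1)])
    moreover have "invert_qt y = ?e c / ?e d"
      unfolding cd(2) by (rule invert_qt_divide[OF cd(1)])
    ultimately show ?thesis
      using nz[OF ab(1)] nz[OF cd(1)] by (simp add: e add_frac_eq)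
  qed
  moreover have "invert_qt 0 = 0" "invert_qt 1 = 1"
    using invert_qt_divide[of 1 0] invert_qt_divide[of 1 1] by (simp_all add: e)
  ultimately show ?thesis by (simp add: rhom_def)
qed

lemma invert_qt_q_var: "invert_qt q_var = inverse q_var"
proof -
  have "map_poly (eval_t y) [:0, 1:] = [:0, 1:]" for y
    by (simp add: map_poly_pCons rhom_simps[OF rhom_eval_t] one_pCons[symmetric])
  then have "eval_qt [:0, 1:] x y = x" for x y
    by (simp add: eval_qt_eq)
  then show ?thesis
    using invert_qt_divide[of 1 "[:0, 1:]"] by (simp add: q_var_def rhom_simps[OF rhom_eval_qt])
qed

lemma invert_qt_t_var: "invert_qt t_var = inverse t_var"
proof -
  have "eval_t y [:0, 1:] = y" for y
    by (simp add: eval_t_def map_poly_pCons one_pCons[symmetric])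
  then have "eval_qt [:[:0, 1:]:] x y = y" for x y
    by (simp add: eval_qt_eq map_poly_pCons rhom_simps[OF rhom_eval_t])
  then show ?thesis
    using invert_qt_divide[of 1 "[:[:0, 1:]:]"] by (simp add: t_var_def rhom_simps[OF rhom_eval_qt])
qed

lemma q_t_var_power_inject:
  assumes "q_var ^ a * t_var ^ b = q_var ^ c * t_var ^ d"
  shows "a = c \<and> b = d"
proof -
  have m: "q_var ^ a * t_var ^ b = to_fract (monom (monom 1 b) a)" for a b
    unfolding q_var_power t_var_power to_fract_mult[symmetric] by (simp add: smult_monom mult.commute[of _ "[:_:]"])
  have eq: "monom (monom (1::rat) b) a = monom (monom 1 d) c"
    using assms unfolding m by (simp only: to_fract_eq_iff)
  have "a = c"
    using arg_cong[OF eq, of degree] by (simp add: degree_monom_eq)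
  moreover from this have "monom (1::rat) b = monom 1 d"
    using arg_cong[OF eq, of "\<lambda>p. coeff p c"] by simp
  then have "b = d"
    by (metis degree_monom_eq one_neq_zero)
  ultimately show ?thesis by blast
qed

lemma q_t_var_independent:
  assumes "q_var powi a * t_var powi b = 1"
  shows "a = 0 \<and> b = 0"
proof -
  \<comment> \<open>Integer exponents are split into positive and negative parts, which turns the
    relation into an equality of two monomials.\<close>
  have split: "x powi a = x ^ nat a / x ^ nat (- a)" if "x \<noteq> 0" for x :: ratfun_qt and a
    by (cases "a \<ge> 0") (auto simp: power_int_def divide_inverse power_inverse)
  have "q_var ^ nat a * t_var ^ nat b = q_var ^ nat (- a) * t_var ^ nat (- b)"
    using assms by (simp add: split divide_simps mult_ac)
  from q_t_var_power_inject[OF this] show ?thesis by linarith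
qed

section \<open>Transport along field homomorphisms\<close>

context
  fixes \<sigma> :: "'a::field \<Rightarrow> 'b::field"
  assumes \<sigma>: "rhom \<sigma>"
begin

abbreviation (input) "map_coeffs \<equiv> (Poly_Mapping.map \<sigma> :: 'a mpoly \<Rightarrow> 'b mpoly)"

lemma lookup_map_coeffs: "Poly_Mapping.lookup (map_coeffs f) m = \<sigma> (Poly_Mapping.lookup f m)"
  by (simp add: map.rep_eq when_def rhom_simps[OF \<sigma>])

lemma map_coeffs_add: "map_coeffs (f + g) = map_coeffs f + map_coeffs g"
  by (rule poly_mapping_eqI) (simp add: lookup_map_coeffs lookup_add rhom_simps[OF \<sigma>])

lemma map_coeffs_diff: "map_coeffs (f - g) = map_coeffs f - map_coeffs g"
  by (rule poly_mapping_eqI) (simp add: lookup_map_coeffs lookup_minus rhom_simps[OF \<sigma>])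

lemma map_coeffs_single: "map_coeffs (Poly_Mapping.single m c) = Poly_Mapping.single m (\<sigma> c)"
  by (rule poly_mapping_eqI) (simp add: lookup_map_coeffs lookup_single when_def rhom_simps[OF \<sigma>])

lemma map_coeffs_0: "map_coeffs 0 = 0"
  by (rule poly_mapping_eqI) (simp add: lookup_map_coeffs rhom_simps[OF \<sigma>])

lemma map_coeffs_mult: "map_coeffs (f * g) = map_coeffs f * map_coeffs g"
proof (induction f rule: poly_mapping_additive_induct)
  case (single m c)
  show ?case
    by (induction g rule: poly_mapping_additive_induct)
      (simp_all add: map_coeffs_0 mult_single map_coeffs_single map_coeffs_add distrib_left rhom_simps[OF \<sigma>])
qed (simp_all add: map_coeffs_0 map_coeffs_add distrib_right)

lemma map_coeffs_Const: "map_coeffs (Const c) = Const (\<sigma> c)"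
  by (simp add: Const_def map_coeffs_single)

lemma map_coeffs_zvar: "map_coeffs (zvar j) = zvar j"
  by (simp add: zvar_def map_coeffs_single rhom_simps[OF \<sigma>])

lemma rhom_map_coeffs: "rhom map_coeffs"
  using map_coeffs_Const[of 1] by (simp add: rhom_def map_coeffs_0 map_coeffs_add map_coeffs_mult rhom_simps[OF \<sigma>])

lemma map_coeffs_subst: "map_coeffs (subst_vars \<rho> f) = subst_vars (\<lambda>j. map_coeffs (\<rho> j)) (map_coeffs f)"
  by (induction f rule: mpoly_induct)
    (simp_all add: subst_vars_hom map_coeffs_add map_coeffs_mult map_coeffs_Const map_coeffs_zvar)

lemma map_coeffs_s_op: "map_coeffs (s_op i f) = s_op i (map_coeffs f)"
  by (simp add: s_op_eq map_coeffs_subst map_coeffs_zvar)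

lemma map_coeffs_tau_op: "map_coeffs (tau_op q f) = tau_op (\<sigma> q) (map_coeffs f)"
proof -
  have "map_coeffs (if j = 1 then Const q * zvar 1 else zvar j) = (if j = 1 then Const (\<sigma> q) * zvar 1 else zvar j)" for j
    by (simp add: map_coeffs_mult map_coeffs_Const map_coeffs_zvar)
  then show ?thesis by (simp add: tau_op_def map_coeffs_subst)
qed

lemma map_coeffs_foldr:
  assumes "\<And>x f. x \<in> set xs \<Longrightarrow> map_coeffs (F x f) = G x (map_coeffs f)"
  shows "map_coeffs (foldr F xs f) = foldr G xs (map_coeffs f)"
  using assms by (induction xs) auto

lemma map_coeffs_omega_op: "map_coeffs (omega_op n q f) = omega_op n (\<sigma> q) (map_coeffs f)"
  unfolding omega_op_def map_coeffs_tau_op[symmetric] by (rule map_coeffs_foldr) (rule map_coeffs_s_op)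

text \<open>The definite description in \<open>T_op\<close> offers nothing to map through; the
  equation with cleared denominator does, and cancellation in the target ring brings the result
  back.\<close>

lemma map_coeffs_T_op: "map_coeffs (T_op t i f) = T_op (\<sigma> t) i (map_coeffs f)"
proof (rule zvar_diff_cancel[of i])
  have "(zvar i - zvar (Suc i)) * map_coeffs (T_op t i f) = map_coeffs ((zvar i - zvar (Suc i)) * T_op t i f)"
    by (simp only: map_coeffs_mult map_coeffs_diff map_coeffs_zvar)
  also have "\<dots> = (zvar i - zvar (Suc i)) * T_op (\<sigma> t) i (map_coeffs f)"
    unfolding T_op_mult_diff
    by (simp only: map_coeffs_add map_coeffs_mult map_coeffs_diff map_coeffs_zvar map_coeffs_Const map_coeffs_s_op)
  finally show "(zvar i - zvar (Suc i)) * map_coeffs (T_op t i f) = (zvar i - zvar (Suc i)) * T_op (\<sigma> t) i (map_coeffs f)" .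
qed

lemma rhom_inverse: "\<sigma> (inverse x) = inverse (\<sigma> x)"
proof (cases "x = 0")
  case False
  then have "\<sigma> x * \<sigma> (inverse x) = 1"
    by (simp add: rhom_simps[OF \<sigma>, symmetric])
  then show ?thesis by (metis inverse_unique)
qed (simp add: rhom_simps[OF \<sigma>])

lemma rhom_nz: "x \<noteq> 0 \<Longrightarrow> \<sigma> x \<noteq> 0"
  using rhom_simps(4)[OF \<sigma>, of x "inverse x"] rhom_simps(2)[OF \<sigma>] by auto

lemma rhom_power_int: "\<sigma> (x powi k) = \<sigma> x powi k"
  by (simp add: power_int_def rhom_power[OF \<sigma>] rhom_inverse)

lemma map_coeffs_T_inv: "map_coeffs (T_inv t i f) = T_inv (\<sigma> t) i (map_coeffs f)"
  using map_coeffs_Const[of 1]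
  by (simp add: T_inv_def map_coeffs_mult map_coeffs_add map_coeffs_diff map_coeffs_Const map_coeffs_T_op rhom_inverse
      rhom_simps[OF \<sigma>])

text \<open>\<open>inv\<close> of an operator has no formula that could be transported, so it is
  replaced on both sides by the explicit \<open>T_inv\<close>; this uses that t and its image are
  nonzero.\<close>

lemma map_coeffs_Y_op:
  assumes "t \<noteq> 0"
  shows "map_coeffs (Y_op n q t i f) = Y_op n (\<sigma> q) (\<sigma> t) i (map_coeffs f)"
proof -
  have "map_coeffs (foldr (T_inv t) xs f) = foldr (T_inv (\<sigma> t)) xs (map_coeffs f)" for xs f
    by (rule map_coeffs_foldr) (rule map_coeffs_T_inv)
  moreover have "map_coeffs (foldr (T_op t) xs f) = foldr (T_op (\<sigma> t)) xs (map_coeffs f)" for xs f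
    by (rule map_coeffs_foldr) (rule map_coeffs_T_op)
  ultimately show ?thesis
    using assms rhom_nz[OF assms]
    by (simp add: Y_op_def inv_T_op map_coeffs_mult map_coeffs_Const rhom_power_int map_coeffs_omega_op)
qed

lemma map_coeffs_zpow: "map_coeffs (zpow n \<nu>) = zpow n \<nu>"
proof -
  have "map_coeffs (\<Prod>j\<in>S. g j) = (\<Prod>j\<in>S. map_coeffs (g j))" for S and g :: "nat \<Rightarrow> 'a mpoly"
    by (induction S rule: infinite_finite_induct) (simp_all add: rhom_simps[OF rhom_map_coeffs])
  then show ?thesis
    by (simp add: zpow_def rhom_power[OF rhom_map_coeffs] map_coeffs_zvar)
qed

lemma is_macdonald_map_coeffs:
  assumes t: "t \<noteq> 0" and E: "is_macdonald n q t \<eta> E"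
  shows "is_macdonald n (\<sigma> q) (\<sigma> t) \<eta> (map_coeffs E)"
  unfolding is_macdonald_def
proof
  have bar: "\<sigma> (eta_bar n q t \<eta> i) = eta_bar n (\<sigma> q) (\<sigma> t) \<eta> i" for i
    by (simp add: eta_bar_def rhom_simps[OF \<sigma>] rhom_power[OF \<sigma>] rhom_power_int)
  show "\<forall>i\<in>{1..n}. Y_op n (\<sigma> q) (\<sigma> t) i (map_coeffs E) = Const (eta_bar n (\<sigma> q) (\<sigma> t) \<eta> i) * map_coeffs E"
  proof
    fix i assume "i \<in> {1..n}"
    then have "map_coeffs (Y_op n q t i E) = map_coeffs (Const (eta_bar n q t \<eta> i) * E)"
      using E by (simp add: is_macdonald_def)
    then show "Y_op n (\<sigma> q) (\<sigma> t) i (map_coeffs E) = Const (eta_bar n (\<sigma> q) (\<sigma> t) \<eta> i) * map_coeffs E"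
      by (simp add: map_coeffs_Y_op[OF t] map_coeffs_mult map_coeffs_Const bar)
  qed
  obtain b where b: "E = zpow n \<eta> + (\<Sum>\<nu> | \<nu> \<in> compositions n \<and> comp_prec n \<nu> \<eta>. Const (b \<nu>) * zpow n \<nu>)"
    using E by (auto simp: is_macdonald_def)
  have "map_coeffs E = zpow n \<eta> + (\<Sum>\<nu> | \<nu> \<in> compositions n \<and> comp_prec n \<nu> \<eta>. Const (\<sigma> (b \<nu>)) * zpow n \<nu>)"
    unfolding b by (simp add: map_coeffs_add rhom_sum[OF rhom_map_coeffs] map_coeffs_mult map_coeffs_Const map_coeffs_zpow)
  then show "\<exists>b. map_coeffs E = zpow n \<eta> + (\<Sum>\<nu> | \<nu> \<in> compositions n \<and> comp_prec n \<nu> \<eta>. Const (b \<nu>) * zpow n \<nu>)"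
    by (intro exI[of _ "\<lambda>\<nu>. \<sigma> (b \<nu>)"])
qed

end

lemma pieri_q_t_var: "n \<ge> 1 \<Longrightarrow> pieri n q_var t_var"
proof unfold_locales
  fix a b assume "inverse q_var powi a * inverse t_var powi b = 1"
  then have "q_var powi (- a) * t_var powi (- b) = 1"
    by (simp add: power_int_minus power_int_inverse)
  from q_t_var_independent[OF this] show "a = 0 \<and> b = 0" by simp
qed (use q_t_var_independent in auto)

text \<open>The image of the polynomial under coefficientwise inversion satisfies the defining
  conditions at 1/q, 1/t, and uniqueness there identifies it.\<close>

lemma macdonald_inv_eq:
  assumes n: "n \<ge> 1" and \<eta>: "\<eta> \<in> compositions n"
  shows "macdonald_inv n \<eta> = generic.E n (inverse q_var) (inverse t_var) \<eta>"
proof -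
  interpret pieri n q_var t_var by (rule pieri_q_t_var[OF n])
  have "macdonald n \<eta> = E \<eta>"
    unfolding macdonald_def is_macdonald_iff[OF \<eta>] by simp
  then have "is_macdonald n q_var t_var \<eta> (macdonald n \<eta>)"
    by (simp add: is_macdonald_iff[OF \<eta>])
  from is_macdonald_map_coeffs[OF rhom_invert_qt t_var_nz this]
  have "is_macdonald n (inverse q_var) (inverse t_var) \<eta> (macdonald_inv n \<eta>)"
    by (simp only: invert_qt_q_var invert_qt_t_var macdonald_inv_def)
  then show ?thesis by (simp only: dual.is_macdonald_iff[OF \<eta>])
qed

theorem proposition7:
  fixes n i :: nat and \<eta> :: "nat \<Rightarrow> nat"
  assumes "n \<ge> 1" and "\<eta> \<in> compositions n" and "i \<in> {1..n}"
  shows "zvar i * macdonald_inv n \<eta> =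
    (\<Sum>I | I \<in> maximal_sets n \<eta> \<and> i \<in> I.
       Const (chi_coef q_var t_var I i (eta_bar n q_var t_var \<eta>) *
              A_coef q_var t_var I (eta_bar n q_var t_var \<eta>) *
              B_coef n q_var t_var I (eta_bar n q_var t_var \<eta>) *
              k_const n q_var t_var \<eta> / k_const n q_var t_var (c_comp I \<eta>)) *
       macdonald_inv n (c_comp I \<eta>))"
proof -
  interpret pieri n q_var t_var by (rule pieri_q_t_var[OF assms(1)])
  show ?thesis
    unfolding macdonald_inv_eq[OF assms(1,2)] pieri_formula[OF assms(2,3)]
  proof (rule sum.cong)
    fix I assume "I \<in> {I. I \<in> maximal_sets n \<eta> \<and> i \<in> I}"
    then have "c_comp I \<eta> \<in> compositions n"
      using assms(2) by (intro c_comp_in_compositions) (auto simp: maximal_sets_def)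
    from macdonald_inv_eq[OF assms(1) this]
    show "Const (chi_coef q_var t_var I i (bar \<eta>) * A_coef q_var t_var I (bar \<eta>) * B_coef n q_var t_var I (bar \<eta>) *
          k_const n q_var t_var \<eta> / k_const n q_var t_var (c_comp I \<eta>)) * dual.E (c_comp I \<eta>) =
        Const (chi_coef q_var t_var I i (bar \<eta>) * A_coef q_var t_var I (bar \<eta>) * B_coef n q_var t_var I (bar \<eta>) *
          k_const n q_var t_var \<eta> / k_const n q_var t_var (c_comp I \<eta>)) * macdonald_inv n (c_comp I \<eta>)"
      by simp
  qed simp
qed

end
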